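(* Let $Z=G/P$ be the flag manifold of a symmetric dimension sequence $(d_1,\dots,d_s,d_s,\dots,d_1)$ or $(d_1,\dots,d_s,e',d_s,\dots,d_1)$, $G=SL(n,\mathbb{C})$, let $D\subset Z$ be an open $SL(n,\mathbb{R})$-orbit with base cycle $C_0$, and let $w=B_1B_2\dots B_sB_{e'}\tilde B_s\dots\tilde B_2\tilde B_1$ be a minimal representative ($B_{e'}$ omitted for the first type of sequence). Then $w$ satisfies the generalized double box contraction condition if and only if $w$ parametrizes an Iwasawa–Schubert variety $S_w\in\mathcal{S}_{C_0}$; and the lifting map $f:\mathcal{S}_{C_0}\to\mathcal{S}_{\hat C_0}$ defined by $S_w\mapsto S_{\hat w}$, where $\hat w$ is the canonical rearrangement of $w$, is injective.
   Context: Let $G=SL(n,\mathbb{C})$, $G_0=SL(n,\mathbb{R})$, $K_0=SO(n,\mathbb{R})$, $B$ the upper triangular Borel subgroup. For a dimension sequence $(d_1,\dots,d_r)$ with sum $n$, $P\supset B$ is the block upper triangular parabolic subgroup with these block sizes and $Z=G/P$ is the manifold of flags $0\subset V_1\subset\dots\subset V_r=\mathbb{C}^n$ with $\dim V_i/V_{i-1}=d_i$. Let $\hat Z=G/B$ and $\pi:\hat Z\to Z$ the projection. The base cycle of an open $G_0$-orbit is the unique $K_0$-orbit in it that is a complex submanifold. $\hat D\subset\hat Z$ is an open $G_0$-orbit with $\pi(\hat D)=D$ and $\hat C_0$ is its base cycle. Schubert varieties in $Z$ are indexed by minimal representatives: permutations $w$ (one-line notation) whose entries increase inside each consecutive block of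 sizes $d_1,\dots,d_r$; $S_w$ is the closure of $B.\pi(V_w)$, where $V_w$ is the complete flag with $k$-th subspace $\langle e_{w(1)},\dots,e_{w(k)}\rangle$. In $\hat Z$, $S_w$ is the closure of $B.V_w$ for any $w\in\Sigma_n$. (These are the Iwasawa–Schubert varieties, as $B$ contains the component $A_0N_0$ of an Iwasawa decomposition of $G_0$.) $\mathcal{S}_{C_0}$ is the set of Schubert varieties $S_w\subset Z$ with $\dim S_w+\dim C_0=\dim Z$ and $S_w\cap C_0\neq\emptyset$; $\mathcal{S}_{\hat C_0}$ is defined likewise in $\hat Z$. For the symmetric sequences, $w$ is divided into blocks $B_1,\dots,B_s,(B_{e'}),\tilde B_s,\dots,\tilde B_1$, with $B_j,\tilde B_j$ of length $d_j$ and $B_{e'}$ of length $e'$. Generalized double box contraction condition: $w$ is constructed as follows. Choose $d_1$ (disjoint) pairs $(l_i^1,k_i^1)$ of consecutive numbers ($k_i^1=l_i^1+1$) in $\{1,\dots,n\}$; $B_1$ consists of the $k_i^1$ and $\tilde B_1$ of the $l_i^1$. Once $B_1,\tilde B_1,\dots,B_j,\tilde B_j$ are chosen, choose $d_{j+1}$ (disjoint) pairs $(l_i^{j+1},k_i^{j+1})$ in the ordered set $\{1,\dots,n\}\setminus\bigcup_{i\le j}(B_i\cup\tilde B_i)$ such that $l_i^{j+1}$ is at the immediate left of $k_i^{j+1}$ in this ordered set for all $i$; $B_{j+1}$ consists of the $k_i^{j+1}$ and $\tilde B_{j+1}$ of the $l_i^{j+1}$. The remaining elements, if any, form $B_{e'}$.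 (All blocks are written in increasing order.) Canonical rearrangement $\hat w$ of $w$: keep each $B_j$, replace each $\tilde B_j=l^j_1\dots l^j_{d_j}$ by $l^j_{d_j}l^j_{d_j-1}\dots l^j_1$, and, if present, replace $B_{e'}=l'_1\dots l'_{e'}$ by $l'_{e'/2+1}l'_{e'/2+2}\dots l'_{e'}\,l'_1\dots l'_{e'/2}$ if $e'$ is even and by $l'_{(e'+1)/2+1}\dots l'_{e'}\,l'_1\dots l'_{(e'+1)/2}$ if $e'$ is odd. *)

theory Defs
  imports "HOL-Analysis.Analysis" "HOL-Combinatorics.Multiset_Permutations"
begin

text \<open>
  The index set \<open>{1,\<dots>,n}\<close> is an arbitrary finite linearly ordered type \<open>'n\<close> with
  \<open>n = CARD('n)\<close>; it is order isomorphic to \<open>{1,\<dots>,n}\<close> in exactly one way. The standard basis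
  vector \<open>e\<^sub>i\<close> is \<open>axis i 1\<close>, and one-line notation is a list over \<open>'n\<close>.
\<close>

section \<open>The groups\<close>

definition SL_C :: "(complex^'n^'n) set" where
  "SL_C = {A. det A = 1}"

definition SL_R :: "(complex^'n^'n) set" where
  "SL_R = {A. det A = 1 \<and> (\<forall>i j. A $ i $ j \<in> \<real>)}"

definition SO_R :: "(complex^'n^'n) set" where
  "SO_R = {A \<in> SL_R. orthogonal_matrix A}"

definition Borel :: "(complex^'n::{finite,linorder}^'n::{finite,linorder}) set" where
  "Borel = {A \<in> SL_C. \<forall>i j. j < i \<longrightarrow> A $ i $ j = 0}"


section \<open>Flag manifolds\<close>

text \<open>A flag \<open>0 \<subset> V\<^sub>1 \<subset> \<dots> \<subset> V\<^sub>r\<close> is the list \<open>[V\<^sub>1, \<dots>, V\<^sub>r]\<close>.\<close>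

type_synonym 'n flag = "(complex^'n) set list"

definition flags :: "nat list \<Rightarrow> 'n::finite flag set" where
  "flags dims = {F. length F = length dims \<and> sorted_wrt (\<subseteq>) F \<and>
     (\<forall>i < length dims. vec.subspace (F ! i) \<and> vec.dim (F ! i) = sum_list (take (Suc i) dims))}"

definition act :: "complex^'n^'n \<Rightarrow> 'n flag \<Rightarrow> 'n flag" where
  "act g F = map (\<lambda>V. (*v) g ` V) F"

definition orbit :: "(complex^'n^'n) set \<Rightarrow> 'n flag \<Rightarrow> 'n flag set" where
  "orbit H F = (\<lambda>g. act g F) ` H"

definition coord_flag :: "'n::finite list \<Rightarrow> 'n flag" where
  "coord_flag w = map (\<lambda>k. vec.span ((\<lambda>i. axis i 1) ` set (take k w))) [1..<Suc (length w)]"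

text \<open>The projection \<open>\<pi>\<close> from complete flags; list position \<open>k - 1\<close> holds the \<open>k\<close>-dimensional space.\<close>

definition flag_proj :: "nat list \<Rightarrow> 'n::finite flag \<Rightarrow> 'n flag" where
  "flag_proj dims F = map (\<lambda>i. F ! (sum_list (take (Suc i) dims) - 1)) [0..<length dims]"

text \<open>The flag whose stabiliser in \<open>SL(n,\<complex>)\<close> is the block upper triangular parabolic \<open>P\<close>.\<close>

definition base_flag :: "nat list \<Rightarrow> 'n::{finite,linorder} flag" where
  "base_flag dims = flag_proj dims (coord_flag (sorted_list_of_set UNIV))"

text \<open>The quotient topology of \<open>G/P\<close>, via the orbit map of the base flag.\<close>

definition flag_top :: "nat list \<Rightarrow> 'n::{finite,linorder} flag topology" where
  "flag_top dims = topology (\<lambda>U. U \<subseteq> flags dims \<and>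
     openin (top_of_set SL_C) {g \<in> SL_C. act g (base_flag dims) \<in> U})"

lemma openin_flag_top:
  fixes U :: "'n::{finite,linorder} flag set"
  shows "openin (flag_top dims) U \<longleftrightarrow> U \<subseteq> flags dims \<and>
     openin (top_of_set SL_C) {g \<in> SL_C. act g (base_flag dims) \<in> U}"
proof -
  let ?pre = "\<lambda>U :: 'n flag set. {g \<in> SL_C. act g (base_flag dims) \<in> U}"
  have "istopology (\<lambda>U :: 'n flag set. U \<subseteq> flags dims \<and> openin (top_of_set SL_C) (?pre U))"
    unfolding istopology_def
  proof (intro conjI allI impI)
    fix S T :: "'n flag set" assume S: "S \<subseteq> flags dims \<and> openin (top_of_set SL_C) (?pre S)"
      and T: "T \<subseteq> flags dims \<and> openin (top_of_set SL_C) (?pre T)"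
    then show "S \<inter> T \<subseteq> flags dims" by blast
    have "?pre (S \<inter> T) = ?pre S \<inter> ?pre T" by blast
    moreover have "openin (top_of_set SL_C) (?pre S \<inter> ?pre T)"
      by (rule openin_Int) (use S T in blast)+
    ultimately show "openin (top_of_set SL_C) (?pre (S \<inter> T))" by (simp only:)
  next
    fix K :: "'n flag set set" assume K: "\<forall>S\<in>K. S \<subseteq> flags dims \<and> openin (top_of_set SL_C) (?pre S)"
    then show "\<Union>K \<subseteq> flags dims" by blast
    have "?pre (\<Union>K) = \<Union> (?pre ` K)" by blast
    moreover have "openin (top_of_set SL_C) (\<Union> (?pre ` K))"
      by (rule openin_Union) (use K in blast)
    ultimately show "openin (top_of_set SL_C) (?pre (\<Union>K))" by (simp only:)
  qed
  then show ?thesis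
    unfolding flag_top_def by (simp only: topology_inverse')
qed


section \<open>Complex submanifolds and dimension\<close>

definition holomorphic_map_on :: "(complex^'m::finite \<Rightarrow> complex^'k::finite) \<Rightarrow> (complex^'m) set \<Rightarrow> bool" where
  "holomorphic_map_on f U \<longleftrightarrow> (\<forall>x\<in>U. \<exists>f'. Vector_Spaces.linear (*s) (*s) f' \<and>
     (f has_derivative f') (at x within U))"

definition biholomorphism :: "(complex^'m::finite) set \<Rightarrow> (complex^'m) set \<Rightarrow>
    (complex^'m \<Rightarrow> complex^'m) \<Rightarrow> (complex^'m \<Rightarrow> complex^'m) \<Rightarrow> bool" where
  "biholomorphism U V h k \<longleftrightarrow> h ` U = V \<and> k ` V = U \<and>
     (\<forall>x\<in>U. k (h x) = x) \<and> (\<forall>y\<in>V. h (k y) = y) \<and>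
     holomorphic_map_on h U \<and> holomorphic_map_on k V"

text \<open>
  \<open>d\<close>-dimensional (embedded) complex submanifolds of a complex vector space \<open>E\<close>, by local
  straightening. \<open>E\<close> is a linear subspace of some \<open>\<complex>\<^sup>m\<close>, since the dimension of a flag
  manifold is not available as a type.
\<close>

definition complex_submanifold_of :: "(complex^'m::finite) set \<Rightarrow> nat \<Rightarrow> (complex^'m) set \<Rightarrow> bool" where
  "complex_submanifold_of E d S \<longleftrightarrow> S \<subseteq> E \<and>
     (\<forall>x\<in>S. \<exists>U V h k L. openin (top_of_set E) U \<and> openin (top_of_set E) V \<and> x \<in> U \<and>
        biholomorphism U V h k \<and>
        vec.subspace L \<and> L \<subseteq> E \<and> vec.dim L = d \<and> h ` (S \<inter> U) = L \<inter> V)"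

text \<open>
  The holomorphic atlas of \<open>G/P\<close>: strictly block lower triangular matrices \<open>X\<close> (entries indexed
  by pairs) form a complex vector space, and \<open>X \<mapsto> g (1 + X) P\<close> is, for every \<open>g \<in> G\<close>, the inverse
  of a chart onto it. The number \<open>card {..<i}\<close> is the zero-based position of \<open>i\<close> in the order of
  \<open>'n\<close>.
\<close>

definition chart_space :: "nat list \<Rightarrow> (complex^('n::{finite,linorder} \<times> 'n::{finite,linorder})) set" where
  "chart_space dims = {X. \<forall>i j. X $ (i, j) \<noteq> 0 \<longrightarrow>
     (\<exists>r < length dims. card {..<j} < sum_list (take r dims) \<and> sum_list (take r dims) \<le> card {..<i})}"

definition chart_param ::
  "nat list \<Rightarrow> complex^'n::{finite,linorder}^'n::{finite,linorder} \<Rightarrow> complex^('n \<times> 'n) \<Rightarrow> 'n flag" where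
  "chart_param dims g X = act (g ** (mat 1 + (\<chi> i j. X $ (i, j)))) (base_flag dims)"

definition complex_submanifold :: "nat list \<Rightarrow> nat \<Rightarrow> 'n::{finite,linorder} flag set \<Rightarrow> bool" where
  "complex_submanifold dims d M \<longleftrightarrow> M \<subseteq> flags dims \<and>
     (\<forall>g\<in>SL_C. complex_submanifold_of (chart_space dims) d
        {X \<in> chart_space dims. chart_param dims g X \<in> M})"

text \<open>
  The dimension of an irreducible analytic set is that of a complex submanifold which is open and
  dense in it (for instance its regular locus, or the open orbit in an orbit closure). This covers
  the flag manifold, its complex submanifolds of constant dimension, and Schubert varieties.
\<close>

definition complex_dim :: "nat list \<Rightarrow> 'n::{finite,linorder} flag set \<Rightarrow> nat" where
  "complex_dim dims A = (THE d. \<exists>M. openin (subtopology (flag_top dims) A) M \<and>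
     A \<subseteq> (flag_top dims) closure_of M \<and> complex_submanifold dims d M)"


section \<open>Open orbits, base cycles and Schubert varieties\<close>

definition open_orbit :: "nat list \<Rightarrow> 'n::{finite,linorder} flag set \<Rightarrow> bool" where
  "open_orbit dims D \<longleftrightarrow> (\<exists>F \<in> flags dims. D = orbit SL_R F) \<and> openin (flag_top dims) D"

text \<open>By a theorem of Wolf, \<open>base_cycle dims D\<close> holds of exactly one set when \<open>D\<close> is an open orbit.\<close>

definition base_cycle :: "nat list \<Rightarrow> 'n::{finite,linorder} flag set \<Rightarrow> 'n flag set \<Rightarrow> bool" where
  "base_cycle dims D C \<longleftrightarrow> (\<exists>F \<in> D. C = orbit SO_R F) \<and> C \<subseteq> D \<and>
     (\<exists>d. complex_submanifold dims d C)"

text \<open>Cutting a list into consecutive blocks of prescribed lengths.\<close>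

fun blocks :: "nat list \<Rightarrow> 'a list \<Rightarrow> 'a list list" where
  "blocks [] w = []"
| "blocks (d # ds) w = take d w # blocks ds (drop d w)"

definition minimal_rep :: "nat list \<Rightarrow> 'n::{finite,linorder} list \<Rightarrow> bool" where
  "minimal_rep dims w \<longleftrightarrow> w \<in> permutations_of_set UNIV \<and> (\<forall>b \<in> set (blocks dims w). sorted b)"

definition schubert :: "nat list \<Rightarrow> 'n::{finite,linorder} list \<Rightarrow> 'n flag set" where
  "schubert dims w = (flag_top dims) closure_of (orbit Borel (flag_proj dims (coord_flag w)))"

definition dual_schubert_varieties ::
  "nat list \<Rightarrow> 'n::{finite,linorder} flag set \<Rightarrow> 'n flag set set" where
  "dual_schubert_varieties dims C = {schubert dims w | w. minimal_rep dims w \<and>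
     complex_dim dims (schubert dims w) + complex_dim dims C
       = complex_dim dims (flags dims :: 'n flag set) \<and>
     schubert dims w \<inter> C \<noteq> {}}"


section \<open>Symmetric sequences\<close>

text \<open>
  \<open>(d\<^sub>1,\<dots>,d\<^sub>s,d\<^sub>s,\<dots>,d\<^sub>1)\<close> for \<open>e = 0\<close> and \<open>(d\<^sub>1,\<dots>,d\<^sub>s,e,d\<^sub>s,\<dots>,d\<^sub>1)\<close> for \<open>e > 0\<close>.
\<close>

definition sym_dims :: "nat list \<Rightarrow> nat \<Rightarrow> nat list" where
  "sym_dims ds e = ds @ (if e = 0 then [] else [e]) @ rev ds"

text \<open>With zero-based \<open>j\<close>, these are the blocks \<open>B\<^sub>j\<^sub>+\<^sub>1\<close>, its mirror block (with tilde), and the middle block.\<close>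

definition left_block :: "nat list \<Rightarrow> nat \<Rightarrow> 'a list \<Rightarrow> nat \<Rightarrow> 'a list" where
  "left_block ds e w j = blocks (sym_dims ds e) w ! j"

definition right_block :: "nat list \<Rightarrow> nat \<Rightarrow> 'a list \<Rightarrow> nat \<Rightarrow> 'a list" where
  "right_block ds e w j = rev (blocks (sym_dims ds e) w) ! j"

definition middle_block :: "nat list \<Rightarrow> nat \<Rightarrow> 'a list \<Rightarrow> 'a list" where
  "middle_block ds e w = (if e = 0 then [] else blocks (sym_dims ds e) w ! length ds)"

definition immediate_left :: "'a::linorder set \<Rightarrow> 'a \<Rightarrow> 'a \<Rightarrow> bool" where
  "immediate_left R l k \<longleftrightarrow> l \<in> R \<and> k \<in> R \<and> l < k \<and> \<not> (\<exists>m\<in>R. l < m \<and> m < k)"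

text \<open>For \<open>j = 0\<close> the set \<open>R\<close> below is all of \<open>{1,\<dots>,n}\<close>, and \<open>immediate_left\<close> means \<open>k = l + 1\<close>.\<close>

definition generalized_double_box_contraction ::
  "nat list \<Rightarrow> nat \<Rightarrow> 'n::{finite,linorder} list \<Rightarrow> bool" where
  "generalized_double_box_contraction ds e w \<longleftrightarrow> (\<forall>j < length ds.
     let R = UNIV - (\<Union>i<j. set (left_block ds e w i) \<union> set (right_block ds e w i))
     in \<exists>prs :: ('n \<times> 'n) set. card prs = ds ! j \<and>
          (\<forall>(l, k) \<in> prs. immediate_left R l k) \<and>
          pairwise (\<lambda>(l, k) (l', k'). disjnt {l, k} {l', k'}) prs \<and>
          set (left_block ds e w j) = snd ` prs \<and>
          set (right_block ds e w j) = fst ` prs)"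

definition canonical_rearrangement :: "nat list \<Rightarrow> nat \<Rightarrow> 'a list \<Rightarrow> 'a list" where
  "canonical_rearrangement ds e w =
     (let m = middle_block ds e w; h = (if even e then e div 2 else (e + 1) div 2)
      in concat (map (left_block ds e w) [0..<length ds])
         @ (drop h m @ take h m)
         @ concat (map (\<lambda>j. rev (right_block ds e w j)) (rev [0..<length ds])))"

end

theory Submission
  imports Defs
begin

text \<open>
  An open orbit contains flags with \<open>V\<^sub>i \<inter> conj V\<^sub>r\<^sub>-\<^sub>i = 0\<close>, and hence only such flags. On the
  base cycle the functions \<open>trace (P\<^sub>i conj P\<^sub>j)\<close> of the orthogonal projections \<open>P\<^sub>i\<close> onto
  \<open>V\<^sub>i\<close> are constant; as its tangent spaces are complex, the derivatives in imaginary directions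
  vanish as well, and together with general position this forces \<open>V\<^sub>r\<^sub>-\<^sub>i\<close> to be the
  orthogonal complement of \<open>V\<^sub>i\<close> for the complex bilinear form. The base cycle is thus the orbit
  of an isotropic flag, whose dimension is read off its tangent space in a chart.

  The dimension of a Schubert variety is an inversion number. If \<open>S\<^sub>w\<close> meets the base cycle,
  semicontinuity of \<open>dim (V\<^sub>i \<inter> \<langle>e\<^sub>1, \<dots>, e\<^sub>k\<rangle>)\<close> bounds the number of entries at most \<open>k\<close>
  in the first \<open>i\<close> and the first \<open>r - i\<close> blocks of \<open>w\<close> by \<open>k\<close> in total. The excess of the
  inversion number over the codimension of the base cycle is a sum of terms which these bounds make
  nonnegative, and all of them vanish exactly under the contraction condition. Conversely,
  under the contraction condition the canonical rearrangement pairs mirror positions so that the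
  larger entry comes first, and the coordinate flag can be moved by the Borel group to the isotropic
  flag spanned by the vectors \<open>e\<^sub>k \<plusminus> \<i> e\<^sub>l\<close> for these pairs \<open>(l, k)\<close>.

  The pairs of the rearrangement are nested, so it satisfies the contraction condition for the
  sequence \<open>(1, \<dots>, 1)\<close>, and the second part is the first one applied to complete flags.
  Injectivity holds since the rearrangement permutes entries within blocks only.
\<close>

section \<open>Positions and coordinate subspaces\<close>

text \<open>The traces are constant on an \<open>SO_R\<close>-orbit because a real orthogonal matrix
  conjugates a projection and its complex conjugate simultaneously. The tangent space of the orbit
  contains the velocities of real antisymmetric generators; being complex, it also contains their
  multiples by \<i>, which are not velocities of curves in \<open>SO_R\<close>. Differentiating
  along such a direction is the main difficulty. A tangent vector only provides a curve of flags in
  a chart, and the group elements that carry the base point along it are chosen separately for each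
  time, without continuity. The projections along the curve are thus not known in advance to be
  differentiable, and their difference quotients are controlled by exact norm identities between
  projections of equal rank. A second obstacle is that isotropic flags are conjugate under real
  orthogonal matrices of either determinant, whereas a base cycle is an orbit of
  \<open>SO_R\<close>; the sign is repaired where a cell is made to meet the cycle. All dimensions
  are compared in the charts \<open>g (1 + X)\<close>, whose transition maps are rational by
  Cramer's rule.\<close>

type_synonym 'n cvec = "complex^'n"

type_synonym 'n cmat = "complex^'n^'n"

definition pos :: "'n::{finite,linorder} \<Rightarrow> nat" where
  "pos i = card {..<i}"

definition ini :: "nat \<Rightarrow> 'n::{finite,linorder} set" where
  "ini m = {i. pos i < m}"

definition crd :: "'n::finite set \<Rightarrow> (complex^'n) set" where
  "crd S = {x. \<forall>i. i \<notin> S \<longrightarrow> x $ i = 0}"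

definition psum :: "nat list \<Rightarrow> nat \<Rightarrow> nat" where
  "psum dims i = sum_list (take i dims)"

lemma pos_less_iff [simp]: "pos i < pos j \<longleftrightarrow> i < j"
proof -
  have *: "pos a < pos b" if "a < b" for a b :: 'a
    unfolding pos_def by (rule psubset_card_mono) (use that in auto)
  show ?thesis
    using *[of i j] *[of j i] by (metis less_asym linorder_neqE)
qed

lemma pos_le_iff [simp]: "pos i \<le> pos j \<longleftrightarrow> i \<le> j"
  by (meson leD leI pos_less_iff)

lemma pos_eq_iff [simp]: "pos i = pos j \<longleftrightarrow> i = j"
  by (metis less_irrefl linorder_neqE pos_less_iff)

lemma inj_pos: "inj_on pos A"
  by (simp add: inj_on_def)

lemma pos_less_card: "pos (i :: 'n::{finite,linorder}) < CARD('n)"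
  unfolding pos_def by (rule psubset_card_mono) auto

lemma pos_surj: "m < CARD('n) \<Longrightarrow> \<exists>i :: 'n::{finite,linorder}. pos i = m"
proof -
  have "pos ` (UNIV :: 'n set) = {..<CARD('n)}"
    by (rule card_subset_eq) (auto simp: pos_less_card card_image inj_pos)
  then show "m < CARD('n) \<Longrightarrow> \<exists>i :: 'n. pos i = m"
    by (metis imageE lessThan_iff)
qed

lemma ini_0 [simp]: "ini 0 = {}"
  by (simp add: ini_def)

lemma ini_card [simp]: "CARD('n) \<le> m \<Longrightarrow> ini m = (UNIV :: 'n::{finite,linorder} set)"
  using pos_less_card less_le_trans by (auto simp: ini_def)

lemma ini_mono: "a \<le> b \<Longrightarrow> ini a \<subseteq> ini b"
  by (auto simp: ini_def)

lemma mem_ini [simp]: "i \<in> ini m \<longleftrightarrow> pos i < m"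
  by (simp add: ini_def)

lemma card_ini: "m \<le> CARD('n) \<Longrightarrow> card (ini m :: 'n::{finite,linorder} set) = m"
proof -
  assume m: "m \<le> CARD('n)"
  have "pos ` (ini m :: 'n set) = {..<m}"
  proof
    show "{..<m} \<subseteq> pos ` (ini m :: 'n set)"
    proof
      fix k assume "k \<in> {..<m}"
      then have k: "k < m" by simp
      with m obtain i :: 'n where "pos i = k"
        using pos_surj[where ?'n='n, of k] by auto
      with k show "k \<in> pos ` (ini m :: 'n set)" by auto
    qed
  qed auto
  then show ?thesis
    by (metis card_image card_lessThan inj_pos)
qed

lemma lessThan_eq_ini: "{..<i} = ini (pos i)"
  by auto

lemma ini_Suc: "ini (Suc (pos i)) = insert i (ini (pos i))"
  by (auto simp: less_Suc_eq_le)

lemma subspace_crd [simp]: "vec.subspace (crd S)"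
  by (auto simp: vec.subspace_def crd_def)

lemma dim_crd [simp]: "vec.dim (crd S) = card S"
  unfolding crd_def by (rule dim_substandard_cart)

lemma crd_Int: "crd A \<inter> crd B = crd (A \<inter> B)"
  by (auto simp: crd_def)

lemma crd_mono: "A \<subseteq> B \<Longrightarrow> crd A \<subseteq> crd B"
  by (auto simp: crd_def)

lemma crd_UNIV [simp]: "crd UNIV = UNIV"
  by (auto simp: crd_def)

lemma axis_in_crd [simp]: "axis i 1 \<in> crd S \<longleftrightarrow> i \<in> S"
  by (auto simp: crd_def axis_def)

lemma span_axis: "vec.span ((\<lambda>i. axis i 1) ` S) = crd S"
proof
  show "vec.span ((\<lambda>i. axis i 1) ` S) \<subseteq> crd S"
    by (rule vec.span_minimal) auto
  show "crd S \<subseteq> vec.span ((\<lambda>i. axis i 1) ` S)"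
  proof
    fix x assume x: "x \<in> crd S"
    have "x = (\<Sum>i\<in>UNIV. (x$i) *s axis i 1)"
      by (rule basis_expansion [symmetric])
    also have "\<dots> = (\<Sum>i\<in>S. (x$i) *s axis i 1)"
      using x by (intro sum.mono_neutral_right) (auto simp: crd_def)
    also have "\<dots> \<in> vec.span ((\<lambda>i. axis i 1) ` S)"
      by (intro vec.span_sum vec.span_scale vec.span_base) auto
    finally show "x \<in> vec.span ((\<lambda>i. axis i 1) ` S)" .
  qed
qed

lemma subspace_image_mult: "vec.subspace V \<Longrightarrow> vec.subspace ((*v) A ` V)"
  for A :: "complex^'n^'m"
  by (rule vec.linear_subspace_image) (auto intro: matrix_vector_mul_linear_gen)

lemma dim_image_mult:
  fixes A :: "complex^'n^'n"
  assumes "invertible A"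
  shows "vec.dim ((*v) A ` V) = vec.dim V"
proof (rule vec.dim_image_eq)
  show "Vector_Spaces.linear (*s) (*s) ((*v) A)"
    by (rule matrix_vector_mul_linear_gen)
  show "inj_on ((*v) A) (vec.span V)"
    using assms inj_matrix_vector_mult by (metis inj_on_subset subset_UNIV)
qed

lemma mult_axis_nth [simp]: "(A *v axis c 1) $ p = A $ p $ c" for A :: "complex^'n^'m"
  by (simp add: matrix_vector_mult_def axis_def if_distrib[of "\<lambda>x. _ * x"] cong: if_cong)

lemma invertible_iff_surj: "invertible A \<longleftrightarrow> surj ((*v) A)" for A :: "complex^'n^'n"
  by (simp add: invertible_right_inverse matrix_right_invertible_surjective)

lemma invertible_iff_ker: "invertible A \<longleftrightarrow> (\<forall>x. A *v x = 0 \<longrightarrow> x = 0)" for A :: "complex^'n^'n"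
  by (simp add: invertible_left_inverse matrix_left_invertible_ker)

lemma invertible_iff_det: "invertible (A :: complex^'n^'n) \<longleftrightarrow> det A \<noteq> 0"
  by (rule invertible_det_nz)

lemma matrix_inv_right: "invertible (A :: complex^'n^'n) \<Longrightarrow> A ** matrix_inv A = mat 1"
  and matrix_inv_left: "invertible (A :: complex^'n^'n) \<Longrightarrow> matrix_inv A ** A = mat 1"
  unfolding invertible_def matrix_inv_def by (metis (mono_tags, lifting) someI_ex)+

text \<open>A permutation with \<open>p i \<le> i\<close> for all \<open>i\<close> is the identity,
  since the positions have the same sum before and after. Every other permutation therefore picks an
  entry above the diagonal.\<close>

lemma det_lower_triangular:
  fixes A :: "complex^'n::{finite,linorder}^'n::{finite,linorder}"
  assumes "\<And>i j. i < j \<Longrightarrow> A $ i $ j = 0"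
  shows "det A = (\<Prod>i\<in>UNIV. A $ i $ i)"
proof -
  have "of_int (sign p) * (\<Prod>i\<in>UNIV. A $ i $ p i) = 0"
    if p: "p permutes UNIV" "p \<noteq> id" for p :: "'n \<Rightarrow> 'n"
  proof -
    have "\<exists>i. i < p i"
    proof (rule ccontr)
      assume "\<not> (\<exists>i. i < p i)"
      then have le: "pos (p i) \<le> pos i" for i
        by (auto simp: not_less)
      have "(\<Sum>i\<in>UNIV. pos (p i)) = (\<Sum>i::'n\<in>UNIV. pos i)"
        using sum.permute[OF p(1), of pos] unfolding comp_def by (rule sym)
      then have "pos (p i) = pos i" for i
        using sum_mono_inv[of "\<lambda>i. pos (p i)" UNIV pos i] le by auto
      with p show False by auto
    qed
    then show ?thesis
      using assms by (auto simp: prod_zero_iff)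
  qed
  then have "det A = (\<Sum>p\<in>{id}. of_int (sign p) * (\<Prod>i\<in>UNIV. A $ i $ p i))"
    unfolding det_def by (intro sum.mono_neutral_right) (auto simp: permutes_id finite_permutations)
  then show ?thesis by simp
qed

lemma det_upper_triangular:
  fixes A :: "complex^'n::{finite,linorder}^'n::{finite,linorder}"
  assumes "\<And>i j. j < i \<Longrightarrow> A $ i $ j = 0"
  shows "det A = (\<Prod>i\<in>UNIV. A $ i $ i)"
proof -
  have "det (transpose A) = (\<Prod>i\<in>UNIV. transpose A $ i $ i)"
    by (rule det_lower_triangular) (simp add: transpose_def assms)
  then show ?thesis unfolding det_transpose by (simp add: transpose_def)
qed

lemma psum_0 [simp]: "psum dims 0 = 0"
  by (simp add: psum_def)

lemma psum_mono: "i \<le> j \<Longrightarrow> psum dims i \<le> psum dims j"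
proof -
  assume "i \<le> j"
  then have "take j dims = take i dims @ take (j - i) (drop i dims)"
    by (metis le_add_diff_inverse take_add)
  then show ?thesis by (simp add: psum_def)
qed

lemma psum_Suc: "i < length dims \<Longrightarrow> psum dims (Suc i) = psum dims i + dims ! i"
  by (simp add: psum_def take_Suc_conv_app_nth)

lemma psum_length [simp]: "psum dims (length dims) = sum_list dims"
  by (simp add: psum_def)

lemma psum_le: "psum dims i \<le> sum_list dims"
  by (cases "i \<le> length dims") (use psum_mono[of i "length dims" dims] in \<open>auto simp: psum_def\<close>)

section \<open>Flags\<close>

lemma length_act [simp]: "length (act g F) = length F"
  by (simp add: act_def)

lemma nth_act [simp]: "i < length F \<Longrightarrow> act g F ! i = (*v) g ` (F ! i)"
  by (simp add: act_def)

lemma act_act: "act g (act h F) = act (g ** h) F"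
  by (simp add: act_def image_comp o_def matrix_vector_mul_assoc)

lemma act_one [simp]: "act (mat 1) F = F"
  by (simp add: act_def)

lemma act_flags:
  fixes g :: "complex^'n::finite^'n"
  assumes "invertible g" "F \<in> flags dims"
  shows "act g F \<in> flags dims"
proof -
  have "sorted_wrt (\<subseteq>) (act g F)"
    using assms(2) unfolding flags_def act_def sorted_wrt_map
    by (auto intro: sorted_wrt_mono_rel[rotated])
  then show ?thesis
    using assms by (auto simp: flags_def dim_image_mult subspace_image_mult)
qed

lemma act_inj:
  assumes "invertible (g :: complex^'n::finite^'n)" "act g F = act g F'"
  shows "F = F'"
  by (metis act_act act_one assms matrix_inv_left)

lemma nth_subset_flags:
  "F \<in> flags dims \<Longrightarrow> i \<le> j \<Longrightarrow> j < length dims \<Longrightarrow> F ! i \<subseteq> F ! j"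
  by (cases "i = j") (simp_all add: flags_def sorted_wrt_iff_nth_less)

lemma SL_C_invertible: "g \<in> SL_C \<Longrightarrow> invertible g"
  by (simp add: SL_C_def invertible_iff_det)

lemma SL_C_mult: "g \<in> SL_C \<Longrightarrow> h \<in> SL_C \<Longrightarrow> g ** h \<in> SL_C"
  by (simp add: SL_C_def det_mul)

lemma SL_C_one [simp]: "mat 1 \<in> SL_C"
  by (simp add: SL_C_def)

lemma SL_C_inv: "g \<in> SL_C \<Longrightarrow> matrix_inv g \<in> SL_C"
proof -
  assume g: "g \<in> SL_C"
  then have "det (g ** matrix_inv g) = 1"
    by (simp add: matrix_inv_right SL_C_invertible)
  with g show ?thesis
    by (simp add: SL_C_def det_mul)
qed

lemma coord_flag_nth:
  "k < length w \<Longrightarrow> coord_flag w ! k = crd (set (take (Suc k) w))"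
  by (simp add: coord_flag_def span_axis del: upt_Suc)

text \<open>The parameter \<open>ty\<close> ties the sequence to the index type, which a list of
  numbers does not mention. Positive block sizes make the partial sums strictly increasing.\<close>

locale dim_seq =
  fixes dims :: "nat list" and ty :: "'n::{finite,linorder} itself"
  assumes dims_pos: "\<forall>d\<in>set dims. 0 < d"
    and dims_sum: "sum_list dims = CARD('n)"
begin

abbreviation "r \<equiv> length dims"
abbreviation "m \<equiv> psum dims"

abbreviation bf :: "'n flag" where "bf \<equiv> base_flag dims"

lemma m_r: "m r = CARD('n)"
  by (simp add: dims_sum)

lemma m_le: "m i \<le> CARD('n)"
  by (metis dims_sum psum_le)

lemma m_strict: "i < j \<Longrightarrow> j \<le> r \<Longrightarrow> m i < m j"
proof -
  assume ij: "i < j" "j \<le> r"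
  then have "m i < m (Suc i)"
    using dims_pos by (simp add: psum_Suc)
  also have "\<dots> \<le> m j"
    using ij by (intro psum_mono) auto
  finally show ?thesis .
qed

lemma flag_proj_coord_flag:
  assumes "length w = CARD('n)"
  shows "flag_proj dims (coord_flag w) = map (\<lambda>i. crd (set (take (m (Suc i)) w))) [0..<r]"
  unfolding flag_proj_def
proof (rule map_cong[OF refl])
  fix i assume "i \<in> set [0..<r]"
  then have "0 < m (Suc i)" "m (Suc i) \<le> length w"
    using m_strict[of 0 "Suc i"] m_le assms by auto
  then show "coord_flag w ! (sum_list (take (Suc i) dims) - 1) = crd (set (take (m (Suc i)) w))"
    by (subst coord_flag_nth) (auto simp: psum_def)
qed

lemma set_take_sorted: "set (take k (sorted_list_of_set (UNIV :: 'n set))) = ini k"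
proof -
  let ?l = "sorted_list_of_set (UNIV :: 'n set)"
  have len: "length ?l = CARD('n)" by simp
  have p: "pos (?l ! k) = k" if k: "k < CARD('n)" for k
  proof -
    \<comment> \<open>The elements below entry \<open>k\<close> are exactly those listed before it,
      so its position is \<open>k\<close>.\<close>
    have "{..<?l ! k} = (!) ?l ` {..<k}"
    proof (intro set_eqI iffI)
      fix x assume x: "x \<in> {..<?l ! k}"
      obtain j where j: "j < CARD('n)" "?l ! j = x"
        using len by (metis UNIV_I finite_class.finite_UNIV in_set_conv_nth set_sorted_list_of_set)
      have "j < k"
      proof (rule ccontr)
        assume "\<not> j < k"
        then have "?l ! k \<le> ?l ! j"
          using j len by (intro sorted_nth_mono) auto
        with x j show False by auto
      qed
      with j show "x \<in> (!) ?l ` {..<k}" by auto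
    next
      fix x assume "x \<in> (!) ?l ` {..<k}"
      then obtain j where j: "j < k" "x = ?l ! j" by auto
      have "sorted_wrt (<) ?l" by (rule strict_sorted_list_of_set)
      then show "x \<in> {..<?l ! k}"
        using j k len by (auto intro: sorted_wrt_nth_less)
    qed
    moreover have "inj_on ((!) ?l) {..<k}"
      using k by (intro inj_on_nth) auto
    ultimately show ?thesis
      by (simp add: pos_def card_image)
  qed
  show ?thesis
  proof (intro set_eqI iffI)
    fix x assume "x \<in> set (take k ?l)"
    then show "x \<in> ini k"
      using p len by (auto simp: in_set_conv_nth)
  next
    fix x :: 'n assume x: "x \<in> ini k"
    have "?l ! pos x = x"
      using p[of "pos x"] by (simp add: pos_less_card)
    then show "x \<in> set (take k ?l)"
      using x len pos_less_card[of x] by (auto simp: in_set_conv_nth intro!: exI[of _ "pos x"])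
  qed
qed

lemma base_flag_eq: "bf = map (\<lambda>i. crd (ini (m (Suc i)))) [0..<r]"
  unfolding base_flag_def by (subst flag_proj_coord_flag) (auto simp: set_take_sorted)

lemma length_bf [simp]: "length bf = r"
  by (simp add: base_flag_eq)

lemma nth_bf [simp]: "i < r \<Longrightarrow> bf ! i = crd (ini (m (Suc i)))"
  by (simp add: base_flag_eq)

lemma crd_flags:
  assumes "\<And>i j. i \<le> j \<Longrightarrow> j < r \<Longrightarrow> S i \<subseteq> S j" "\<And>i. i < r \<Longrightarrow> card (S i) = m (Suc i)"
  shows "map (\<lambda>i. crd (S i)) [0..<r] \<in> (flags dims :: 'n flag set)"
  using assms by (simp add: flags_def sorted_wrt_iff_nth_less psum_def less_imp_le crd_mono)

lemma bf_flags [simp]: "bf \<in> flags dims"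
  unfolding base_flag_eq
  by (rule crd_flags) (simp_all add: ini_mono psum_mono card_ini m_le)

end

section \<open>The big cell\<close>

text \<open>For strictly block lower triangular \<open>X\<close> these matrices form the unipotent
  group opposite to the parabolic, and \<open>act (lo X) bf\<close> runs through the big
  cell.\<close>

definition lo :: "complex^('n \<times> 'n) \<Rightarrow> complex^'n^'n" where
  "lo X = mat 1 + (\<chi> i j. X $ (i, j))"

lemma lo_nth: "lo X $ i $ j = (if i = j then 1 else 0) + X $ (i, j)"
  by (simp add: lo_def mat_def)

lemma lo_mult_nth: "(lo X *v u) $ i = u $ i + (\<Sum>j\<in>UNIV. X $ (i, j) * u $ j)"
proof -
  have "(lo X *v u) $ i = (\<Sum>j\<in>UNIV. (if i = j then 1 else 0) * u $ j + X $ (i, j) * u $ j)"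
    unfolding matrix_vector_mult_def by (simp add: lo_nth ring_distribs)
  also have "\<dots> = u $ i + (\<Sum>j\<in>UNIV. X $ (i, j) * u $ j)"
    by (simp add: sum.distrib if_distrib[of "\<lambda>x. x * _"] cong: if_cong)
  finally show ?thesis .
qed

lemma lo_0 [simp]: "lo 0 = mat 1"
  by (simp add: vec_eq_iff lo_nth mat_def)

lemma lo_inject: "lo X = lo Y \<Longrightarrow> X = Y"
  by (simp add: vec_eq_iff lo_nth)

context dim_seq
begin

text \<open>The zero-based index of the block that contains the position of
  \<open>c\<close>.\<close>

definition bi :: "'n \<Rightarrow> nat" where
  "bi c = (LEAST i. pos c < m (Suc i))"

lemma bi_props: "bi c < r" "m (bi c) \<le> pos c" "pos c < m (Suc (bi c))"
proof -
  have "pos c < m r" by (simp add: pos_less_card dims_sum)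
  then have "r \<noteq> 0" by (cases r) auto
  then obtain k where k: "r = Suc k" by (cases r) auto
  then have ex: "pos c < m (Suc k)" using \<open>pos c < m r\<close> by simp
  show *: "pos c < m (Suc (bi c))"
    unfolding bi_def by (rule LeastI[of _ k]) (rule ex)
  have "bi c \<le> k"
    unfolding bi_def by (rule Least_le) (rule ex)
  then show "bi c < r" using k by simp
  show "m (bi c) \<le> pos c"
  proof (cases "bi c")
    case (Suc j)
    then have "\<not> pos c < m (Suc j)"
      using not_less_Least[of j "\<lambda>i. pos c < m (Suc i)"] unfolding bi_def by simp
    with Suc show ?thesis by simp
  qed simp
qed

lemma pos_less_m_iff: "pos c < m i \<longleftrightarrow> bi c < i"
proof
  assume "pos c < m i"
  then show "bi c < i"
    using bi_props(2)[of c] psum_mono[of i "bi c" dims] by (meson leD leI le_trans)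
next
  assume "bi c < i"
  then show "pos c < m i"
    using bi_props(3)[of c] psum_mono[of "Suc (bi c)" i dims] by simp
qed

lemma bi_eqI: "m i \<le> pos c \<Longrightarrow> pos c < m (Suc i) \<Longrightarrow> bi c = i"
  by (metis less_SucE not_less pos_less_m_iff)

lemma ini_m: "ini (m i) = {c. bi c < i}"
  by (auto simp: pos_less_m_iff)

lemma bi_mono: "a \<le> c \<Longrightarrow> bi a \<le> bi c"
  by (metis bi_props(3) leD leI less_Suc_eq_le le_less_trans pos_le_iff pos_less_m_iff)

lemma bi_less_imp: "bi a < bi c \<Longrightarrow> a < c"
  using bi_mono by (meson leD leI)

definition Low :: "('n \<times> 'n) set" where
  "Low = {(p, c). bi c < bi p}"

lemma bf_eq: "bf = map (\<lambda>i. crd {a. bi a \<le> i}) [0..<r]"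
  unfolding base_flag_eq ini_m by (simp add: less_Suc_eq_le)

lemma nth_bf': "i < r \<Longrightarrow> bf ! i = crd {a. bi a \<le> i}"
  by (simp add: bf_eq)

lemma card_bi_le: "i < r \<Longrightarrow> card {a. bi a \<le> i} = m (Suc i)"
  using card_ini[OF m_le, of "Suc i"] unfolding ini_m less_Suc_eq_le by simp

lemma chart_space_eq: "(chart_space dims :: (complex^('n \<times> 'n)) set) = crd Low"
proof -
  have "(\<exists>q<r. card {..<j} < sum_list (take q dims) \<and> sum_list (take q dims) \<le> card {..<i})
      \<longleftrightarrow> bi j < bi i" for i j :: 'n
    unfolding pos_def[symmetric] psum_def[symmetric] not_less[symmetric]
    using bi_props(1)[of i] by (auto simp: pos_less_m_iff)
  then show ?thesis
    unfolding chart_space_def crd_def Low_def by auto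
qed

lemma chart_param_eq: "chart_param dims g X = act (g ** lo X) bf"
  by (simp add: chart_param_def lo_def)

lemma crd_LowD: "X \<in> crd Low \<Longrightarrow> bi p \<le> bi c \<Longrightarrow> X $ (p, c) = 0"
  by (auto simp: crd_def Low_def)

lemma det_lo: "X \<in> crd Low \<Longrightarrow> det (lo X) = 1"
proof -
  assume X: "X \<in> crd Low"
  have "det (lo X) = (\<Prod>i\<in>UNIV. lo X $ i $ i)"
    by (rule det_lower_triangular) (use crd_LowD[OF X] bi_mono in \<open>auto simp: lo_nth less_imp_le\<close>)
  then show ?thesis using crd_LowD[OF X] by (simp add: lo_nth)
qed

lemma lo_SL: "X \<in> crd Low \<Longrightarrow> lo X \<in> SL_C"
  by (simp add: SL_C_def det_lo)

lemma chart_param_0: "chart_param dims g 0 = act g bf"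
  by (simp add: chart_param_eq)

lemma parabolic_act_bf:
  assumes "invertible q" "\<And>p c. bi c < bi p \<Longrightarrow> q $ p $ c = 0"
  shows "act q bf = bf"
proof -
  have "(*v) q ` crd {a. bi a \<le> i} = crd {a. bi a \<le> i}" for i
  proof (rule vec.subspace_dim_equal)
    show "(*v) q ` crd {a. bi a \<le> i} \<subseteq> crd {a. bi a \<le> i}"
    proof clarify
      fix x assume x: "x \<in> crd {a. bi a \<le> i}"
      have "q $ p $ c * x $ c = 0" if "\<not> bi p \<le> i" for p c
        using assms(2)[of c p] x that by (cases "bi c \<le> i") (auto simp: crd_def)
      then show "q *v x \<in> crd {a. bi a \<le> i}"
        by (auto simp: crd_def matrix_vector_mult_def intro!: sum.neutral)
    qed
  qed (use assms in \<open>simp_all add: dim_image_mult subspace_image_mult\<close>)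
  then show ?thesis
    by (simp add: list_eq_iff_nth_eq nth_bf' del: nth_bf)
qed

text \<open>\<open>lo (Lam A)\<close> is the unipotent factor of \<open>A\<close> in the big cell: its column \<open>c\<close> is the vector
  \<open>A y\<close> with \<open>y\<close> supported in the blocks up to that of \<open>c\<close> and \<open>A y \<equiv> e\<^sub>c\<close> modulo the
  coordinates of the later blocks, and Cramer's rule gives \<open>y\<close>.\<close>

definition sub :: "'n cmat \<Rightarrow> nat \<Rightarrow> 'n cmat" where
  "sub A i = (\<chi> a c. if bi a \<le> i \<and> bi c \<le> i then A $ a $ c else if a = c then 1 else 0)"

definition ysol :: "'n cmat \<Rightarrow> 'n \<Rightarrow> 'n cvec" where
  "ysol A c = (\<chi> k. det (\<chi> i j. if j = k then axis c 1 $ i else sub A (bi c) $ i $ j)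
     / det (sub A (bi c)))"

text \<open>All leading block minors are nonzero. By \<open>Om_act\<close> and
  \<open>Lam_unique\<close> this is the set of matrices that move the base flag into the big
  cell.\<close>

definition Om :: "('n cmat) set" where
  "Om = {A. \<forall>c. det (sub A (bi c)) \<noteq> 0}"

definition Lam :: "'n cmat \<Rightarrow> complex^('n \<times> 'n)" where
  "Lam A = (\<chi> pc. if bi (snd pc) < bi (fst pc) then (A *v ysol A (snd pc)) $ fst pc else 0)"

lemma Lam_in: "Lam A \<in> crd Low"
  by (auto simp: crd_def Low_def Lam_def)

lemma ysol:
  assumes "A \<in> Om"
  shows "sub A (bi c) *v ysol A c = axis c 1"
proof -
  have "det (sub A (bi c)) \<noteq> 0" using assms by (simp add: Om_def)
  from cramer[OF this] show ?thesis by (simp add: ysol_def)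
qed

lemma ysol_support:
  assumes "A \<in> Om" "bi c < bi k"
  shows "ysol A c $ k = 0"
proof -
  have "ysol A c $ k = (sub A (bi c) *v ysol A c) $ k"
    using assms(2) by (simp add: matrix_vector_mult_def sub_def if_distrib[of "\<lambda>x. x * _"] cong: if_cong)
  also have "\<dots> = 0"
    using assms by (auto simp: ysol axis_def)
  finally show ?thesis .
qed

lemma sub_mult:
  assumes "x \<in> crd {a. bi a \<le> i}" "bi a \<le> i"
  shows "(sub A i *v x) $ a = (A *v x) $ a"
  unfolding matrix_vector_mult_def
  by (auto simp: sub_def intro!: sum.cong) (use assms in \<open>auto simp: crd_def\<close>)

text \<open>A block LU decomposition: the solutions \<open>ysol A c\<close> are the columns of a
  block upper triangular matrix that clears the leading blocks of \<open>A\<close>.\<close>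

lemma Lam_factor:
  assumes "A \<in> Om"
  shows "A ** (\<chi> k c. ysol A c $ k) = lo (Lam A)"
proof -
  have sup: "ysol A c \<in> crd {a. bi a \<le> bi c}" for c
    using ysol_support[OF assms] by (auto simp: crd_def)
  have "(A *v ysol A c) $ p = lo (Lam A) $ p $ c" for p c
  proof (cases "bi p \<le> bi c")
    case True
    then have "(A *v ysol A c) $ p = axis c 1 $ p"
      using sub_mult[OF sup True] ysol[OF assms] by metis
    then show ?thesis using True by (auto simp: lo_nth Lam_def axis_def)
  next
    case False
    then show ?thesis by (auto simp: lo_nth Lam_def)
  qed
  then show ?thesis
    by (simp add: vec_eq_iff matrix_matrix_mult_def matrix_vector_mult_def)
qed

text \<open>Determinants in the factorization make both factors on its left side invertible, and the
  block upper triangular one fixes the base flag.\<close>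

lemma Om_act:
  assumes "A \<in> Om"
  shows "invertible A" "act (lo (Lam A)) bf = act A bf"
proof -
  let ?Y = "\<chi> k c. ysol A c $ k"
  have "det A * det ?Y = 1"
    using det_lo[OF Lam_in, of A] unfolding Lam_factor[OF assms, symmetric] det_mul .
  then have inv: "invertible A" "invertible ?Y" by (auto simp: invertible_iff_det)
  have "act ?Y bf = bf"
    by (rule parabolic_act_bf[OF inv(2)]) (simp add: ysol_support[OF assms])
  then show "act (lo (Lam A)) bf = act A bf"
    unfolding Lam_factor[OF assms, symmetric] by (simp add: act_act[symmetric])
  show "invertible A" by (rule inv)
qed

text \<open>Forward substitution: row \<open>a\<close> of \<open>X\<close> only meets columns of
  earlier blocks, where \<open>u\<close> is already known to vanish.\<close>

lemma lo_inj_leading: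
  assumes X: "X \<in> crd Low" and u: "u \<in> crd {a. bi a \<le> i}"
    and z: "\<And>a. bi a \<le> i \<Longrightarrow> (lo X *v u) $ a = 0"
  shows "u = 0"
proof -
  have "u $ a = 0" for a
  proof (induction "pos a" arbitrary: a rule: less_induct)
    case less
    show ?case
    proof (cases "bi a \<le> i")
      case True
      have "X $ (a, j) * u $ j = 0" for j
        using less[of j] crd_LowD[OF X, of a j] bi_less_imp[of j a] by (cases "bi a \<le> bi j") auto
      then have "(\<Sum>j\<in>UNIV. X $ (a, j) * u $ j) = 0" by (intro sum.neutral) blast
      then show ?thesis using z[OF True] by (simp add: lo_mult_nth)
    next
      case False
      then show ?thesis using u by (simp add: crd_def)
    qed
  qed
  then show ?thesis by (simp add: vec_eq_iff)
qed

text \<open>The hypothesis concerns the flag alone, and \<open>A\<close> is not assumed invertible.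
  The statement therefore both recognizes membership in the big cell and reads off the coordinate of
  any matrix representing a given flag.\<close>

lemma Lam_unique:
  assumes X: "X \<in> crd Low" and A: "act A bf = act (lo X) bf"
  shows "A \<in> Om" "Lam A = X"
proof -
  have im: "(*v) A ` crd {a. bi a \<le> i} = (*v) (lo X) ` crd {a. bi a \<le> i}" if "i < r" for i
    using A that by (metis length_bf nth_act nth_bf')
  have inv: "invertible A"
  proof -
    have "range ((*v) A) = range ((*v) (lo X))"
    proof -
      obtain k where k: "r = Suc k"
        using bi_props(1) by (cases r) auto
      have "{a. bi a \<le> k} = UNIV" using bi_props(1) k by (auto simp: less_Suc_eq_le)
      then show ?thesis using im[of k] k by simp
    qed
    also have "\<dots> = UNIV"
      using SL_C_invertible[OF lo_SL[OF X]] unfolding invertible_iff_surj .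
    finally show ?thesis
      unfolding invertible_iff_surj .
  qed
  show Om: "A \<in> Om"
    unfolding Om_def
  proof clarify
    \<comment> \<open>A kernel vector of the filled-up leading block gives a vector of the flag
      member whose leading coordinates vanish. Written through \<open>lo X\<close>, such a vector is
      zero by \<open>lo_inj_leading\<close>.\<close>
    fix c assume "det (sub A (bi c)) = 0"
    then have "\<not> invertible (sub A (bi c))" by (simp add: invertible_iff_det)
    then obtain v where v: "sub A (bi c) *v v = 0" "v \<noteq> 0"
      unfolding invertible_iff_ker by auto
    have vs: "v \<in> crd {a. bi a \<le> bi c}"
    proof -
      have "v $ k = 0" if "\<not> bi k \<le> bi c" for k
      proof -
        have "v $ k = (sub A (bi c) *v v) $ k"
          using that by (simp add: matrix_vector_mult_def sub_def if_distrib[of "\<lambda>x. x * _"] cong: if_cong)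
        then show ?thesis using v by simp
      qed
      then show ?thesis by (auto simp: crd_def)
    qed
    then obtain u where u: "u \<in> crd {a. bi a \<le> bi c}" "A *v v = lo X *v u"
      using im[OF bi_props(1)[of c]] by blast
    have "u = 0"
      by (rule lo_inj_leading[OF X u(1)]) (use sub_mult[OF vs, of _ A] v u in auto)
    then have "A *v v = 0" using u by simp
    then show False
      using inv v unfolding invertible_iff_ker by auto
  qed
  have L: "Lam A \<in> crd Low" by (rule Lam_in)
  have "lo (Lam A) *v axis c 1 = lo X *v axis c 1" for c
  proof -
    have ax: "axis c 1 \<in> crd {a. bi a \<le> bi c}" by simp
    have "(*v) (lo (Lam A)) ` crd {a. bi a \<le> bi c} = (*v) (lo X) ` crd {a. bi a \<le> bi c}"
      using im[OF bi_props(1)[of c]] Om_act(2)[OF Om] bi_props(1)[of c] by (metis length_bf nth_act nth_bf')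
    then obtain u where u: "u \<in> crd {a. bi a \<le> bi c}" "lo (Lam A) *v axis c 1 = lo X *v u"
      using ax by blast
    have lead: "(lo Y *v axis c 1) $ a = axis c 1 $ a" if "Y \<in> crd Low" "bi a \<le> bi c" for a Y
      using crd_LowD[OF that] by (simp add: lo_nth) (simp add: axis_def)
    have "u - axis c 1 = 0"
    proof (rule lo_inj_leading[OF X])
      show "u - axis c 1 \<in> crd {a. bi a \<le> bi c}"
        by (rule vec.subspace_diff[OF subspace_crd u(1) ax])
      fix a assume "bi a \<le> bi c"
      then show "(lo X *v (u - axis c 1)) $ a = 0"
        using lead[OF L] lead[OF X] u by (simp add: matrix_vector_mult_diff_distrib)
    qed
    then show ?thesis using u by simp
  qed
  then have "lo (Lam A) = lo X"
    unfolding vec_eq_iff by simp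
  then show "Lam A = X" by (rule lo_inject)
qed

lemma Lam_lo: "X \<in> crd Low \<Longrightarrow> Lam (lo X) = X"
  and lo_Om: "X \<in> crd Low \<Longrightarrow> lo X \<in> Om"
  using Lam_unique by auto

lemma Lam_parabolic:
  assumes "invertible q" "\<And>p c. bi c < bi p \<Longrightarrow> q $ p $ c = 0"
  shows "q \<in> Om" "Lam q = 0"
  using Lam_unique[of 0 q] parabolic_act_bf[OF assms] by (auto simp: crd_def)

end

section \<open>Holomorphic functions\<close>

text \<open>Complex differentiability of a scalar function at one point, as a real derivative that
  commutes with complex scalars. Closure under the field operations covers everything produced by
  Cramer's rule.\<close>

definition holo :: "(complex^'m::finite \<Rightarrow> complex) \<Rightarrow> complex^'m \<Rightarrow> bool" where
  "holo f x \<longleftrightarrow> (\<exists>f'. (\<forall>c v. f' (c *s v) = c * f' v) \<and> (f has_derivative f') (at x))"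

lemma holo_const [intro]: "holo (\<lambda>x. a) x"
  unfolding holo_def by (rule exI[of _ "\<lambda>_. 0"]) auto

lemma holo_coord [intro]: "holo (\<lambda>x. x $ i) x"
  unfolding holo_def
  by (rule exI[of _ "\<lambda>v. v $ i"]) (auto intro!: bounded_linear_imp_has_derivative bounded_linear_vec_nth)

lemma holo_add [intro]: "holo f x \<Longrightarrow> holo g x \<Longrightarrow> holo (\<lambda>x. f x + g x) x"
  unfolding holo_def by (elim exE, rule_tac x = "\<lambda>v. f' v + f'a v" in exI) (auto intro!: derivative_eq_intros simp: ring_distribs)

lemma holo_mult [intro]: "holo f x \<Longrightarrow> holo g x \<Longrightarrow> holo (\<lambda>x. f x * g x) x"
  unfolding holo_def by (elim exE, rule_tac x = "\<lambda>v. f x * f'a v + f' v * g x" in exI) (auto intro!: derivative_eq_intros simp: ring_distribs)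

lemma holo_inverse: "holo f x \<Longrightarrow> f x \<noteq> 0 \<Longrightarrow> holo (\<lambda>x. inverse (f x)) x"
  unfolding holo_def by (elim exE, rule_tac x = "\<lambda>v. - (inverse (f x) * f' v * inverse (f x))" in exI) (auto intro!: derivative_eq_intros simp: ring_distribs)

lemma holo_divide: "holo f x \<Longrightarrow> holo g x \<Longrightarrow> g x \<noteq> 0 \<Longrightarrow> holo (\<lambda>x. f x / g x) x"
  unfolding divide_inverse by (intro holo_mult holo_inverse)

lemma holo_sum: "(\<And>i. i \<in> A \<Longrightarrow> holo (f i) x) \<Longrightarrow> holo (\<lambda>x. \<Sum>i\<in>A. f i x) x"
  by (induction A rule: infinite_finite_induct) auto

lemma holo_prod: "(\<And>i. i \<in> A \<Longrightarrow> holo (f i) x) \<Longrightarrow> holo (\<lambda>x. \<Prod>i\<in>A. f i x) x"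
  by (induction A rule: infinite_finite_induct) auto

lemma holo_det:
  assumes "\<And>i j. holo (\<lambda>x. A x $ i $ j) x"
  shows "holo (\<lambda>x. det (A x)) x"
  unfolding det_def by (intro holo_sum holo_mult holo_const holo_prod assms)

lemma holo_imp_derivative:
  fixes f :: "complex^'m::finite \<Rightarrow> complex^'k::finite"
  assumes "\<And>i. holo (\<lambda>x. f x $ i) x"
  shows "\<exists>f'. Vector_Spaces.linear (*s) (*s) f' \<and> (f has_derivative f') (at x)"
proof -
  have "\<exists>g. \<forall>i. (\<forall>c v. g i (c *s v) = c * g i v) \<and> ((\<lambda>x. f x $ i) has_derivative g i) (at x)"
    using assms unfolding holo_def by (intro choice) auto
  then obtain g where g: "\<And>i c v. g i (c *s v) = c * g i v"
    "\<And>i. ((\<lambda>x. f x $ i) has_derivative g i) (at x)" by blast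
  let ?f' = "\<lambda>v. \<chi> i. g i v"
  have "(f has_derivative ?f') (at x)"
    unfolding has_derivative_componentwise_within[of f] 
  proof (intro ballI)
    fix b :: "complex^'k" assume "b \<in> Basis"
    then obtain i u where b: "b = axis i u" by (auto simp: Basis_vec_def)
    have "((\<lambda>x. f x $ i \<bullet> u) has_derivative (\<lambda>v. g i v \<bullet> u)) (at x)"
      by (intro derivative_intros g)
    then show "((\<lambda>x. f x \<bullet> b) has_derivative (\<lambda>v. ?f' v \<bullet> b)) (at x)"
      by (simp add: b inner_axis)
  qed
  moreover have "Vector_Spaces.linear (*s) (*s) ?f'"
    unfolding Vector_Spaces.linear_iff
    using has_derivative_linear[OF g(2)]
    by (auto simp: vec_eq_iff g linear_add intro: vec.vector_space_axioms)
  ultimately show ?thesis by blast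
qed

lemma holomorphic_map_onI:
  "(\<And>x i. x \<in> U \<Longrightarrow> holo (\<lambda>x. f x $ i) x) \<Longrightarrow> holomorphic_map_on f U"
  unfolding holomorphic_map_on_def
proof
  fix x assume "\<And>x i. x \<in> U \<Longrightarrow> holo (\<lambda>x. f x $ i) x" "x \<in> U"
  then show "\<exists>f'. Vector_Spaces.linear (*s) (*s) f' \<and> (f has_derivative f') (at x within U)"
    using holo_imp_derivative[of f x] has_derivative_at_withinI[of f _ x U] by auto
qed

context dim_seq
begin

lemma holo_Lam:
  fixes A :: "complex^'k::finite \<Rightarrow> 'n cmat"
  assumes "\<And>i j. holo (\<lambda>x. A x $ i $ j) x" "A x \<in> Om"
  shows "holo (\<lambda>x. Lam (A x) $ k) x"
proof -
  have s: "holo (\<lambda>x. sub (A x) a $ i $ j) x" for i j a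
    unfolding sub_def using assms(1) by (cases "bi i \<le> a \<and> bi j \<le> a"; cases "i = j") auto
  have "holo (\<lambda>x. ysol (A x) c $ k) x" for c k
    unfolding ysol_def vec_lambda_beta
  proof (intro holo_divide holo_det)
    show "det (sub (A x) (bi c)) \<noteq> 0" using assms(2) by (simp add: Om_def)
    show "holo (\<lambda>x. (\<chi> i j. if j = k then axis c 1 $ i else sub (A x) (bi c) $ i $ j) $ i $ j) x" for i j
      using s by (cases "j = k") auto
  qed (rule s)
  then show ?thesis
    unfolding Lam_def matrix_vector_mult_def vec_lambda_beta
    by (cases "bi (snd k) < bi (fst k)") (auto intro!: holo_sum holo_mult assms)
qed

end

section \<open>Hermitian geometry and adapted bases\<close>

text \<open>The Hermitian form, linear in the first argument. The complex bilinear form is expressed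
  as \<open>hm x (cj y)\<close>.\<close>

definition hm :: "complex^'n \<Rightarrow> complex^'n \<Rightarrow> complex" where
  "hm x y = (\<Sum>i\<in>UNIV. x $ i * cnj (y $ i))"

definition cj :: "complex^'n \<Rightarrow> complex^'n" where
  "cj x = (\<chi> i. cnj (x $ i))"

lemma cj_nth [simp]: "cj x $ i = cnj (x $ i)"
  by (simp add: cj_def)

lemma cj_cj [simp]: "cj (cj x) = x"
  by (simp add: vec_eq_iff)

lemma cj_add: "cj (x + y) = cj x + cj y"
  and cj_scale: "cj (c *s x) = cnj c *s cj x"
  and cj_0 [simp]: "cj 0 = 0"
  by (simp_all add: vec_eq_iff)

lemma subspace_cj: "vec.subspace V \<Longrightarrow> vec.subspace (cj ` V)"
  unfolding vec.subspace_def
proof (intro conjI ballI allI)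
  assume V: "0 \<in> V \<and> (\<forall>x\<in>V. \<forall>y\<in>V. x + y \<in> V) \<and> (\<forall>c. \<forall>x\<in>V. c *s x \<in> V)"
  show "0 \<in> cj ` V" using V by (metis cj_0 image_eqI)
  show "x + y \<in> cj ` V" if "x \<in> cj ` V" "y \<in> cj ` V" for x y
    using that V by (auto simp: cj_add[symmetric])
  show "c *s x \<in> cj ` V" if "x \<in> cj ` V" for c x
  proof -
    from \<open>x \<in> cj ` V\<close> obtain y where y: "y \<in> V" "x = cj y" by blast
    then have "c *s x = cj (cnj c *s y)" by (simp add: cj_scale)
    with y V show ?thesis by blast
  qed
qed

lemma hm_add_left: "hm (x + y) z = hm x z + hm y z"
  and hm_add_right: "hm z (x + y) = hm z x + hm z y"
  and hm_scale_left: "hm (c *s x) z = c * hm x z"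
  and hm_scale_right: "hm z (c *s x) = cnj c * hm z x"
  and hm_0_left [simp]: "hm 0 z = 0"
  and hm_0_right [simp]: "hm z 0 = 0"
  by (simp_all add: hm_def sum.distrib sum_distrib_left algebra_simps)

lemma hm_commute: "hm x y = cnj (hm y x)"
  by (simp add: hm_def mult.commute)

lemma hm_cj: "hm (cj x) (cj y) = cnj (hm x y)"
  by (simp add: hm_def)

lemma inner_eq_Re_hm: "x \<bullet> y = Re (hm x y)"
  by (simp add: inner_vec_def hm_def inner_complex_def)

lemma hm_self: "hm x x = of_real ((norm x)\<^sup>2)"
proof -
  have "Im (hm x x) = 0" by (simp add: hm_def)
  moreover have "Re (hm x x) = (norm x)\<^sup>2"
    by (simp add: inner_eq_Re_hm[symmetric] dot_square_norm)
  ultimately show ?thesis by (simp add: complex_eq_iff)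
qed

lemma hm_self_eq_0 [simp]: "hm x x = 0 \<longleftrightarrow> x = 0"
  by (simp add: hm_self)

lemma scaleR_cvec: "c *\<^sub>R x = of_real c *s x" for x :: "complex^'n"
  by (simp add: vec_eq_iff) (simp add: scaleR_conv_of_real)

lemma real_subspace: "vec.subspace V \<Longrightarrow> subspace V" for V :: "(complex^'n) set"
  by (auto simp: subspace_def vec.subspace_def scaleR_cvec)

lemma closed_csubspace: "vec.subspace V \<Longrightarrow> closed V" for V :: "(complex^'n) set"
  by (intro closed_subspace real_subspace)

text \<open>A vector that is orthogonal to a complex subspace in the real sense is Hermitian
  orthogonal to it, because the subspace contains \<i> times each of its vectors.\<close>

lemma exists_unit_orthogonal:
  assumes V: "vec.subspace V" and W: "vec.subspace W" "W \<subset> V"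
  shows "\<exists>x\<in>V. hm x x = 1 \<and> (\<forall>y\<in>W. hm x y = 0)"
proof -
  have "span W \<subset> span V"
    using assms by (simp add: span_eq_iff[THEN iffD2] real_subspace)
  then obtain x where x: "x \<noteq> 0" "x \<in> span V" "\<And>y. y \<in> span W \<Longrightarrow> orthogonal x y"
    by (rule orthogonal_to_subspace_exists_gen) blast
  have xV: "x \<in> V" using x V by (simp add: span_eq_iff[THEN iffD2] real_subspace)
  have 0: "hm x y = 0" if y: "y \<in> W" for y
  proof -
    have "\<i> *s y \<in> W" using W y by (simp add: vec.subspace_scale)
    then have "Re (hm x y) = 0" "Re (hm x (\<i> *s y)) = 0"
      using x(3) y W by (simp_all add: span_eq_iff[THEN iffD2] real_subspace orthogonal_def inner_eq_Re_hm)
    then show ?thesis by (simp add: hm_scale_right complex_eq_iff)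
  qed
  let ?c = "complex_of_real (inverse (norm x))"
  have "hm (?c *s x) (?c *s x) = 1"
  proof -
    have "hm (?c *s x) (?c *s x) = ?c * cnj ?c * hm x x"
      by (simp only: hm_scale_left hm_scale_right mult.assoc mult.left_commute)
    also have "\<dots> = of_real (inverse (norm x) * inverse (norm x) * (norm x)\<^sup>2)"
      by (simp only: hm_self complex_cnj_complex_of_real of_real_mult)
    also have "inverse (norm x) * inverse (norm x) * (norm x)\<^sup>2 = 1"
      using x(1) by (simp add: power2_eq_square field_simps)
    finally show ?thesis by simp
  qed
  moreover have "?c *s x \<in> V" using V xV by (simp add: vec.subspace_scale)
  ultimately show ?thesis
    using 0 by (intro bexI[of _ "?c *s x"]) (auto simp: hm_scale_left)
qed

definition adj :: "complex^'n^'n \<Rightarrow> complex^'n^'n" where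
  "adj A = (\<chi> i j. cnj (A $ j $ i))"

lemma adj_nth [simp]: "adj A $ i $ j = cnj (A $ j $ i)"
  by (simp add: adj_def)

lemma adj_mult: "adj (A ** B) = adj B ** adj A"
  by (simp add: vec_eq_iff matrix_matrix_mult_def mult.commute)

lemma adj_adj [simp]: "adj (adj A) = A"
  by (simp add: vec_eq_iff)

lemma adj_mult_nth: "(adj A ** B) $ i $ j = hm (column j B) (column i A)"
  by (simp add: matrix_matrix_mult_def hm_def column_def mult.commute)

lemma hm_adj: "hm (A *v x) y = hm x (adj A *v y)"
proof -
  have "hm (A *v x) y = (\<Sum>i\<in>UNIV. \<Sum>j\<in>UNIV. A $ i $ j * x $ j * cnj (y $ i))"
    by (simp add: hm_def matrix_vector_mult_def sum_distrib_right)
  also have "\<dots> = (\<Sum>j\<in>UNIV. \<Sum>i\<in>UNIV. A $ i $ j * x $ j * cnj (y $ i))"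
    by (rule sum.swap)
  also have "\<dots> = hm x (adj A *v y)"
    by (simp add: hm_def matrix_vector_mult_def sum_distrib_left mult_ac)
  finally show ?thesis .
qed

lemma unitary_invertible: "adj U ** U = mat 1 \<Longrightarrow> invertible U"
  using invertible_left_inverse by blast

lemma subspace_mult_in:
  fixes A :: "complex^'n^'m"
  assumes "vec.subspace V" "\<And>j. j \<in> S \<Longrightarrow> column j A \<in> V" "x \<in> crd S"
  shows "A *v x \<in> V"
proof -
  have "A *v x = (\<Sum>j\<in>UNIV. x $ j *s column j A)"
    by (rule matrix_mult_sum)
  also have "\<dots> \<in> V"
  proof (intro vec.subspace_sum assms(1))
    fix j show "x $ j *s column j A \<in> V"
      using assms by (cases "j \<in> S") (auto simp: crd_def vec.subspace_scale vec.subspace_0)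
  qed
  finally show ?thesis .
qed

context dim_seq
begin

lemma flags_subspace: "F \<in> flags dims \<Longrightarrow> i < r \<Longrightarrow> vec.subspace (F ! i)"
  and flags_dim: "F \<in> flags dims \<Longrightarrow> i < r \<Longrightarrow> vec.dim (F ! i) = m (Suc i)"
  and flags_length: "F \<in> flags dims \<Longrightarrow> length F = r"
  by (auto simp: flags_def psum_def)

lemma image_crd_eqI:
  fixes A :: "'n cmat"
  assumes "invertible A" "vec.subspace V" "vec.dim V = card S" "\<And>j. j \<in> S \<Longrightarrow> column j A \<in> V"
  shows "(*v) A ` crd S = V"
proof (rule vec.subspace_dim_equal)
  show "(*v) A ` crd S \<subseteq> V"
    using subspace_mult_in[OF assms(2,4)] by auto
qed (use assms in \<open>auto simp: subspace_image_mult dim_image_mult\<close>)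

lemma act_bf_eqI:
  fixes A :: "'n cmat"
  assumes "invertible A" "F \<in> flags dims" "\<And>c i. bi c \<le> i \<Longrightarrow> i < r \<Longrightarrow> column c A \<in> F ! i"
  shows "act A bf = F"
proof (rule nth_equalityI)
  show "length (act A bf) = length F" using assms(2) by (simp add: flags_length)
  fix i assume "i < length (act A bf)"
  then have i: "i < r" by simp
  have "(*v) A ` crd {a. bi a \<le> i} = F ! i"
    by (rule image_crd_eqI) (use assms i in \<open>auto simp: flags_subspace flags_dim card_bi_le\<close>)
  then show "act A bf ! i = F ! i" using i by (simp add: nth_bf' del: nth_bf)
qed

text \<open>Gram-Schmidt along the flag: the vectors chosen before \<open>c\<close> span at most
  \<open>pos c\<close> dimensions, fewer than the flag member belonging to the block of
  \<open>c\<close> has.\<close>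

lemma adapted_unitary:
  assumes F: "F \<in> (flags dims :: 'n flag set)"
  shows "\<exists>U. adj U ** U = mat 1 \<and> act U bf = F"
proof -
  have "\<exists>u :: 'n \<Rightarrow> 'n cvec. \<forall>c. pos c < k \<longrightarrow>
          u c \<in> F ! bi c \<and> hm (u c) (u c) = 1 \<and> (\<forall>b<c. hm (u c) (u b) = 0)" for k
  proof (induction k)
    case (Suc k)
    then obtain u :: "'n \<Rightarrow> 'n cvec" where u: "\<And>c. pos c < k \<Longrightarrow> u c \<in> F ! bi c"
      "\<And>c. pos c < k \<Longrightarrow> hm (u c) (u c) = 1" "\<And>c b. pos c < k \<Longrightarrow> b < c \<Longrightarrow> hm (u c) (u b) = 0"
      by blast
    show ?case
    proof (cases "k < CARD('n)")
      case False
      then have "pos c < k" for c :: 'n using pos_less_card[of c] by simp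
      then show ?thesis using Suc by blast
    next
      case True
      then obtain c :: 'n where c: "pos c = k" using pos_surj by blast
      let ?W = "vec.span (u ` {..<c})"
      have sub: "?W \<subseteq> F ! bi c"
      proof (rule vec.span_minimal[OF _ flags_subspace[OF F bi_props(1)]], clarify)
        fix b assume "b < c"
        then have "pos b < k" unfolding c[symmetric] by simp
        then have "u b \<in> F ! bi b" by (rule u(1))
        moreover have "F ! bi b \<subseteq> F ! bi c"
          by (rule nth_subset_flags[OF F bi_mono bi_props(1)]) (use \<open>b < c\<close> in simp)
        ultimately show "u b \<in> F ! bi c" by blast
      qed
      have "vec.dim ?W \<le> card (u ` {..<c})"
        unfolding vec.dim_span by (rule vec.dim_le_card') simp
      also have "\<dots> \<le> pos c"
        unfolding pos_def by (rule card_image_le) simp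
      also have "\<dots> < vec.dim (F ! bi c)"
        using flags_dim[OF F bi_props(1)] bi_props(3) by simp
      finally have "vec.dim ?W < vec.dim (F ! bi c)" .
      then have "?W \<noteq> F ! bi c" by (metis less_irrefl)
      with sub have "?W \<subset> F ! bi c" by (rule psubsetI)
      from exists_unit_orthogonal[OF flags_subspace[OF F bi_props(1)] vec.subspace_span this]
      obtain x where x: "x \<in> F ! bi c" "hm x x = 1" "\<And>y. y \<in> ?W \<Longrightarrow> hm x y = 0" by blast
      have "hm x (u b) = 0" if "b < c" for b
        using x(3) that by (simp add: vec.span_base)
      have "(u(c := x)) a \<in> F ! bi a \<and>
          hm ((u(c := x)) a) ((u(c := x)) a) = 1 \<and> (\<forall>b<a. hm ((u(c := x)) a) ((u(c := x)) b) = 0)"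
        if "pos a < Suc k" for a
      proof (cases "a = c")
        case True
        then show ?thesis using x \<open>\<And>b. b < c \<Longrightarrow> hm x (u b) = 0\<close> by auto
      next
        case False
        then have "pos a \<noteq> k" unfolding c[symmetric] by simp
        then have a: "pos a < k" using that by simp
        then have "a < c" unfolding c[symmetric] by simp
        then show ?thesis using u a by auto
      qed
      then show ?thesis by blast
    qed
  qed auto
  from this[of "CARD('n)"] obtain u :: "'n \<Rightarrow> 'n cvec" where u: "\<And>c. u c \<in> F ! bi c"
    "\<And>c. hm (u c) (u c) = 1" "\<And>c b. b < c \<Longrightarrow> hm (u c) (u b) = 0"
    using pos_less_card by blast
  define U :: "'n cmat" where "U = (\<chi> p c. u c $ p)"
  have col: "column c U = u c" for c
    by (simp add: U_def column_def vec_eq_iff)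
  have "hm (u j) (u i) = (if i = j then 1 else 0)" for i j
    using u(2,3) hm_commute[of "u j" "u i"] by (cases i j rule: linorder_cases) auto
  then have un: "adj U ** U = mat 1"
    by (simp add: vec_eq_iff adj_mult_nth col mat_def)
  moreover have "act U bf = F"
    by (rule act_bf_eqI[OF unitary_invertible[OF un] F])
      (use u(1) nth_subset_flags[OF F] in \<open>auto simp: col subset_iff\<close>)
  ultimately show ?thesis by blast
qed

text \<open>Scalars preserve every subspace, and a complex root of the inverse determinant
  normalizes \<open>g\<close>. The scalar is exposed in the conclusion because the tangent space of
  the base cycle is computed with an explicit representative.\<close>

lemma scalar_to_SL:
  fixes g :: "'n cmat"
  assumes "invertible g"
  shows "\<exists>c. c \<noteq> 0 \<and> mat c ** g \<in> SL_C \<and> (\<forall>F\<in>flags dims. act (mat c ** g) F = act g F)"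
proof -
  have n: "CARD('n) \<noteq> 0" by simp
  obtain c where c: "inverse (det g) = c ^ CARD('n)"
    using n by (rule exists_complex_root)
  have c0: "c \<noteq> 0" using c assms by (auto simp: invertible_iff_det zero_power)
  have "det (mat c :: 'n cmat) = c ^ CARD('n)"
    by (subst det_lower_triangular) (auto simp: mat_def)
  then have "det (mat c ** g) = 1"
    using c[symmetric] assms by (simp add: det_mul invertible_iff_det)
  moreover have "act (mat c ** g) F = act g F" if F: "F \<in> flags dims" for F
  proof (rule nth_equalityI)
    fix i assume "i < length (act (mat c ** g) F)"
    then have i: "i < length F" by simp
    have mc: "mat c *v x = c *s x" for x :: "'n cvec"
      by (simp add: vec_eq_iff matrix_vector_mult_def mat_def if_distrib[of "\<lambda>x. x * _"] cong: if_cong)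
    have V: "vec.subspace ((*v) g ` (F ! i))"
      using F i by (intro subspace_image_mult flags_subspace) (auto simp: flags_length)
    have "(*v) (mat c ** g) ` (F ! i) = (*s) c ` ((*v) g ` (F ! i))"
      by (simp add: image_comp o_def mc flip: matrix_vector_mul_assoc)
    also have "\<dots> = (*v) g ` (F ! i)"
    proof
      show "(*s) c ` ((*v) g ` (F ! i)) \<subseteq> (*v) g ` (F ! i)"
        using V by (auto simp: vec.subspace_def)
      show "(*v) g ` (F ! i) \<subseteq> (*s) c ` ((*v) g ` (F ! i))"
      proof
        fix y assume "y \<in> (*v) g ` (F ! i)"
        then have "inverse c *s y \<in> (*v) g ` (F ! i)" using V by (simp add: vec.subspace_scale)
        moreover have "y = c *s (inverse c *s y)" using c0 by (simp add: vec_eq_iff)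
        ultimately show "y \<in> (*s) c ` ((*v) g ` (F ! i))" by blast
      qed
    qed
    finally show "act (mat c ** g) F ! i = act g F ! i" using i by simp
  qed simp
  ultimately show ?thesis using c0 by (intro exI[of _ c]) (auto simp: SL_C_def)
qed

lemma scale_to_SL:
  fixes g :: "'n cmat"
  assumes "invertible g"
  shows "\<exists>g'\<in>SL_C. \<forall>F\<in>flags dims. act g' F = act g F"
  using scalar_to_SL[OF assms] by blast

lemma flags_transitive:
  assumes "F \<in> flags dims"
  shows "\<exists>g\<in>SL_C. act g bf = F"
  using adapted_unitary[OF assms] scale_to_SL unitary_invertible bf_flags by metis

end

section \<open>Tangent spaces\<close>

text \<open>Curves need only be differentiable at time 0 and lie in the set for nearby times. For a
  submanifold these velocities form the usual tangent space.\<close>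

definition tang :: "'a::real_normed_vector set \<Rightarrow> 'a \<Rightarrow> 'a set" where
  "tang S x = {v. \<exists>c :: real \<Rightarrow> 'a. c 0 = x \<and> (\<forall>\<^sub>F t in at 0. c t \<in> S) \<and> (c has_vector_derivative v) (at 0)}"

lemma curve_in_nbhd:
  fixes c :: "real \<Rightarrow> 'a::real_normed_vector"
  assumes "(c has_vector_derivative v) (at 0)" "\<forall>\<^sub>F t in at 0. c t \<in> E" "openin (top_of_set E) U" "c 0 \<in> U"
  shows "\<forall>\<^sub>F t in at 0. c t \<in> U"
proof -
  obtain T where T: "open T" "U = E \<inter> T" using assms(3) by (auto simp: openin_open)
  have "isCont c 0"
    using assms(1) has_vector_derivative_continuous by blast
  then have "\<forall>\<^sub>F t in at 0. c t \<in> T"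
    using T assms(4) by (auto simp: isCont_def tendsto_def)
  with assms(2) show ?thesis
    by eventually_elim (simp add: T)
qed

lemma curve_compose:
  fixes c :: "real \<Rightarrow> 'a::real_normed_vector"
  assumes "(f has_derivative f') (at (c 0) within U)" "(c has_vector_derivative v) (at 0)"
    and "\<forall>\<^sub>F t in at 0. c t \<in> U" "c 0 \<in> U"
  shows "((\<lambda>t. f (c t)) has_vector_derivative f' v) (at 0)"
proof -
  obtain T where T: "open T" "0 \<in> T" "\<And>t. t \<in> T \<Longrightarrow> c t \<in> U"
    using assms(3,4) unfolding eventually_at_topological by (metis UNIV_I)
  have "(c has_vector_derivative v) (at 0 within T)"
    using assms(2) by (rule has_vector_derivative_at_within)
  moreover have "(f has_derivative f') (at (c 0) within c ` T)"
    by (rule has_derivative_subset[OF assms(1)]) (use T in auto)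
  ultimately have "(f \<circ> c has_vector_derivative f' v) (at 0 within T)"
    by (rule vector_derivative_diff_chain_within)
  then show ?thesis
    using at_within_open[OF T(2,1)] by (simp add: o_def)
qed

lemma vector_derivative_quotient:
  fixes c :: "real \<Rightarrow> 'a::real_normed_vector"
  assumes "(c has_vector_derivative v) (at 0)"
  shows "((\<lambda>t. (1 / t) *\<^sub>R (c t - c 0)) \<longlongrightarrow> v) (at 0)"
proof -
  have "((\<lambda>y. (c y - c 0 - (y - 0) *\<^sub>R v) /\<^sub>R norm (y - 0)) \<longlongrightarrow> 0) (at 0)"
    using assms unfolding has_vector_derivative_def has_derivative_at_within by blast
  then have "((\<lambda>y. norm ((c y - c 0 - (y - 0) *\<^sub>R v) /\<^sub>R norm (y - 0))) \<longlongrightarrow> 0) (at 0)"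
    by (rule tendsto_norm_zero)
  moreover have "\<forall>\<^sub>F y in at 0. norm ((c y - c 0 - (y - 0) *\<^sub>R v) /\<^sub>R norm (y - 0))
      = norm ((1 / y) *\<^sub>R (c y - c 0) - v)"
  proof (rule eventually_at_topological[THEN iffD2, OF exI[of _ UNIV]], safe)
    fix y :: real assume y: "y \<noteq> 0"
    have "norm ((c y - c 0 - (y - 0) *\<^sub>R v) /\<^sub>R norm (y - 0))
        = norm ((1 / y) *\<^sub>R (c y - c 0 - y *\<^sub>R v))" by (simp add: divide_inverse)
    also have "(1 / y) *\<^sub>R (c y - c 0 - y *\<^sub>R v) = (1 / y) *\<^sub>R (c y - c 0) - v"
      using y by (simp add: scaleR_right_diff_distrib)
    finally show "norm ((c y - c 0 - (y - 0) *\<^sub>R v) /\<^sub>R norm (y - 0))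
      = norm ((1 / y) *\<^sub>R (c y - c 0) - v)" .
  qed auto
  ultimately have "((\<lambda>y. norm ((1 / y) *\<^sub>R (c y - c 0) - v)) \<longlongrightarrow> 0) (at 0)"
    by (rule Lim_transform_eventually)
  then show ?thesis
    by (rule LIM_zero_cancel[OF tendsto_norm_zero_cancel])
qed

lemma curve_derivative_in_subspace:
  fixes c :: "real \<Rightarrow> 'a::real_normed_vector"
  assumes "(c has_vector_derivative v) (at 0)" "\<forall>\<^sub>F t in at 0. c t \<in> E" "c 0 \<in> E" "subspace E" "closed E"
  shows "v \<in> E"
proof -
  have "((\<lambda>t. (1 / t) *\<^sub>R (c t - c 0)) \<longlongrightarrow> v) (at 0)"
    by (rule vector_derivative_quotient[OF assms(1)])
  moreover have "\<forall>\<^sub>F t in at 0. (1 / t) *\<^sub>R (c t - c 0) \<in> E"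
    using assms(2) by eventually_elim (use assms in \<open>auto intro!: subspace_scale subspace_diff\<close>)
  ultimately show ?thesis
    by (intro Lim_in_closed_set[OF \<open>closed E\<close>]) auto
qed

lemma has_vector_derivative_eventually:
  fixes f g :: "real \<Rightarrow> 'a::real_normed_vector"
  assumes "(f has_vector_derivative v) (at a)" "\<forall>\<^sub>F t in at a. f t = g t" "f a = g a"
  shows "(g has_vector_derivative v) (at a)"
  using assms unfolding has_vector_derivative_def
  by (intro has_derivative_transform_eventually[of f _ a UNIV g]) auto

lemma line_derivative: "((\<lambda>t. x + t *\<^sub>R v) has_vector_derivative v) (at 0)"
  by (auto intro!: derivative_eq_intros)

text \<open>The derivative of the inverse straightening map carries the linear model
  \<open>L\<close> injectively onto the set of velocities, and it is complex linear.\<close>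

lemma tang_submanifold:
  fixes S :: "(complex^'m::finite) set"
  assumes S: "complex_submanifold_of E d S" and E: "vec.subspace E" and x: "x \<in> S"
  shows "vec.subspace (tang S x)" "vec.dim (tang S x) = d"
proof -
  have SE: "S \<subseteq> E" using S by (simp add: complex_submanifold_of_def)
  obtain U V h k L where U: "openin (top_of_set E) U" and V: "openin (top_of_set E) V" and xU: "x \<in> U"
    and bih: "biholomorphism U V h k" and L: "vec.subspace L" "L \<subseteq> E" "vec.dim L = d"
    and hS: "h ` (S \<inter> U) = L \<inter> V"
    using S x unfolding complex_submanifold_of_def by meson
  have UE: "U \<subseteq> E" and VE: "V \<subseteq> E" using U V openin_imp_subset by blast+
  have hU: "h ` U = V" "k ` V = U" and kh: "\<And>x. x \<in> U \<Longrightarrow> k (h x) = x" and hk: "\<And>x. x \<in> V \<Longrightarrow> h (k x) = x"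
    using bih unfolding biholomorphism_def by auto
  have hxV: "h x \<in> V" using hU xU by blast
  obtain h' where h': "Vector_Spaces.linear (*s) (*s) h'" "(h has_derivative h') (at x within U)"
    using bih xU unfolding biholomorphism_def holomorphic_map_on_def by blast
  obtain k' where k': "Vector_Spaces.linear (*s) (*s) k'" "(k has_derivative k') (at (h x) within V)"
    using bih hxV unfolding biholomorphism_def holomorphic_map_on_def by blast
  have lE: "\<forall>\<^sub>F t in at 0. y + t *\<^sub>R v \<in> E" if "y \<in> E" "v \<in> E" for y v and t :: real
    using that E by (auto simp: real_subspace subspace_add subspace_scale)
  \<comment> \<open>The derivatives are taken within relatively open subsets of \<open>E\<close> and
    are pinned down only along \<open>E\<close>; the chain rule is therefore tested on straight
    lines with direction in \<open>E\<close>.\<close>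
  have k'h': "k' (h' v) = v" if v: "v \<in> E" for v
  proof -
    have ev: "\<forall>\<^sub>F t in at 0. x + t *\<^sub>R v \<in> U"
      by (rule curve_in_nbhd[OF line_derivative lE U]) (use xU UE v in auto)
    have 1: "((\<lambda>t. h (x + t *\<^sub>R v)) has_vector_derivative h' v) (at 0)"
      by (rule curve_compose[where U=U]) (use h' line_derivative ev xU in auto)
    have "((\<lambda>t. k (h (x + t *\<^sub>R v))) has_vector_derivative k' (h' v)) (at 0)"
      by (rule curve_compose[where U=V, OF _ 1]) (use k' hU hxV in \<open>auto intro: eventually_mono[OF ev]\<close>)
    moreover have "((\<lambda>t. k (h (x + t *\<^sub>R v))) has_vector_derivative v) (at 0)"
    proof (rule has_vector_derivative_eventually[OF line_derivative])
      show "\<forall>\<^sub>F t in at 0. x + t *\<^sub>R v = k (h (x + t *\<^sub>R v))"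
        using ev by eventually_elim (simp add: kh)
    qed (use kh xU in auto)
    ultimately show ?thesis by (rule vector_derivative_unique_at)
  qed
  have T: "tang S x = k' ` L"
  proof
    show "tang S x \<subseteq> k' ` L"
    proof
      fix v assume "v \<in> tang S x"
      then obtain c where c: "c 0 = x" "\<forall>\<^sub>F t in at 0. c t \<in> S" "(c has_vector_derivative v) (at 0)"
        by (auto simp: tang_def)
      have cE: "\<forall>\<^sub>F t in at 0. c t \<in> E" using c(2) SE by (auto elim: eventually_mono)
      have vE: "v \<in> E"
        by (rule curve_derivative_in_subspace[OF c(3) cE])
          (use c xU UE E in \<open>auto simp: real_subspace closed_csubspace\<close>)
      have cU: "\<forall>\<^sub>F t in at 0. c t \<in> U"
        by (rule curve_in_nbhd[OF c(3) cE U]) (use c xU in auto)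
      have 1: "((\<lambda>t. h (c t)) has_vector_derivative h' v) (at 0)"
        by (rule curve_compose[OF _ c(3) cU]) (use h' c xU in auto)
      have hL: "h y \<in> L" if "y \<in> S" "y \<in> U" for y using that hS by blast
      have "h' v \<in> L"
      proof (rule curve_derivative_in_subspace[OF 1])
        show "\<forall>\<^sub>F t in at 0. h (c t) \<in> L"
          using cU c(2) by eventually_elim (simp add: hL)
      qed (use c xU x hL L in \<open>auto simp: real_subspace closed_csubspace\<close>)
      then show "v \<in> k' ` L" using k'h'[OF vE] by force
    qed
    show "k' ` L \<subseteq> tang S x"
    proof clarify
      fix l assume l: "l \<in> L"
      have hxL: "h x \<in> L" using hS x xU by blast
      have Lin: "h x + t *\<^sub>R l \<in> L" for t
        using hxL l L by (simp add: real_subspace subspace_add subspace_scale)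
      have ev: "\<forall>\<^sub>F t in at 0. h x + t *\<^sub>R l \<in> V"
        by (rule curve_in_nbhd[OF line_derivative lE V]) (use hxV VE l L in auto)
      have kS: "k y \<in> S" if y: "y \<in> L" "y \<in> V" for y
      proof -
        obtain z where "z \<in> S" "z \<in> U" "y = h z" using hS y by blast
        then show ?thesis using kh by simp
      qed
      have "((\<lambda>t. k (h x + t *\<^sub>R l)) has_vector_derivative k' l) (at 0)"
        by (rule curve_compose[OF _ line_derivative ev]) (use k' hxV in auto)
      moreover have "\<forall>\<^sub>F t in at 0. k (h x + t *\<^sub>R l) \<in> S"
        using ev by eventually_elim (simp add: Lin kS)
      ultimately show "k' l \<in> tang S x"
        unfolding tang_def using kh xU by (intro CollectI exI[of _ "\<lambda>t. k (h x + t *\<^sub>R l)"]) auto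
    qed
  qed
  have h'k': "h' (k' v) = v" if v: "v \<in> E" for v
  proof -
    have ev: "\<forall>\<^sub>F t in at 0. h x + t *\<^sub>R v \<in> V"
      by (rule curve_in_nbhd[OF line_derivative lE V]) (use hxV VE v in auto)
    have 1: "((\<lambda>t. k (h x + t *\<^sub>R v)) has_vector_derivative k' v) (at 0)"
      by (rule curve_compose[OF _ line_derivative ev]) (use k' hxV in auto)
    have evU: "\<forall>\<^sub>F t in at 0. k (h x + t *\<^sub>R v) \<in> U" 
      using ev by eventually_elim (use hU in blast)
    have "((\<lambda>t. h (k (h x + t *\<^sub>R v))) has_vector_derivative h' (k' v)) (at 0)"
      by (rule curve_compose[where U=U, OF _ 1 evU]) (use h' kh xU in auto)
    moreover have "((\<lambda>t. h (k (h x + t *\<^sub>R v))) has_vector_derivative v) (at 0)"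
    proof (rule has_vector_derivative_eventually[OF line_derivative])
      show "\<forall>\<^sub>F t in at 0. h x + t *\<^sub>R v = h (k (h x + t *\<^sub>R v))"
        using ev by eventually_elim (simp add: hk)
    qed (use hk hxV in auto)
    ultimately show ?thesis by (rule vector_derivative_unique_at)
  qed
  show "vec.subspace (tang S x)"
    unfolding T by (rule vec.linear_subspace_image[OF k'(1) L(1)])
  have "inj_on k' (vec.span L)"
    using h'k' L by (metis inj_on_inverseI vec.span_eq_iff subsetD)
  then show "vec.dim (tang S x) = d"
    unfolding T using vec.dim_image_eq[OF k'(1), of L] L by simp
qed

section \<open>Topology and dimension\<close>

lemma continuous_on_det:
  fixes A :: "'a::topological_space \<Rightarrow> complex^'n^'n"
  assumes "\<And>i j. continuous_on S (\<lambda>x. A x $ i $ j)"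
  shows "continuous_on S (\<lambda>x. det (A x))"
  unfolding det_def by (intro continuous_intros assms)

lemma bounded_bilinear_matrix_vector: "bounded_bilinear ((*v) :: complex^'n^'m \<Rightarrow> complex^'n \<Rightarrow> complex^'m)"
proof -
  have "bilinear ((*v) :: complex^'n^'m \<Rightarrow> complex^'n \<Rightarrow> complex^'m)"
    unfolding bilinear_def
    by (auto intro!: linearI simp: vec_eq_iff matrix_vector_mult_def sum.distrib scaleR_sum_right ring_distribs)
  then show ?thesis by (simp add: bilinear_conv_bounded_bilinear)
qed

lemma bounded_bilinear_matrix_mult: "bounded_bilinear ((**) :: complex^'n^'m \<Rightarrow> complex^'p^'n \<Rightarrow> complex^'p^'m)"
proof -
  have "bilinear ((**) :: complex^'n^'m \<Rightarrow> complex^'p^'n \<Rightarrow> complex^'p^'m)"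
    unfolding bilinear_def
    by (auto intro!: linearI simp: vec_eq_iff matrix_matrix_mult_def sum.distrib scaleR_sum_right ring_distribs)
  then show ?thesis by (simp add: bilinear_conv_bounded_bilinear)
qed

lemmas continuous_on_matrix_mult [continuous_intros] =
  bounded_bilinear.continuous_on[OF bounded_bilinear_matrix_mult]

lemma continuous_on_lo [continuous_intros]:
  "continuous_on S f \<Longrightarrow> continuous_on S (\<lambda>x. lo (f x))"
  unfolding lo_def by (intro continuous_intros)

lemma exists_complement:
  fixes W V :: "(complex^'n) set"
  assumes "vec.subspace W" "vec.subspace V" "W \<subseteq> V"
  shows "\<exists>N. vec.subspace N \<and> N \<subseteq> V \<and> N \<inter> W = {0} \<and> vec.dim N + vec.dim W = vec.dim V"
proof -
  obtain B0 where B0: "B0 \<subseteq> W" "vec.independent B0" "W \<subseteq> vec.span B0" "card B0 = vec.dim W"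
    using vec.basis_exists by blast
  obtain B where B: "B0 \<subseteq> B" "B \<subseteq> V" "vec.independent B" "V \<subseteq> vec.span B"
    using vec.maximal_independent_subset_extend[of B0 V] B0 assms by blast
  have fin: "finite B" by (rule vec.finiteI_independent) (rule B)
  have cB: "card B = vec.dim V" by (rule vec.basis_card_eq_dim) (use B in auto)
  let ?N = "vec.span (B - B0)"
  have NV: "?N \<subseteq> V" by (rule vec.span_minimal) (use B assms in auto)
  have dN: "vec.dim ?N = card (B - B0)"
    unfolding vec.dim_span by (rule vec.dim_eq_card_independent) (use B vec.independent_mono in blast)
  have d: "vec.dim ?N + vec.dim W = vec.dim V"
    using card_mono[OF fin B(1)] card_Diff_subset[of B0 B] finite_subset[OF B(1) fin] B B0 cB dN by simp
  have eq: "vec.dim {x + y |x y. x \<in> ?N \<and> y \<in> W} + vec.dim (?N \<inter> W) = vec.dim ?N + vec.dim W"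
    by (rule vec.dim_sums_Int) (use assms in auto)
  have sub: "vec.subspace {x + y |x y. x \<in> ?N \<and> y \<in> W}"
    by (rule vec.subspace_sums) (use assms in auto)
  have "B \<subseteq> {x + y |x y. x \<in> ?N \<and> y \<in> W}"
  proof
    fix b assume b: "b \<in> B"
    show "b \<in> {x + y |x y. x \<in> ?N \<and> y \<in> W}"
    proof (cases "b \<in> B0")
      case True
      then have "b = 0 + b" "0 \<in> ?N" "b \<in> W" using B0 vec.span_zero by auto
      then show ?thesis by blast
    next
      case False
      then have "b = b + 0" "b \<in> ?N" "0 \<in> W" using b assms by (auto simp: vec.span_base vec.subspace_0)
      then show ?thesis by blast
    qed
  qed
  then have "vec.span B \<subseteq> {x + y |x y. x \<in> ?N \<and> y \<in> W}"
    using sub by (rule vec.span_minimal)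
  then have "vec.dim V \<le> vec.dim {x + y |x y. x \<in> ?N \<and> y \<in> W}"
    using B by (meson order_trans vec.dim_subset)
  then have "vec.dim (?N \<inter> W) = 0" using eq d by linarith
  then have "?N \<inter> W \<subseteq> {0}" unfolding vec.dim_eq_0 .
  moreover have "0 \<in> ?N \<inter> W" using assms by (simp add: vec.subspace_0 vec.span_zero)
  ultimately show ?thesis using NV d by (intro exI[of _ ?N]) auto
qed

context dim_seq
begin

lemma openin_flags: "openin (flag_top dims) (flags dims :: 'n flag set)"
proof -
  have "{g \<in> SL_C. act g bf \<in> (flags dims :: 'n flag set)} = SL_C"
    using act_flags[OF SL_C_invertible bf_flags] by auto
  then show ?thesis by (simp add: openin_flag_top)
qed

lemma topspace_flag_top [simp]: "topspace (flag_top dims :: 'n flag topology) = flags dims"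
  using openin_flags openin_flag_top[of dims] by (metis openin_subset openin_topspace subset_antisym)

lemma openin_act_vimage:
  fixes f :: "'b::topological_space \<Rightarrow> 'n cmat"
  assumes "continuous_on S f" "f \<in> S \<rightarrow> SL_C" "openin (flag_top dims) W"
  shows "openin (top_of_set S) {x \<in> S. act (f x) bf \<in> W}"
proof -
  have "openin (top_of_set S) (S \<inter> f -` {g \<in> SL_C. act g bf \<in> W})"
    by (rule continuous_openin_preimage[OF assms(1,2)]) (use assms(3) in \<open>simp add: openin_flag_top\<close>)
  moreover have "S \<inter> f -` {g \<in> SL_C. act g bf \<in> W} = {x \<in> S. act (f x) bf \<in> W}"
    using assms(2) by auto
  ultimately show ?thesis by simp
qed

lemma openin_chart_vimage:
  assumes "openin (flag_top dims) W" "g \<in> SL_C"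
  shows "openin (top_of_set (crd Low)) {X \<in> crd Low. chart_param dims g X \<in> W}"
  unfolding chart_param_eq
  by (rule openin_act_vimage) (use assms in \<open>auto intro!: continuous_intros SL_C_mult lo_SL\<close>)

lemma chart_param_flags: "g \<in> SL_C \<Longrightarrow> X \<in> crd Low \<Longrightarrow> chart_param dims g X \<in> flags dims"
  by (simp add: chart_param_eq act_flags SL_C_invertible SL_C_mult lo_SL)

lemma continuous_on_sub: "continuous_on S (\<lambda>A. sub A a $ i $ j)"
  unfolding sub_def vec_lambda_beta
  by (cases "bi i \<le> a \<and> bi j \<le> a") (auto intro!: continuous_intros)

lemma open_Om: "open (Om :: 'n cmat set)"
proof -
  have "open {A :: 'n cmat. det (sub A (bi c)) \<noteq> 0}" for c
    by (intro open_Collect_neq continuous_on_det continuous_on_sub continuous_intros)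
  then show ?thesis
    unfolding Om_def Collect_all_eq by (intro open_INT) auto
qed

lemma continuous_on_Lam: "continuous_on Om Lam"
proof -
  have y: "continuous_on Om (\<lambda>A. ysol A c $ k)" for c k
    unfolding ysol_def vec_lambda_beta
  proof (intro continuous_on_divide continuous_on_det)
    show "continuous_on Om (\<lambda>A. (\<chi> i j. if j = k then axis c 1 $ i else sub A (bi c) $ i $ j) $ i $ j)" for i j
      using continuous_on_sub by (cases "j = k") auto
  qed (auto simp: Om_def intro: continuous_on_sub)
  have "continuous_on Om (\<lambda>A. if bi c < bi p then (A *v ysol A c) $ p else 0)" for c p
    unfolding matrix_vector_mult_def vec_lambda_beta
    by (cases "bi c < bi p", simp_all only: if_True if_False)
      (intro continuous_on_sum continuous_on_mult y continuous_on_component continuous_on_id continuous_on_const)+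
  then show ?thesis
    unfolding Lam_def by (intro continuous_on_vec_lambda)
qed

lemma act_cancel: "invertible (g :: 'n cmat) \<Longrightarrow> act g F = F' \<longleftrightarrow> F = act (matrix_inv g) F'"
  by (metis act_act act_one matrix_inv_left matrix_inv_right)

text \<open>Openness in the quotient topology is checked upstairs: a matrix \<open>h\<close> lands
  in the image exactly when \<open>matrix_inv g ** h\<close> is in \<open>Om\<close> and its
  coordinate \<open>Lam\<close> is in \<open>T\<close>, and both are open conditions.\<close>

lemma openin_chart_image:
  assumes g: "g \<in> SL_C" and T: "openin (top_of_set (crd Low)) T"
  shows "openin (flag_top dims) (chart_param dims g ` T)"
proof -
  obtain T' where T': "open T'" "T = crd Low \<inter> T'" using T by (auto simp: openin_open)
  have inv: "invertible g" by (rule SL_C_invertible) (rule g)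
  let ?S = "(\<lambda>h. matrix_inv g ** h) -` Om"
  let ?O = "?S \<inter> (\<lambda>h. Lam (matrix_inv g ** h)) -` T'"
  have S: "open ?S"
    by (rule open_vimage[OF open_Om]) (intro continuous_intros)
  have "open ?O"
    by (rule continuous_open_preimage[OF _ S T'(1)])
      (auto intro!: continuous_on_compose2[OF continuous_on_Lam] continuous_intros)
  moreover have "{h \<in> SL_C. act h bf \<in> chart_param dims g ` T} = SL_C \<inter> ?O"
  proof -
    have "act h bf \<in> chart_param dims g ` T \<longleftrightarrow> h \<in> ?O" for h
    proof
      assume "act h bf \<in> chart_param dims g ` T"
      then obtain X where X: "X \<in> T" "act h bf = act g (act (lo X) bf)"
        by (auto simp: chart_param_eq act_act)
      then have "act (matrix_inv g ** h) bf = act (lo X) bf"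
        by (metis act_act act_one inv matrix_inv_left)
      then show "h \<in> ?O" using Lam_unique[of X] X T' by auto
    next
      assume h: "h \<in> ?O"
      then have "act (lo (Lam (matrix_inv g ** h))) bf = act (matrix_inv g ** h) bf"
        using Om_act by blast
      then have "chart_param dims g (Lam (matrix_inv g ** h)) = act h bf"
        unfolding chart_param_eq act_act[symmetric]
        by (metis act_act act_one inv matrix_inv_right)
      moreover have "Lam (matrix_inv g ** h) \<in> T" using h T' Lam_in by auto
      ultimately show "act h bf \<in> chart_param dims g ` T" by force
    qed
    then show ?thesis by blast
  qed
  ultimately show ?thesis
    unfolding openin_flag_top
    using T openin_imp_subset g by (fastforce simp: openin_open intro!: chart_param_flags)
qed

text \<open>Lower semicontinuity of rank: on a complement of \<open>g\<^sup>-\<^sup>1 E \<inter> V\<close> in \<open>V\<close>, the map \<open>g\<close> stays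
  injective modulo \<open>E\<close> under small perturbations.\<close>

lemma openin_dim_Int_less:
  fixes S :: "'n set"
  assumes i: "i < r"
  shows "openin (flag_top dims) {F \<in> flags dims. vec.dim (F ! i \<inter> crd S) < t}"
proof -
  let ?V = "crd {a. bi a \<le> i}"
  let ?pr = "\<lambda>x :: 'n cvec. \<chi> p. if p \<in> S then 0 else x $ p"
  let ?W = "\<lambda>g. {x \<in> ?V. g *v x \<in> crd S}"
  have blpr: "bounded_linear ?pr"
    unfolding linear_conv_bounded_linear[symmetric] by (rule linearI) (auto simp: vec_eq_iff)
  have pr: "?pr x = 0 \<longleftrightarrow> x \<in> crd S" for x by (auto simp: vec_eq_iff crd_def)
  have subW: "vec.subspace (?W g)" for g :: "'n cmat"
    by (auto simp: vec.subspace_def crd_def matrix_vector_right_distrib vector_scalar_commute)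
  have dimW: "vec.dim (act g bf ! i \<inter> crd S) = vec.dim (?W g)" if "invertible g" for g :: "'n cmat"
  proof -
    have "act g bf ! i \<inter> crd S = (*v) g ` ?W g"
      using i by (auto simp: nth_bf' simp del: nth_bf)
    then show ?thesis using that by (simp add: dim_image_mult)
  qed
  have "\<exists>e>0. \<forall>h. norm (h - g) < e \<longrightarrow> vec.dim (?W h) < t" if g: "vec.dim (?W g) < t" for g :: "'n cmat"
  proof -
    obtain N where N: "vec.subspace N" "N \<subseteq> ?V" "N \<inter> ?W g = {0}" "vec.dim N + vec.dim (?W g) = vec.dim ?V"
      using exists_complement[OF subW subspace_crd, of g "{a. bi a \<le> i}"] by auto
    have bl: "bounded_linear (\<lambda>x. ?pr (h *v x))" for h :: "'n cmat"
      by (rule bounded_linear_compose[OF blpr])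
        (rule bounded_bilinear.bounded_linear_right[OF bounded_bilinear_matrix_vector])
    have "\<forall>x\<in>N. ?pr (g *v x) = 0 \<longrightarrow> x = 0"
      using N unfolding pr by blast
    then obtain e where e: "e > 0" "\<And>x. x \<in> N \<Longrightarrow> e * norm x \<le> norm (?pr (g *v x))"
      using injective_imp_isometric[OF closed_csubspace[OF N(1)] real_subspace[OF N(1)] bl[of g]] by blast
    obtain K where K: "0 < K" "\<And>A x. norm ((A :: 'n cmat) *v x) \<le> norm A * norm x * K"
      using bounded_bilinear.pos_bounded[OF bounded_bilinear_matrix_vector] by blast
    obtain K' where K': "0 < K'" "\<And>x. norm (?pr x) \<le> norm x * K'"
      using bounded_linear.pos_bounded[OF blpr] by blast
    \<comment> \<open>The number \<open>e\<close> bounds the map induced by \<open>g\<close> from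
      below on the complement \<open>N\<close>, and \<open>K * K'\<close> bounds multiplication
      followed by the projection. A perturbation of this size creates no kernel vector in
      \<open>N\<close>.\<close>
    have "vec.dim (?W h) < t" if h: "norm (h - g) < e / (K * K')" for h :: "'n cmat"
    proof -
      have "x = 0" if x: "x \<in> N" "x \<in> ?W h" for x
      proof (rule ccontr)
        assume "x \<noteq> 0"
        have "?pr (h *v x) = 0" using x(2) unfolding pr by blast
        moreover have "?pr ((h - g) *v x) = ?pr (h *v x) - ?pr (g *v x)"
          unfolding matrix_vector_mult_diff_rdistrib
          by (rule linear_diff[OF bounded_linear.linear[OF blpr]])
        ultimately have "?pr (g *v x) = - ?pr ((h - g) *v x)" by simp
        then have "norm (?pr (g *v x)) \<le> norm ((h - g) *v x) * K'"
          by (simp only: norm_minus_cancel K'(2))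
        also have "\<dots> \<le> (norm (h - g) * norm x * K) * K'"
          by (rule mult_right_mono[OF K(2)]) (use K' in simp)
        also have "\<dots> = norm (h - g) * (K * K') * norm x" by simp
        also have "\<dots> < e * norm x"
          using h \<open>x \<noteq> 0\<close> K K' by (intro mult_strict_right_mono) (auto simp: field_simps)
        finally show False using e(2)[OF x(1)] by simp
      qed
      then have 0: "N \<inter> ?W h \<subseteq> {0}" by auto
      have "vec.dim {x + y |x y. x \<in> N \<and> y \<in> ?W h} + vec.dim (N \<inter> ?W h) = vec.dim N + vec.dim (?W h)"
        by (rule vec.dim_sums_Int[OF N(1) subW])
      moreover have "{x + y |x y. x \<in> N \<and> y \<in> ?W h} \<subseteq> ?V"
        using N(2) vec.subspace_add[OF subspace_crd] by auto
      then have "vec.dim {x + y |x y. x \<in> N \<and> y \<in> ?W h} \<le> vec.dim ?V"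
        by (rule vec.dim_subset)
      moreover have "vec.dim (N \<inter> ?W h) = 0" using 0 by (simp only: vec.dim_eq_0)
      ultimately show ?thesis using N(4) g by simp
    qed
    then show ?thesis using e K K' by (intro exI[of _ "e / (K * K')"]) auto
  qed
  then have "open {g :: 'n cmat. vec.dim (?W g) < t}"
    unfolding open_dist dist_norm by blast
  moreover have "{g \<in> SL_C. act g bf \<in> {F \<in> flags dims. vec.dim (F ! i \<inter> crd S) < t}}
      = SL_C \<inter> {g. vec.dim (?W g) < t}"
    by (auto simp: dimW SL_C_invertible act_flags)
  ultimately show ?thesis
    unfolding openin_flag_top by (auto simp: openin_open)
qed

text \<open>One chart centred at each point of \<open>M\<close>, in which \<open>M\<close> is
  linear, is enough: every other chart is straightened by the transition map to that one.\<close>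

lemma complex_submanifold_chartsI:
  assumes M: "M \<subseteq> flags dims"
    and ch: "\<And>F. F \<in> M \<Longrightarrow> \<exists>g\<in>SL_C. F = act g bf \<and> vec.subspace {X \<in> crd Low. chart_param dims g X \<in> M} \<and>
       vec.dim {X \<in> crd Low. chart_param dims g X \<in> M} = d"
  shows "complex_submanifold dims d M"
  unfolding complex_submanifold_def chart_space_eq
proof (intro conjI M ballI)
  fix g :: "'n cmat" assume g: "g \<in> SL_C"
  let ?S = "{X \<in> crd Low. chart_param dims g X \<in> M}"
  show "complex_submanifold_of (crd Low) d ?S"
    unfolding complex_submanifold_of_def
  proof (intro conjI ballI)
    fix X0 assume X0: "X0 \<in> ?S"
    then obtain g' where g': "g' \<in> SL_C" "chart_param dims g X0 = act g' bf"
      "vec.subspace {X \<in> crd Low. chart_param dims g' X \<in> M}"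
      "vec.dim {X \<in> crd Low. chart_param dims g' X \<in> M} = d"
      using ch by blast
    let ?L = "{X \<in> crd Low. chart_param dims g' X \<in> M}"
    \<comment> \<open>\<open>Lam (tr a b X)\<close> is the coordinate in the chart of
      \<open>a\<close> of the point with coordinate \<open>X\<close> in the chart of
      \<open>b\<close>, and \<open>U a b\<close> is the domain of this transition map.\<close>
    define tr where "tr a b X = (matrix_inv a ** b) ** lo X" for a b :: "'n cmat" and X
    define U where "U a b = {X \<in> crd Low. tr a b X \<in> Om}" for a b
    have tr_act: "act a (act (tr a b X) bf) = chart_param dims b X" if "a \<in> SL_C" for a b X
      using matrix_inv_right[OF SL_C_invertible[OF that]]
      by (simp add: tr_def chart_param_eq act_act matrix_mul_assoc)
    have opU: "openin (top_of_set (crd Low)) (U a b)" for a b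
    proof -
      have "open (tr a b -` Om)"
        unfolding tr_def by (rule open_vimage[OF open_Om]) (intro continuous_intros)
      moreover have "U a b = crd Low \<inter> tr a b -` Om" by (auto simp: U_def)
      ultimately show ?thesis by (auto simp: openin_open)
    qed
    have chart_eq: "chart_param dims a (Lam (tr a b X)) = chart_param dims b X" if "a \<in> SL_C" "X \<in> U a b" for a b X
      using Om_act(2)[of "tr a b X"] tr_act[OF that(1), of b X] that(2)
      by (simp add: U_def chart_param_eq act_act[symmetric])
    have inverse_tr: "Lam (tr a b X) \<in> U b a" "Lam (tr b a (Lam (tr a b X))) = X"
      if a: "a \<in> SL_C" and b: "b \<in> SL_C" and X: "X \<in> U a b" for a b X
    proof -
      let ?Y = "Lam (tr a b X)"
      have "act b (act (tr b a ?Y) bf) = act b (act (lo X) bf)"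
        using tr_act[OF b, of a ?Y] chart_eq[OF a X] by (simp add: chart_param_eq act_act)
      then have "act (tr b a ?Y) bf = act (lo X) bf"
        by (rule act_inj[OF SL_C_invertible[OF b]])
      moreover have "X \<in> crd Low" using X by (simp add: U_def)
      ultimately show "Lam (tr a b X) \<in> U b a" "Lam (tr b a (Lam (tr a b X))) = X"
        using Lam_unique by (auto simp: U_def Lam_in)
    qed
    have hol: "holomorphic_map_on (\<lambda>X. Lam (tr a b X)) (U a b)" for a b
    proof (rule holomorphic_map_onI)
      fix X i assume "X \<in> U a b"
      then show "holo (\<lambda>X. Lam (tr a b X) $ i) X"
        unfolding U_def
      proof (intro holo_Lam)
        show "holo (\<lambda>X. tr a b X $ i $ j) X" for i j
          unfolding tr_def matrix_matrix_mult_def lo_nth vec_lambda_beta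
          by (intro holo_sum holo_mult holo_const holo_add holo_coord)
      qed simp
    qed
    have image_tr: "(\<lambda>X. Lam (tr a b X)) ` U a b = U b a" if "a \<in> SL_C" "b \<in> SL_C" for a b
    proof (intro subset_antisym subsetI)
      fix Y assume "Y \<in> U b a"
      then show "Y \<in> (\<lambda>X. Lam (tr a b X)) ` U a b"
        using inverse_tr[OF that(2,1)] by (intro image_eqI[of _ _ "Lam (tr b a Y)"]) auto
    qed (use inverse_tr[OF that] in auto)
    have bih: "biholomorphism (U g' g) (U g g') (\<lambda>X. Lam (tr g' g X)) (\<lambda>X. Lam (tr g g' X))"
      unfolding biholomorphism_def
      by (intro conjI ballI hol image_tr g g'(1)) (use inverse_tr[OF g'(1) g] inverse_tr[OF g g'(1)] in auto)
    have "act g' (act (tr g' g X0) bf) = act g' (act (lo 0) bf)"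
      using tr_act[OF g'(1)] g'(2) by simp
    then have "act (tr g' g X0) bf = act (lo 0) bf"
      by (rule act_inj[OF SL_C_invertible[OF g'(1)]])
    then have X0U: "X0 \<in> U g' g"
      using Lam_unique(1)[of 0 "tr g' g X0"] X0 by (simp add: U_def vec.subspace_0)
    have im: "(\<lambda>X. Lam (tr g' g X)) ` (?S \<inter> U g' g) = ?L \<inter> U g g'"
    proof
      show "(\<lambda>X. Lam (tr g' g X)) ` (?S \<inter> U g' g) \<subseteq> ?L \<inter> U g g'"
        using inverse_tr[OF g'(1) g] chart_eq[OF g'(1)] by (auto simp: Lam_in)
      show "?L \<inter> U g g' \<subseteq> (\<lambda>X. Lam (tr g' g X)) ` (?S \<inter> U g' g)"
      proof
        fix Y assume Y: "Y \<in> ?L \<inter> U g g'"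
        then have "Lam (tr g g' Y) \<in> ?S \<inter> U g' g" "Lam (tr g' g (Lam (tr g g' Y))) = Y"
          using inverse_tr[OF g g'(1)] chart_eq[OF g] by (auto simp: Lam_in)
        then show "Y \<in> (\<lambda>X. Lam (tr g' g X)) ` (?S \<inter> U g' g)" by (metis (no_types, lifting) image_eqI)
      qed
    qed
    show "\<exists>U V h k L. openin (top_of_set (crd Low)) U \<and> openin (top_of_set (crd Low)) V \<and> X0 \<in> U \<and>
        biholomorphism U V h k \<and> vec.subspace L \<and> L \<subseteq> crd Low \<and> vec.dim L = d \<and> h ` (?S \<inter> U) = L \<inter> V"
      by (rule exI[of _ "U g' g"], rule exI[of _ "U g g'"], rule exI[of _ "\<lambda>X. Lam (tr g' g X)"],
          rule exI[of _ "\<lambda>X. Lam (tr g g' X)"], rule exI[of _ ?L])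
        (use opU X0U bih g' im in auto)
  qed auto
qed

text \<open>The tangent space of \<open>M\<close> at the point \<open>act g bf\<close>, expressed in
  the chart centred there by \<open>g\<close>. It depends on \<open>g\<close> and not only on the
  point, so comparisons always use the same \<open>g\<close>.\<close>

definition tg :: "'n cmat \<Rightarrow> 'n flag set \<Rightarrow> (complex^('n \<times> 'n)) set" where
  "tg g M = tang {X \<in> crd Low. chart_param dims g X \<in> M} 0"

lemma tg_subspace:
  assumes "complex_submanifold dims d M" "g \<in> SL_C" "act g bf \<in> M"
  shows "vec.subspace (tg g M)" "vec.dim (tg g M) = d"
  using tang_submanifold[of "crd Low" d "{X \<in> crd Low. chart_param dims g X \<in> M}" 0] assms
  by (auto simp: tg_def complex_submanifold_def chart_space_eq chart_param_0 vec.subspace_0)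

lemma tg_mono:
  assumes W: "openin (flag_top dims) W" "M \<inter> W \<subseteq> M'" "g \<in> SL_C" "act g bf \<in> W"
  shows "tg g M \<subseteq> tg g M'"
proof
  fix v assume "v \<in> tg g M"
  then obtain c where c: "c 0 = 0" "\<forall>\<^sub>F t in at 0. c t \<in> {X \<in> crd Low. chart_param dims g X \<in> M}"
    "(c has_vector_derivative v) (at 0)" by (auto simp: tg_def tang_def)
  have "\<forall>\<^sub>F t in at 0. c t \<in> {X \<in> crd Low. chart_param dims g X \<in> W}"
  proof (rule curve_in_nbhd[OF c(3) _ openin_chart_vimage[OF W(1,3)]])
    show "\<forall>\<^sub>F t in at 0. c t \<in> crd Low" using c(2) by eventually_elim simp
  qed (use c W in \<open>simp add: chart_param_0 vec.subspace_0\<close>)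
  with c(2) have "\<forall>\<^sub>F t in at 0. c t \<in> {X \<in> crd Low. chart_param dims g X \<in> M'}"
    by eventually_elim (use W(2) in auto)
  then show "v \<in> tg g M'" using c by (auto simp: tg_def tang_def)
qed

text \<open>The dimension is well defined: by density two admissible pieces \<open>M\<close> and
  \<open>M'\<close> share a point, near which both coincide with \<open>A\<close>, so their tangent
  spaces there are equal.\<close>

lemma complex_dim_eqI:
  fixes A :: "'n flag set"
  assumes A: "A \<noteq> {}" "A \<subseteq> flags dims"
    and M: "openin (subtopology (flag_top dims) A) M" "A \<subseteq> (flag_top dims) closure_of M"
      "complex_submanifold dims d M"
  shows "complex_dim dims A = d"
  unfolding complex_dim_def
proof (rule the_equality)
  show "\<exists>M. openin (subtopology (flag_top dims) A) M \<and> A \<subseteq> (flag_top dims) closure_of M \<and> complex_submanifold dims d M"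
    using M by blast
  fix d' assume "\<exists>M. openin (subtopology (flag_top dims) A) M \<and> A \<subseteq> (flag_top dims) closure_of M \<and> complex_submanifold dims d' M"
  then obtain M' where M': "openin (subtopology (flag_top dims) A) M'" "A \<subseteq> (flag_top dims) closure_of M'"
    "complex_submanifold dims d' M'" by blast
  obtain W W' where W: "openin (flag_top dims) W" "M = W \<inter> A" and W': "openin (flag_top dims) W'" "M' = W' \<inter> A"
    using M(1) M'(1) by (auto simp: openin_subtopology)
  have "M \<noteq> {}" using A M(2) by auto
  then obtain F0 where F0: "F0 \<in> M" by blast
  then have "F0 \<in> (flag_top dims) closure_of M'" using W M' by blast
  then obtain F where F: "F \<in> M'" "F \<in> W"
    using F0 W by (auto simp: in_closure_of)
  have FA: "F \<in> A" using F W' by blast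
  then obtain g where g: "g \<in> SL_C" "act g bf = F"
    using flags_transitive A by blast
  have WW: "openin (flag_top dims) (W \<inter> W')" using W W' by blast
  have "tg g M \<subseteq> tg g M'" by (rule tg_mono[OF WW]) (use W W' F g in auto)
  moreover have "tg g M' \<subseteq> tg g M" by (rule tg_mono[OF WW]) (use W W' F g in auto)
  ultimately have "tg g M = tg g M'" by blast
  moreover have "vec.dim (tg g M) = d" by (rule tg_subspace[OF M(3) g(1)]) (use W F FA g in auto)
  moreover have "vec.dim (tg g M') = d'" by (rule tg_subspace[OF M'(3) g(1)]) (use F g in auto)
  ultimately show "d' = d" by simp
qed

lemma complex_dim_flags: "complex_dim dims (flags dims :: 'n flag set) = card Low"
proof (rule complex_dim_eqI)
  show "(flags dims :: 'n flag set) \<noteq> {}" using bf_flags by blast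
  show "flags dims \<subseteq> (flag_top dims) closure_of (flags dims :: 'n flag set)"
    by (rule closure_of_subset) simp
  show "complex_submanifold dims (card Low) (flags dims :: 'n flag set)"
  proof (rule complex_submanifold_chartsI)
    fix F :: "'n flag" assume "F \<in> flags dims"
    then obtain g where g: "g \<in> SL_C" "act g bf = F" using flags_transitive by blast
    have "{X \<in> crd Low. chart_param dims g X \<in> flags dims} = crd Low"
      using g by (auto simp: chart_param_flags)
    then show "\<exists>g\<in>SL_C. F = act g bf \<and> vec.subspace {X \<in> crd Low. chart_param dims g X \<in> flags dims} \<and>
       vec.dim {X \<in> crd Low. chart_param dims g X \<in> flags dims} = card Low"
      using g by (intro bexI[of _ g]) auto
  qed simp
  show "openin (subtopology (flag_top dims) (flags dims)) (flags dims :: 'n flag set)"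
    by (metis openin_topspace topspace_flag_top subtopology_topspace)
qed simp

end

section \<open>Schubert varieties\<close>

definition at_pos :: "'n::{finite,linorder} list \<Rightarrow> 'n \<Rightarrow> 'n" where
  "at_pos w a = w ! pos a"

definition perm_mat :: "('n \<Rightarrow> 'n) \<Rightarrow> complex^'n^'n" where
  "perm_mat \<sigma> = (\<chi> p a. if p = \<sigma> a then 1 else 0)"

lemma perm_list:
  fixes w :: "'n::{finite,linorder} list"
  assumes "w \<in> permutations_of_set UNIV"
  shows "distinct w" "set w = UNIV" "length w = CARD('n)"
  using assms distinct_card[of w] by (auto simp: permutations_of_set_def)

lemma set_take_eq:
  assumes "length (w :: 'n::{finite,linorder} list) = CARD('n)"
  shows "set (take k w) = at_pos w ` ini k"
proof (intro set_eqI iffI)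
  fix x assume "x \<in> set (take k w)"
  then obtain j where j: "j < k" "j < CARD('n)" "x = w ! j"
    using assms by (auto simp: in_set_conv_nth)
  then obtain a :: 'n where "pos a = j" using pos_surj by blast
  then show "x \<in> at_pos w ` ini k" using j by (auto simp: at_pos_def)
next
  fix x assume "x \<in> at_pos w ` ini k"
  then obtain a where "a \<in> ini k" "x = at_pos w a" by blast
  then have "pos a < k" "x = w ! pos a" by (auto simp: at_pos_def)
  then show "x \<in> set (take k w)"
    using assms pos_less_card[of a] by (auto simp: in_set_conv_nth intro!: exI[of _ "pos a"])
qed

lemma bij_at_pos:
  fixes w :: "'n::{finite,linorder} list"
  assumes "w \<in> permutations_of_set UNIV"
  shows "bij (at_pos w)"
proof -
  have "surj (at_pos w)"
    using set_take_eq[of w "CARD('n)"] perm_list[OF assms] by simp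
  then show ?thesis by (simp add: bij_def finite_UNIV_surj_inj)
qed

lemma mult_perm_mat [simp]: "(A ** perm_mat \<sigma>) $ p $ a = A $ p $ \<sigma> a"
  by (simp add: matrix_matrix_mult_def perm_mat_def if_distrib[of "\<lambda>x. _ * x"] cong: if_cong)

lemma perm_mat_mult: "inj \<sigma> \<Longrightarrow> (perm_mat \<sigma> ** A) $ \<sigma> p $ a = A $ p $ a"
  by (simp add: matrix_matrix_mult_def perm_mat_def inj_eq if_distrib[of "\<lambda>x. x * _"] cong: if_cong)

lemma perm_mat_conj:
  assumes "bij \<sigma>"
  shows "B ** perm_mat \<sigma> = perm_mat \<sigma> ** (\<chi> a c. B $ \<sigma> a $ \<sigma> c)"
proof -
  have "(B ** perm_mat \<sigma>) $ p $ c = (perm_mat \<sigma> ** (\<chi> a c. B $ \<sigma> a $ \<sigma> c)) $ p $ c" for p c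
  proof -
    obtain a where "p = \<sigma> a" using surjD[OF bij_is_surj[OF assms], of p] by blast
    then show ?thesis using assms by (simp add: perm_mat_mult bij_is_inj)
  qed
  then show ?thesis unfolding vec_eq_iff by blast
qed

lemma perm_mat_axis: "perm_mat \<sigma> *v axis c 1 = axis (\<sigma> c) 1"
  by (simp add: vec_eq_iff) (simp add: perm_mat_def axis_def)

lemma perm_mat_invertible:
  assumes "bij \<sigma>"
  shows "invertible (perm_mat \<sigma>)"
proof -
  have "perm_mat \<sigma> ** perm_mat (inv \<sigma>) = mat 1"
    using assms by (simp add: vec_eq_iff) (simp add: perm_mat_def mat_def surj_f_inv_f bij_is_surj)
  then show ?thesis using invertible_right_inverse by blast
qed

lemma perm_mat_crd:
  assumes "bij \<sigma>"
  shows "(*v) (perm_mat \<sigma>) ` crd S = crd (\<sigma> ` S)"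
proof (rule vec.subspace_dim_equal)
  show "(*v) (perm_mat \<sigma>) ` crd S \<subseteq> crd (\<sigma> ` S)"
  proof clarify
    fix x assume x: "x \<in> crd S"
    have "column j (perm_mat \<sigma>) = axis (\<sigma> j) 1" for j
      by (simp add: column_def perm_mat_def axis_def vec_eq_iff)
    then show "perm_mat \<sigma> *v x \<in> crd (\<sigma> ` S)"
      using x by (intro subspace_mult_in[of _ S]) auto
  qed
  show "vec.dim (crd (\<sigma> ` S)) \<le> vec.dim ((*v) (perm_mat \<sigma>) ` crd S)"
    using assms by (simp add: dim_image_mult perm_mat_invertible card_image_le)
qed (auto simp: subspace_image_mult)

text \<open>Triangularity as preservation of the standard flag passes to products and inverses
  without computing entries.\<close>

lemma upper_triangular_iff:
  fixes A :: "complex^'n::{finite,linorder}^'n::{finite,linorder}"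
  shows "(\<forall>i j. j < i \<longrightarrow> A $ i $ j = 0) \<longleftrightarrow> (\<forall>k. (*v) A ` crd (ini k) \<subseteq> crd (ini k))"
proof
  assume A: "\<forall>i j. j < i \<longrightarrow> A $ i $ j = 0"
  have "A $ i $ j * x $ j = 0" if "x \<in> crd (ini k)" "\<not> pos i < k" for i j k x
  proof (cases "j < i")
    case False
    then have "pos i \<le> pos j" by simp
    then show ?thesis using that by (auto simp: crd_def simp del: pos_le_iff)
  qed (use A in auto)
  then show "\<forall>k. (*v) A ` crd (ini k) \<subseteq> crd (ini k)"
    by (auto simp: crd_def matrix_vector_mult_def intro!: sum.neutral)
next
  assume A: "\<forall>k. (*v) A ` crd (ini k) \<subseteq> crd (ini k)"
  show "\<forall>i j. j < i \<longrightarrow> A $ i $ j = 0"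
  proof (intro allI impI)
    fix i j :: 'n assume "j < i"
    have "axis j 1 \<in> crd (ini (Suc (pos j)))" by simp
    then have "A *v axis j 1 \<in> crd (ini (Suc (pos j)))" using A by blast
    then have "(A *v axis j 1) $ i = 0" using \<open>j < i\<close> by (auto simp: crd_def less_Suc_eq_le)
    then show "A $ i $ j = 0" unfolding mult_axis_nth .
  qed
qed

lemma Borel_image:
  fixes b :: "complex^'n::{finite,linorder}^'n::{finite,linorder}"
  assumes "b \<in> Borel"
  shows "(*v) b ` crd (ini k) = crd (ini k)"
proof (rule vec.subspace_dim_equal)
  show "(*v) b ` crd (ini k) \<subseteq> crd (ini k)"
    using assms upper_triangular_iff unfolding Borel_def by blast
  have "invertible b" using assms by (simp add: Borel_def SL_C_invertible)
  then show "vec.dim (crd (ini k :: 'n set)) \<le> vec.dim ((*v) b ` crd (ini k))"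
    by (simp add: dim_image_mult)
qed (auto simp: subspace_image_mult)

lemma Borel_mult: "a \<in> Borel \<Longrightarrow> b \<in> Borel \<Longrightarrow> a ** b \<in> Borel"
proof -
  assume a: "a \<in> Borel" and b: "b \<in> Borel"
  have "(*v) (a ** b) ` crd (ini k) = crd (ini k)" for k
    using Borel_image[OF a] Borel_image[OF b]
    by (simp add: matrix_vector_mul_assoc[symmetric] image_comp[symmetric, unfolded o_def])
  then have "\<forall>i j. j < i \<longrightarrow> (a ** b) $ i $ j = 0"
    using upper_triangular_iff by blast
  then show "a ** b \<in> Borel" using a b by (auto simp: Borel_def SL_C_mult)
qed

lemma Borel_inv: "b \<in> Borel \<Longrightarrow> matrix_inv b \<in> Borel"
proof -
  assume b: "b \<in> Borel"
  then have SL: "b \<in> SL_C" by (simp add: Borel_def)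
  have "(*v) (matrix_inv b) ` crd (ini k) = crd (ini k)" for k
  proof -
    have "(*v) (matrix_inv b) ` crd (ini k) = (*v) (matrix_inv b) ` (*v) b ` crd (ini k)"
      using Borel_image[OF b] by simp
    also have "\<dots> = crd (ini k)"
      by (simp add: image_comp o_def matrix_vector_mul_assoc matrix_inv_left SL SL_C_invertible)
    finally show ?thesis .
  qed
  then have "\<forall>i j. j < i \<longrightarrow> matrix_inv b $ i $ j = 0"
    using upper_triangular_iff by blast
  then show "matrix_inv b \<in> Borel" using SL by (auto simp: Borel_def SL_C_inv)
qed

lemma one_Borel: "mat 1 \<in> Borel"
  by (simp add: Borel_def) (simp add: mat_def)

lemma Borel_diag:
  assumes "b \<in> Borel"
  shows "b $ i $ i \<noteq> 0"
proof -
  have "det b = (\<Prod>i\<in>UNIV. b $ i $ i)"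
    by (rule det_upper_triangular) (use assms in \<open>auto simp: Borel_def\<close>)
  then have "(\<Prod>i\<in>UNIV. b $ i $ i) \<noteq> 0"
    using assms by (auto simp: Borel_def SL_C_def)
  then show ?thesis by (simp add: prod_zero_iff)
qed

text \<open>\<open>T\<close> is triangular for the order pulled back along \<sigma>, and
  \<open>Q\<close> is closed upwards in it, so the rows are solved from the top down. With
  \<open>Q\<close> always true this yields injectivity; with a proper \<open>Q\<close> it yields the
  triangular shape of a solution.\<close>

lemma back_substitution:
  fixes T :: "complex^'n::{finite,linorder}^'n::{finite,linorder}" and \<sigma> :: "'n \<Rightarrow> 'n"
  assumes T: "\<And>k j. T $ k $ j \<noteq> 0 \<Longrightarrow> \<sigma> k \<le> \<sigma> j" "\<And>k. T $ k $ k \<noteq> 0" and \<sigma>: "inj \<sigma>"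
    and Q: "\<And>k. Q k \<Longrightarrow> (T *v x) $ k = 0" "\<And>j k. Q k \<Longrightarrow> \<sigma> k \<le> \<sigma> j \<Longrightarrow> Q j"
    and k: "Q k"
  shows "x $ k = 0"
  using k
proof (induction "CARD('n) - pos (\<sigma> k)" arbitrary: k rule: less_induct)
  case less
  have "T $ k $ j * x $ j = 0" if "j \<noteq> k" for j
  proof (cases "T $ k $ j = 0")
    case False
    then have le: "\<sigma> k \<le> \<sigma> j" by (rule T)
    then have "\<sigma> k < \<sigma> j" using that \<sigma> by (auto simp: inj_eq less_le)
    then have "pos (\<sigma> k) < pos (\<sigma> j)" by simp
    then have "CARD('n) - pos (\<sigma> j) < CARD('n) - pos (\<sigma> k)"
      using pos_less_card[of "\<sigma> j"] by linarith
    then show ?thesis using less(1) Q(2)[OF less(2) le] by simp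
  qed simp
  then have "(T *v x) $ k = (\<Sum>j\<in>UNIV. if j = k then T $ k $ k * x $ k else 0)"
    unfolding matrix_vector_mult_def vec_lambda_beta by (intro sum.cong) auto
  then have "T $ k $ k * x $ k = 0" using Q(1)[OF less(2)] by simp
  then show ?case using T(2) by simp
qed

context dim_seq
begin

text \<open>The inversions of \<open>w\<close> between different blocks, with the later position as
  row. They index the coordinates of the Schubert cell in the chart centred at its coordinate
  flag.\<close>

definition len_set :: "'n list \<Rightarrow> ('n \<times> 'n) set" where
  "len_set w = {(a, c) \<in> Low. at_pos w a < at_pos w c}"

lemma flag_proj_perm:
  assumes "w \<in> permutations_of_set (UNIV :: 'n set)"
  shows "flag_proj dims (coord_flag w) = act (perm_mat (at_pos w)) bf"
proof -
  note len = perm_list(3)[OF assms]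
  show ?thesis
    unfolding flag_proj_coord_flag[OF len]
    by (intro nth_equalityI) (auto simp: perm_mat_crd[OF bij_at_pos[OF assms]] set_take_eq[OF len])
qed

lemma flag_proj_flags: "w \<in> permutations_of_set (UNIV :: 'n set) \<Longrightarrow> flag_proj dims (coord_flag w) \<in> flags dims"
  by (simp add: flag_proj_perm act_flags perm_mat_invertible bij_at_pos)

text \<open>Conjugating by the permutation matrix turns a Borel element into a matrix triangular for
  the order of the values of \<open>w\<close>. The solutions of Cramer's rule inherit this shape, so
  the unipotent factor has nonzero coordinates at inversions only.\<close>

lemma cell_chart:
  assumes w: "w \<in> permutations_of_set (UNIV :: 'n set)"
  shows "orbit Borel (flag_proj dims (coord_flag w)) = (\<lambda>X. act (perm_mat (at_pos w)) (act (lo X) bf)) ` crd (len_set w)"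
proof -
  let ?\<sigma> = "at_pos w"
  let ?P = "perm_mat ?\<sigma>"
  note bij = bij_at_pos[OF w]
  show ?thesis
    unfolding orbit_def flag_proj_perm[OF w]
  proof (intro subset_antisym subsetI)
    fix F assume "F \<in> (\<lambda>g. act g (act ?P bf)) ` Borel"
    then obtain b where b: "b \<in> Borel" "F = act b (act ?P bf)" by blast
    define A where "A = (\<chi> a c. b $ ?\<sigma> a $ ?\<sigma> c)"
    have bP: "b ** ?P = ?P ** A" unfolding A_def by (rule perm_mat_conj[OF bij])
    have sub1: "\<sigma>1 \<le> \<sigma>2" if "\<sigma>1 = ?\<sigma> k" "\<sigma>2 = ?\<sigma> j" "sub A i $ k $ j \<noteq> 0" for i k j \<sigma>1 \<sigma>2
      using that b by (auto simp: sub_def A_def Borel_def not_less[symmetric] split: if_splits)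
    have sub2: "sub A i $ k $ k \<noteq> 0" for i k
      using Borel_diag[OF b(1)] by (simp add: sub_def A_def)
    have Om: "A \<in> Om"
      unfolding Om_def
    proof clarify
      fix c assume "det (sub A (bi c)) = 0"
      then have "\<not> invertible (sub A (bi c))" by (simp add: invertible_iff_det)
      then obtain x where x: "sub A (bi c) *v x = 0" "x \<noteq> 0" unfolding invertible_iff_ker by auto
      have "x $ k = 0" for k
        by (rule back_substitution[of "sub A (bi c)" ?\<sigma> "\<lambda>_. True"])
          (use sub1 sub2 bij x in \<open>auto simp: bij_is_inj\<close>)
      with x show False by (simp add: vec_eq_iff)
    qed
    have y: "?\<sigma> k \<le> ?\<sigma> c" if "ysol A c $ k \<noteq> 0" for k c
    proof (rule ccontr)
      assume k: "\<not> ?\<sigma> k \<le> ?\<sigma> c"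
      have "ysol A c $ k = 0"
        by (rule back_substitution[of "sub A (bi c)" ?\<sigma> "\<lambda>k. \<not> ?\<sigma> k \<le> ?\<sigma> c"])
          (use sub1 sub2 bij k in \<open>auto simp: bij_is_inj ysol[OF Om] axis_def\<close>)
      with that show False by simp
    qed
    have A1: "?\<sigma> p \<le> ?\<sigma> k" if "A $ p $ k \<noteq> 0" for p k
      using that b by (auto simp: A_def Borel_def not_less[symmetric])
    have "Lam A \<in> crd (len_set w)"
    proof -
      have "at_pos w p < at_pos w c" if "Lam A $ (p, c) \<noteq> 0" for p c
      proof -
        have Low: "bi c < bi p" using that by (auto simp: Lam_def split: if_splits)
        with that have "(\<Sum>k\<in>UNIV. A $ p $ k * ysol A c $ k) \<noteq> 0"
          by (simp add: Lam_def matrix_vector_mult_def)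
        then obtain k where "A $ p $ k * ysol A c $ k \<noteq> 0" by (meson sum.neutral)
        then have "?\<sigma> p \<le> ?\<sigma> c" using A1[of p k] y[of c k] by (simp add: order_trans)
        moreover have "?\<sigma> p \<noteq> ?\<sigma> c" using Low bij by (auto simp: bij_is_inj inj_eq)
        ultimately show ?thesis by simp
      qed
      then show ?thesis using Lam_in[of A] by (force simp: crd_def len_set_def)
    qed
    moreover have "F = act ?P (act (lo (Lam A)) bf)"
      using b Om_act(2)[OF Om] by (simp add: act_act bP)
    ultimately show "F \<in> (\<lambda>X. act ?P (act (lo X) bf)) ` crd (len_set w)" by blast
  next
    fix F assume "F \<in> (\<lambda>X. act ?P (act (lo X) bf)) ` crd (len_set w)"
    then obtain X where X: "X \<in> crd (len_set w)" "F = act ?P (act (lo X) bf)" by blast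
    \<comment> \<open>\<open>lo X\<close> conjugated back; off the diagonal it is supported on
      inversions, which makes it upper triangular.\<close>
    define b where "b = (\<chi> p q. lo X $ (inv ?\<sigma> p) $ (inv ?\<sigma> q))"
    have "(\<chi> a c. b $ ?\<sigma> a $ ?\<sigma> c) = lo X"
      by (simp add: b_def vec_eq_iff bij bij_is_inj inv_f_f)
    then have bP: "b ** ?P = ?P ** lo X" using perm_mat_conj[OF bij, of b] by simp
    have up: "b $ i $ j = 0" if "j < i" for i j
    proof -
      have "(inv ?\<sigma> i, inv ?\<sigma> j) \<notin> len_set w"
        using that bij by (auto simp: len_set_def bij_is_surj surj_f_inv_f)
      moreover have "inv ?\<sigma> i \<noteq> inv ?\<sigma> j"
        using that bij by (metis bij_inv_eq_iff less_irrefl)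
      ultimately show ?thesis using X by (auto simp: b_def lo_nth crd_def)
    qed
    have "b $ i $ i = 1" for i
    proof -
      have "(inv ?\<sigma> i, inv ?\<sigma> i) \<notin> len_set w" by (auto simp: len_set_def)
      then show ?thesis using X by (auto simp: b_def lo_nth crd_def)
    qed
    then have "det b = 1" using det_upper_triangular[of b] up by simp
    then have "b \<in> Borel" using up by (simp add: Borel_def SL_C_def)
    moreover have "F = act b (act ?P bf)" by (simp add: X act_act bP)
    ultimately show "F \<in> (\<lambda>g. act g (act ?P bf)) ` Borel" by blast
  qed
qed

lemma crd_len_set: "crd (len_set w) \<subseteq> crd Low"
  by (rule crd_mono) (auto simp: len_set_def)

lemma cell_mem_iff:
  assumes w: "w \<in> permutations_of_set (UNIV :: 'n set)" and X: "X \<in> crd Low"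
  shows "act (perm_mat (at_pos w)) (act (lo X) bf) \<in> orbit Borel (flag_proj dims (coord_flag w)) \<longleftrightarrow> X \<in> crd (len_set w)"
proof
  assume "act (perm_mat (at_pos w)) (act (lo X) bf) \<in> orbit Borel (flag_proj dims (coord_flag w))"
  then obtain Y where Y: "Y \<in> crd (len_set w)"
    "act (perm_mat (at_pos w)) (act (lo X) bf) = act (perm_mat (at_pos w)) (act (lo Y) bf)"
    unfolding cell_chart[OF w] by blast
  have eq: "act (lo X) bf = act (lo Y) bf"
    by (rule act_inj[OF perm_mat_invertible[OF bij_at_pos[OF w]] Y(2)])
  have "Lam (lo X) = Y"
    by (rule Lam_unique(2)[OF _ eq]) (use Y crd_len_set in blast)
  then show "X \<in> crd (len_set w)" using Lam_lo[OF X] Y by simp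
qed (auto simp: cell_chart[OF w])

lemma orbit_Borel_iff:
  assumes "b \<in> (Borel :: 'n cmat set)"
  shows "act b F \<in> orbit Borel F0 \<longleftrightarrow> F \<in> orbit Borel F0"
proof
  assume "act b F \<in> orbit Borel F0"
  then obtain b' where b': "b' \<in> Borel" "act b F = act b' F0" by (auto simp: orbit_def)
  have "invertible b" using assms by (simp add: Borel_def SL_C_invertible)
  then have "F = act (matrix_inv b) (act b' F0)" using act_cancel[of b F "act b' F0"] b' by blast
  then have "F = act (matrix_inv b ** b') F0" by (simp only: act_act)
  moreover have "matrix_inv b ** b' \<in> Borel" by (intro Borel_mult Borel_inv assms b')
  ultimately show "F \<in> orbit Borel F0" unfolding orbit_def by blast
next
  assume "F \<in> orbit Borel F0"
  then obtain b' where "b' \<in> Borel" "act b F = act (b ** b') F0" by (auto simp: orbit_def act_act)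
  then show "act b F \<in> orbit Borel F0" using Borel_mult[OF assms] unfolding orbit_def by blast
qed

lemma schubert_subset_flags: "schubert dims w \<subseteq> (flags dims :: 'n flag set)"
  unfolding schubert_def by (metis closure_of_subset_topspace topspace_flag_top)

lemma complex_dim_schubert:
  assumes w: "w \<in> permutations_of_set (UNIV :: 'n set)"
  shows "complex_dim dims (schubert dims w) = card (len_set w)"
proof -
  let ?O = "orbit Borel (flag_proj dims (coord_flag w))"
  let ?P = "perm_mat (at_pos w)"
  obtain g where g: "g \<in> SL_C" "\<And>F. F \<in> flags dims \<Longrightarrow> act g F = act ?P F"
    using scale_to_SL[OF perm_mat_invertible[OF bij_at_pos[OF w]]] by blast
  have lof: "act (lo X) bf \<in> flags dims" if "X \<in> crd Low" for X
    using that by (simp add: act_flags SL_C_invertible lo_SL)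
  have chart: "chart_param dims (b ** g) X = act b (act ?P (act (lo X) bf))" if "X \<in> crd Low" for X b
    using g(2)[OF lof[OF that]] by (simp add: chart_param_eq act_act[symmetric])
  have chart1: "chart_param dims g X = act ?P (act (lo X) bf)" if "X \<in> crd Low" for X
    using chart[OF that, of "mat 1"] by simp
  have Of: "?O \<subseteq> flags dims"
    using flag_proj_flags[OF w] by (auto simp: orbit_def act_flags Borel_def SL_C_invertible)
  have sub: "complex_submanifold dims (card (len_set w)) ?O"
  proof (rule complex_submanifold_chartsI[OF Of])
    fix F assume "F \<in> ?O"
    then obtain b where b: "b \<in> Borel" "F = act b (flag_proj dims (coord_flag w))" by (auto simp: orbit_def)
    \<comment> \<open>The orbit is stable under the Borel element \<open>b\<close>, so moving the
      centre of the chart by \<open>b\<close> does not change the linear equations of the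
      orbit.\<close>
    have "{X \<in> crd Low. chart_param dims (b ** g) X \<in> ?O} = crd (len_set w)"
      using crd_len_set by (auto simp: chart orbit_Borel_iff[OF b(1)] cell_mem_iff[OF w] subset_iff)
    moreover have "F = act (b ** g) bf"
      using g(2)[OF bf_flags] b by (simp add: flag_proj_perm[OF w] act_act[symmetric])
    moreover have "b ** g \<in> SL_C" using b g by (simp add: SL_C_mult Borel_def)
    ultimately show "\<exists>g\<in>SL_C. F = act g bf \<and> vec.subspace {X \<in> crd Low. chart_param dims g X \<in> ?O} \<and>
        vec.dim {X \<in> crd Low. chart_param dims g X \<in> ?O} = card (len_set w)"
      by (intro bexI[of _ "b ** g"]) auto
  qed
  have Oeq: "?O = chart_param dims g ` crd (len_set w)"
    unfolding cell_chart[OF w] using crd_len_set by (auto simp: chart1 subset_iff image_iff)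
  \<comment> \<open>The rest of the chart is open and misses the cell, hence also its closure. The
    closure therefore meets the chart in the cell alone, which makes the cell open in it.\<close>
  let ?N = "chart_param dims g ` (crd Low - crd (len_set w))"
  have "closed (crd (len_set w))" by (rule closed_csubspace) simp
  then have "openin (top_of_set (crd Low)) (crd Low - crd (len_set w))"
    unfolding Diff_eq by (intro openin_open_Int) auto
  then have N: "openin (flag_top dims) ?N" by (rule openin_chart_image[OF g(1)])
  have "?N \<inter> ?O = {}" by (auto simp: chart1 cell_mem_iff[OF w])
  then have NS: "?N \<inter> schubert dims w = {}"
    unfolding schubert_def using openin_Int_closure_of_eq_empty[OF N] by blast
  have W: "openin (flag_top dims) (chart_param dims g ` crd Low)"
    by (rule openin_chart_image[OF g(1)]) simp
  have OS: "?O \<subseteq> schubert dims w"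
    unfolding schubert_def by (rule closure_of_subset) (simp add: Of)
  show ?thesis
  proof (rule complex_dim_eqI[OF _ _ _ _ sub])
    have "?O = chart_param dims g ` crd Low \<inter> schubert dims w"
      using NS OS Oeq crd_len_set by blast
    then show "openin (subtopology (flag_top dims) (schubert dims w)) ?O"
      using W by (auto simp: openin_subtopology)
    show "schubert dims w \<noteq> {}" using OS one_Borel by (auto simp: orbit_def)
    show "schubert dims w \<subseteq> flags dims"
      by (rule schubert_subset_flags)
  qed (simp add: schubert_def)
qed

lemma cell_subset_schubert:
  assumes w: "w \<in> permutations_of_set (UNIV :: 'n set)"
  shows "orbit Borel (flag_proj dims (coord_flag w)) \<subseteq> schubert dims w"
  unfolding schubert_def
  by (rule closure_of_subset) (use flag_proj_flags[OF w] in \<open>auto simp: orbit_def act_flags Borel_def SL_C_invertible\<close>)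

text \<open>On the cell the bound comes from the coordinate flag, since \<open>Borel\<close>
  preserves each \<open>crd (ini k)\<close>. The flags violating it form an open set, which would
  meet the cell if it contained a point of the closure.\<close>

lemma schubert_dim_ge:
  assumes w: "w \<in> permutations_of_set (UNIV :: 'n set)" and F: "F \<in> schubert dims w" and i: "i < r"
  shows "card (set (take (m (Suc i)) w) \<inter> ini k) \<le> vec.dim (F ! i \<inter> crd (ini k))"
proof (rule ccontr)
  let ?t = "card (set (take (m (Suc i)) w) \<inter> ini k)"
  let ?U = "{F \<in> flags dims. vec.dim (F ! i \<inter> crd (ini k :: 'n set)) < ?t}"
  assume "\<not> ?thesis"
  moreover have "F \<in> flags dims"
    using F schubert_subset_flags by blast
  ultimately have FU: "F \<in> ?U" by simp
  have "openin (flag_top dims) ?U" by (rule openin_dim_Int_less[OF i])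
  then obtain G where G: "G \<in> orbit Borel (flag_proj dims (coord_flag w))" "G \<in> ?U"
    using F FU unfolding schubert_def in_closure_of by meson
  then obtain b where b: "b \<in> Borel" "G = act b (flag_proj dims (coord_flag w))" by (auto simp: orbit_def)
  have inv: "invertible b" using b by (simp add: Borel_def SL_C_invertible)
  have "G ! i = (*v) b ` crd (set (take (m (Suc i)) w))"
    using b i by (simp add: flag_proj_coord_flag[OF perm_list(3)[OF w]])
  then have "(*v) b ` crd (set (take (m (Suc i)) w) \<inter> ini k) \<subseteq> G ! i \<inter> crd (ini k)"
    using Borel_image[OF b(1), of k] by (auto simp: crd_Int[symmetric])
  then have "vec.dim ((*v) b ` crd (set (take (m (Suc i)) w) \<inter> ini k)) \<le> vec.dim (G ! i \<inter> crd (ini k))"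
    by (rule vec.dim_subset)
  then show False using G inv by (simp add: dim_image_mult)
qed

text \<open>Membership of an index is visible as a jump of the counting function at its
  position.\<close>

lemma set_eq_of_card_ini:
  fixes A B :: "'n set"
  assumes "\<And>k. card (A \<inter> ini k) = card (B \<inter> ini k)"
  shows "A = B"
proof -
  have *: "x \<in> C \<longleftrightarrow> card (C \<inter> ini (Suc (pos x))) \<noteq> card (C \<inter> ini (pos x))" for x and C :: "'n set"
    unfolding ini_Suc by (cases "x \<in> C") simp_all
  show ?thesis by (rule set_eqI) (simp add: *[of _ A] *[of _ B] assms)
qed

text \<open>Each coordinate flag lies in the closure of the other cell, and the dimension bounds
  applied in both directions give equal counts in all initial segments.\<close>

lemma schubert_eq_imp:
  assumes w: "w \<in> permutations_of_set (UNIV :: 'n set)" and v: "v \<in> permutations_of_set (UNIV :: 'n set)"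
    and eq: "schubert dims w = schubert dims v" and i: "i < r"
  shows "set (take (m (Suc i)) w) = set (take (m (Suc i)) v)"
proof (rule set_eq_of_card_ini, rule antisym)
  have *: "card (set (take (m (Suc i)) a) \<inter> ini k) \<le> card (set (take (m (Suc i)) b) \<inter> ini k)"
    if a: "a \<in> permutations_of_set (UNIV :: 'n set)" and b: "b \<in> permutations_of_set (UNIV :: 'n set)"
      and eq: "schubert dims a = schubert dims b" for a b k
  proof -
    have "flag_proj dims (coord_flag b) \<in> orbit Borel (flag_proj dims (coord_flag b))"
      unfolding orbit_def using one_Borel by (intro image_eqI[of _ _ "mat 1"]) auto
    then have "flag_proj dims (coord_flag b) \<in> schubert dims a"
      using cell_subset_schubert[OF b] eq by blast
    from schubert_dim_ge[OF a this i, of k] show ?thesis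
      using i by (simp add: flag_proj_coord_flag[OF perm_list(3)[OF b]] crd_Int)
  qed
  fix k
  show "card (set (take (m (Suc i)) w) \<inter> ini k) \<le> card (set (take (m (Suc i)) v) \<inter> ini k)"
    by (rule *[OF w v eq])
  show "card (set (take (m (Suc i)) v) \<inter> ini k) \<le> card (set (take (m (Suc i)) w) \<inter> ini k)"
    by (rule *[OF v w eq[symmetric]])
qed

end

section \<open>Order reversal and the standard isotropic basis\<close>

definition rv :: "'n::{finite,linorder} \<Rightarrow> 'n" where
  "rv a = (THE b. pos b + pos a + 1 = CARD('n))"

lemma pos_rv: "pos (rv a) + pos a + 1 = CARD('n)" for a :: "'n::{finite,linorder}"
proof -
  have "CARD('n) - 1 - pos a < CARD('n)" by simp
  then obtain b :: 'n where b: "pos b = CARD('n) - 1 - pos a" using pos_surj by blast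
  then have "pos b + pos a + 1 = CARD('n)" using pos_less_card[of a] by simp
  moreover have "c = b" if "pos c + pos a + 1 = CARD('n)" for c :: 'n
  proof -
    have "pos c = pos b" using that calculation by linarith
    then show ?thesis by simp
  qed
  ultimately show ?thesis
    unfolding rv_def by (rule theI)
qed

lemma rv_rv [simp]: "rv (rv a) = a"
proof -
  have "pos (rv (rv a)) = pos a" using pos_rv[of a] pos_rv[of "rv a"] by linarith
  then show ?thesis by simp
qed

lemma rv_eq_iff [simp]: "rv a = rv b \<longleftrightarrow> a = b"
  by (metis rv_rv)

lemma bij_rv: "bij rv"
  by (rule o_bij[of rv]) auto

text \<open>In the first half, column \<open>a\<close> is the unit vector
  \<open>(e_a - i e_(rv a)) / sqrt 2\<close>; in the second half it is the conjugate of its mirror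
  column; a middle index keeps its standard basis vector. Conjugation thus exchanges mirror
  columns.\<close>

definition sg :: "complex^'n::{finite,linorder}^'n::{finite,linorder}" where
  "sg = (\<chi> p a. if a < rv a then (if p = a then of_real (1 / sqrt 2) else if p = rv a then - \<i> / sqrt 2 else 0)
     else if rv a < a then (if p = rv a then of_real (1 / sqrt 2) else if p = a then \<i> / sqrt 2 else 0)
     else if p = a then 1 else 0)"

lemma cj_column_sg: "cj (column a sg) = column (rv a) sg"
  by (auto simp: vec_eq_iff column_def sg_def)

lemma hm_two_support:
  assumes "\<And>p. p \<noteq> a \<Longrightarrow> p \<noteq> b \<Longrightarrow> x $ p * cnj (y $ p) = 0" "a \<noteq> b"
  shows "hm x y = x $ a * cnj (y $ a) + x $ b * cnj (y $ b)"
proof -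
  have "hm x y = (\<Sum>p\<in>{a, b}. x $ p * cnj (y $ p))"
    unfolding hm_def by (rule sum.mono_neutral_right) (use assms in auto)
  then show ?thesis using assms by simp
qed

lemma sg_unitary: "adj sg ** sg = mat 1"
proof -
  have sq: "complex_of_real (sqrt 2) * complex_of_real (sqrt 2) = 2"
    by (metis of_real_mult of_real_numeral real_sqrt_mult_self abs_numeral)
  have "hm (column j sg) (column i sg) = (if i = j then 1 else 0)" for i j :: 'a
  proof (cases "j = i \<or> j = rv i")
    case False
    then have "column j sg $ p * cnj (column i sg $ p) = 0" for p
      by (auto simp: column_def sg_def)
    then have "hm (column j sg) (column i sg) = 0" unfolding hm_def by (intro sum.neutral) blast
    then show ?thesis using False by auto
  next
    case True
    show ?thesis
    proof (cases "i = rv i")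
      case False
      then have "hm (column j sg) (column i sg) = column j sg $ i * cnj (column i sg $ i)
          + column j sg $ rv i * cnj (column i sg $ rv i)"
        by (intro hm_two_support) (auto simp: column_def sg_def)
      then show ?thesis
        using True False sq by (auto simp: column_def sg_def field_simps)
    next
      case iq: True
      then have ji: "j = i" using True by auto
      then have "hm (column j sg) (column i sg) = (\<Sum>p\<in>UNIV. if p = i then 1 else 0)"
        unfolding hm_def using iq by (intro sum.cong) (auto simp: column_def sg_def)
      then show ?thesis using ji by simp
    qed
  qed
  then show ?thesis by (simp add: vec_eq_iff adj_mult_nth mat_def)
qed

section \<open>Real matrices\<close>

definition real_mat :: "complex^'n^'m \<Rightarrow> bool" where
  "real_mat A \<longleftrightarrow> (\<forall>i j. A $ i $ j \<in> \<real>)"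

lemma cj_mult: "real_mat A \<Longrightarrow> cj (A *v x) = A *v cj x"
  by (auto simp: vec_eq_iff matrix_vector_mult_def real_mat_def Reals_cnj_iff)

lemma real_mat_mult: "real_mat A \<Longrightarrow> real_mat B \<Longrightarrow> real_mat (A ** B)"
  by (auto simp: real_mat_def matrix_matrix_mult_def)

lemma SL_R_iff: "A \<in> SL_R \<longleftrightarrow> A \<in> SL_C \<and> real_mat A"
  by (auto simp: SL_R_def SL_C_def real_mat_def)

lemma real_mat_inv:
  fixes A :: "complex^'n^'n"
  assumes "real_mat A" "invertible A"
  shows "real_mat (matrix_inv A)"
proof -
  let ?B = "matrix_inv A"
  let ?C = "\<chi> i j. cnj (?B $ i $ j)"
  have "A ** ?C = mat 1"
  proof -
    have "(A ** ?C) $ i $ j = cnj ((A ** ?B) $ i $ j)" for i j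
      using assms(1) by (simp add: matrix_matrix_mult_def real_mat_def Reals_cnj_iff)
    then show ?thesis using matrix_inv_right[OF assms(2)] by (simp add: vec_eq_iff mat_def)
  qed
  then have "?C = ?B"
    by (metis matrix_inv_left[OF assms(2)] matrix_mul_assoc matrix_mul_lid matrix_mul_rid)
  then have "cnj (?B $ i $ j) = ?B $ i $ j" for i j by (metis vec_lambda_beta)
  then show ?thesis by (simp add: real_mat_def Reals_cnj_iff)
qed

lemma poly_det:
  fixes A :: "real \<Rightarrow> complex^'n^'n"
  assumes "\<And>i j. \<exists>p. \<forall>t. A t $ i $ j = poly p (of_real t)"
  shows "\<exists>p. \<forall>t. det (A t) = poly p (of_real t)"
proof -
  have "\<exists>p. \<forall>i j t. A t $ i $ j = poly (p i j) (of_real t)" using assms by metis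
  then obtain p where p: "\<And>i j t. A t $ i $ j = poly (p i j) (of_real t)" by blast
  have "\<forall>t. det (A t) = poly (\<Sum>s\<in>{s. s permutes UNIV}. of_int (sign s) * (\<Prod>i\<in>UNIV. p i (s i))) (of_real t)"
    by (simp add: det_def poly_sum poly_prod p of_int_poly)
  then show ?thesis by blast
qed

text \<open>A polynomial that is nonzero at some time \<open>s\<close>, however far from 0, has
  finitely many roots and hence none near 0 except possibly 0 itself.\<close>

lemma eventually_det_nonzero:
  fixes A :: "real \<Rightarrow> complex^'n^'n"
  assumes "\<And>i j. \<exists>p. \<forall>t. A t $ i $ j = poly p (of_real t)" "det (A s) \<noteq> 0"
  shows "\<forall>\<^sub>F t in at 0. det (A t) \<noteq> 0"
proof -
  obtain p where p: "\<And>t. det (A t) = poly p (of_real t)" using poly_det[OF assms(1)] by blast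
  then have "p \<noteq> 0" using assms(2) by auto
  then have "finite (complex_of_real -` {z. poly p z = 0})"
    by (intro finite_vimageI poly_roots_finite) (auto intro: injI)
  then have "\<not> (0::real) islimpt (complex_of_real -` {z. poly p z = 0})"
    by (rule islimpt_finite)
  then show ?thesis
    by (simp add: islimpt_iff_eventually p)
qed

section \<open>Symmetric dimension sequences, isotropy and general position\<close>

locale sym_seq = dim_seq dims ty for dims and ty :: "'n::{finite,linorder} itself" +
  assumes rev_dims: "rev dims = dims"
begin

lemma nth_act_bf: "i < r \<Longrightarrow> act g bf ! i = (*v) g ` crd {a. bi a \<le> i}"
  by (simp add: nth_bf' del: nth_bf)

lemma m_rev: "i \<le> r \<Longrightarrow> m i + m (r - i) = CARD('n)"
proof -
  assume i: "i \<le> r"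
  have "m (r - i) = sum_list (drop i dims)"
    unfolding psum_def by (metis (no_types, lifting) rev_dims rev_drop sum_list_rev)
  then show ?thesis
    by (metis append_take_drop_id dims_sum psum_def sum_list_append)
qed

lemma bi_rv: "bi (rv a) = r - 1 - bi a"
proof -
  have b: "bi a < r" by (rule bi_props(1))
  have 1: "m (bi a) + m (Suc (r - 1 - bi a)) = CARD('n)"
    using m_rev[of "bi a"] b by (simp add: Suc_diff_Suc)
  have 2: "m (Suc (bi a)) + m (r - 1 - bi a) = CARD('n)"
    using m_rev[of "Suc (bi a)"] b by simp
  show ?thesis
    by (rule bi_eqI) (use pos_rv[of a] bi_props(2,3)[of a] 1 2 in linarith)+
qed

lemma bi_add_bi_rv: "bi a + bi (rv a) = r - 1"
  using bi_rv[of a] bi_props(1)[of a] by simp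

text \<open>Members of complementary dimension are orthogonal for the complex bilinear form, that is, each is
  Hermitian orthogonal to the conjugate of the other.\<close>

definition isotropic :: "'n flag \<Rightarrow> bool" where
  "isotropic F \<longleftrightarrow> (\<forall>i j. i + j + 2 = r \<longrightarrow> (\<forall>x\<in>F ! i. \<forall>y\<in>F ! j. hm x (cj y) = 0))"

text \<open>List positions are zero-based, so \<open>i + j + 2 = r\<close> pairs the members
  numbered \<open>i + 1\<close> and \<open>j + 1\<close>, whose dimensions add up to that of the
  whole space.\<close>

definition general_pos :: "'n flag \<Rightarrow> bool" where
  "general_pos F \<longleftrightarrow> (\<forall>i j. i + j + 2 = r \<longrightarrow> F ! i \<inter> cj ` (F ! j) \<subseteq> {0})"

lemma isotropic_general_pos: "isotropic F \<Longrightarrow> general_pos F"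
  unfolding isotropic_def general_pos_def by fastforce

text \<open>Conjugation moves the columns of the first \<open>j + 1\<close> blocks to those of the
  last \<open>j + 1\<close> blocks, which are disjoint from the first \<open>i + 1\<close> blocks
  and hence Hermitian orthogonal to them.\<close>

lemma isotropic_unitary:
  assumes "adj U ** U = mat 1" "\<And>a. cj (column a U) = column (rv a) U"
  shows "isotropic (act U bf)"
  unfolding isotropic_def
proof (intro allI impI ballI)
  fix i j x y assume ij: "i + j + 2 = r" and xy: "x \<in> act U bf ! i" "y \<in> act U bf ! j"
  obtain u where u: "x = U *v u" "u \<in> crd {a. bi a \<le> i}" using xy ij by (auto simp: nth_act_bf simp del: nth_act)
  obtain v where v: "y = U *v v" "v \<in> crd {a. bi a \<le> j}" using xy ij by (auto simp: nth_act_bf simp del: nth_act)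
  let ?v = "\<chi> a. cnj (v $ rv a)"
  have "cj y = (\<Sum>a\<in>UNIV. cnj (v $ a) *s column (rv a) U)"
    unfolding v(1) matrix_mult_sum
    by (simp add: assms(2)[symmetric]) (simp add: vec_eq_iff)
  also have "\<dots> = (\<Sum>a\<in>UNIV. cnj (v $ rv a) *s column a U)"
    by (rule sum.reindex_bij_witness[of _ rv rv]) auto
  also have "\<dots> = U *v ?v"
    unfolding matrix_mult_sum by simp
  finally have "hm x (cj y) = hm u (adj U *v (U *v ?v))"
    using u by (simp add: hm_adj)
  also have "\<dots> = hm u ?v"
    by (simp add: matrix_vector_mul_assoc assms(1))
  also have "\<dots> = 0"
    unfolding hm_def
  proof (rule sum.neutral, rule ballI)
    fix a
    have "\<not> bi a \<le> i \<or> \<not> bi (rv a) \<le> j"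
      using bi_add_bi_rv[of a] ij by linarith
    then show "u $ a * cnj (?v $ a) = 0"
      using u v by (auto simp: crd_def)
  qed
  finally show "hm x (cj y) = 0" .
qed

lemma SL_R_general_pos:
  assumes "h \<in> SL_R" "F \<in> flags dims" "general_pos (act h F)"
  shows "general_pos F"
  unfolding general_pos_def
proof (intro allI impI subsetI)
  fix i j x assume ij: "i + j + 2 = r" and x: "x \<in> F ! i \<inter> cj ` (F ! j)"
  have h: "invertible h" "real_mat h" using assms(1) by (auto simp: SL_R_iff SL_C_invertible)
  obtain y where y: "y \<in> F ! j" "x = cj y" using x by blast
  have "h *v x \<in> act h F ! i" "h *v y \<in> act h F ! j"
    using x y ij assms(2) by (auto simp: flags_length)
  moreover have "h *v x = cj (h *v y)"
    using y cj_mult[OF h(2), of y] by simp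
  ultimately have "h *v x \<in> act h F ! i" "h *v x \<in> cj ` (act h F ! j)" by blast+
  then have "h *v x \<in> {0}"
    using assms(3) ij unfolding general_pos_def by blast
  then show "x \<in> {0}" using h(1) unfolding invertible_iff_ker by simp
qed

text \<open>The columns of \<open>pair_mat i g\<close> are bases of \<open>V\<^sub>i\<close> and of the conjugate of its
  partner of complementary dimension.\<close>

definition pair_mat :: "nat \<Rightarrow> 'n cmat \<Rightarrow> 'n cmat" where
  "pair_mat i g = (\<chi> p c. if bi c \<le> i then g $ p $ c else cnj (g $ p $ rv c))"

lemma pair_mat_mult:
  assumes "i + j + 2 = r" "x \<in> crd {a. bi a \<le> i}" "y \<in> crd {a. bi a \<le> j}"
  shows "pair_mat i g *v (x + (\<chi> c. cnj (y $ rv c))) = g *v x + cj (g *v y)"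
proof -
  have ji: "bi (rv c) \<le> j \<longleftrightarrow> \<not> bi c \<le> i" for c
    using bi_add_bi_rv[of c] assms(1) by linarith
  have "(pair_mat i g *v (x + (\<chi> c. cnj (y $ rv c)))) $ p = (g *v x + cj (g *v y)) $ p" for p
  proof -
    have "(pair_mat i g *v (x + (\<chi> c. cnj (y $ rv c)))) $ p
        = (\<Sum>c\<in>UNIV. g $ p $ c * x $ c + cnj (g $ p $ rv c * y $ rv c))"
      unfolding matrix_vector_mult_def vec_lambda_beta
    proof (rule sum.cong[OF refl])
      fix c show "pair_mat i g $ p $ c * (x + (\<chi> c. cnj (y $ rv c))) $ c
          = g $ p $ c * x $ c + cnj (g $ p $ rv c * y $ rv c)"
        using assms(2,3) ji[of c] by (cases "bi c \<le> i") (auto simp: pair_mat_def crd_def)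
    qed
    also have "\<dots> = (\<Sum>c\<in>UNIV. g $ p $ c * x $ c) + (\<Sum>c\<in>UNIV. cnj (g $ p $ rv c * y $ rv c))"
      by (rule sum.distrib)
    also have "(\<Sum>c\<in>UNIV. cnj (g $ p $ rv c * y $ rv c)) = (\<Sum>c\<in>UNIV. cnj (g $ p $ c * y $ c))"
      by (rule sum.reindex_bij_witness[of _ rv rv]) auto
    finally show ?thesis by (simp add: matrix_vector_mult_def)
  qed
  then show ?thesis unfolding vec_eq_iff by blast
qed

text \<open>A kernel vector of \<open>pair_mat i g\<close> is a relation
  \<open>g *v x + cj (g *v y) = 0\<close>, that is, a common vector of a member and the conjugate of
  its partner.\<close>

lemma general_pos_iff_det:
  assumes "invertible g"
  shows "general_pos (act g bf) \<longleftrightarrow> (\<forall>i. i + 2 \<le> r \<longrightarrow> det (pair_mat i g) \<noteq> 0)"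
proof
  assume G: "general_pos (act g bf)"
  show "\<forall>i. i + 2 \<le> r \<longrightarrow> det (pair_mat i g) \<noteq> 0"
  proof (intro allI impI)
    fix i assume "i + 2 \<le> r"
    then obtain j where ij: "i + j + 2 = r" by (metis add.commute add.left_commute le_Suc_ex)
    have "z = 0" if z: "pair_mat i g *v z = 0" for z
    proof -
      let ?x = "\<chi> c. if bi c \<le> i then z $ c else 0"
      let ?y = "\<chi> c. if bi c \<le> j then cnj (z $ rv c) else 0"
      have ji: "bi (rv c) \<le> j \<longleftrightarrow> \<not> bi c \<le> i" for c
        using bi_add_bi_rv[of c] ij by linarith
      have x: "?x \<in> crd {a. bi a \<le> i}" and y: "?y \<in> crd {a. bi a \<le> j}" by (auto simp: crd_def)
      have zz: "z = ?x + (\<chi> c. cnj (?y $ rv c))" using ji by (auto simp: vec_eq_iff)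
      then have 0: "g *v ?x + cj (g *v ?y) = 0" using pair_mat_mult[OF ij x y, of g] z by simp
      then have e: "g *v ?x = cj (g *v (- ?y))"
        by (simp add: vec_eq_iff vec.neg add_eq_0_iff2)
      have "- ?y \<in> crd {a. bi a \<le> j}" using y by (auto simp: crd_def)
      then have "g *v ?x \<in> act g bf ! i" "g *v (- ?y) \<in> act g bf ! j"
        using x ij by (simp_all add: nth_act_bf del: nth_act)
      then have "g *v ?x \<in> act g bf ! i \<inter> cj ` (act g bf ! j)"
        using e by blast
      then have gx: "g *v ?x = 0" using G ij unfolding general_pos_def by blast
      then have "cj (cj (g *v ?y)) = 0" using 0 by simp
      then have "?x = 0" "?y = 0" using gx assms unfolding invertible_iff_ker cj_cj by blast+
      then show "z = 0" using zz by (simp add: vec_eq_iff)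
    qed
    then show "det (pair_mat i g) \<noteq> 0"
      unfolding invertible_iff_det[symmetric] invertible_iff_ker by blast
  qed
next
  assume G: "\<forall>i. i + 2 \<le> r \<longrightarrow> det (pair_mat i g) \<noteq> 0"
  show "general_pos (act g bf)"
    unfolding general_pos_def
  proof (intro allI impI subsetI)
    fix i j x assume ij: "i + j + 2 = r" and x: "x \<in> act g bf ! i \<inter> cj ` (act g bf ! j)"
    obtain u where u: "x = g *v u" "u \<in> crd {a. bi a \<le> i}" using x ij by (auto simp: nth_act_bf simp del: nth_act)
    obtain v where v: "x = cj (g *v v)" "v \<in> crd {a. bi a \<le> j}" using x ij by (auto simp: nth_act_bf simp del: nth_act)
    have nv: "- v \<in> crd {a. bi a \<le> j}" using v by (auto simp: crd_def)
    have "pair_mat i g *v (u + (\<chi> c. cnj ((- v) $ rv c))) = 0"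
      unfolding pair_mat_mult[OF ij u(2) nv] using u v by (simp add: vec_eq_iff vec.neg)
    moreover have "invertible (pair_mat i g)" using G ij by (simp add: invertible_iff_det)
    ultimately have z: "u + (\<chi> c. cnj ((- v) $ rv c)) = 0" unfolding invertible_iff_ker by blast
    have "u $ c = 0" for c
    proof (cases "bi c \<le> i")
      case True
      then have "\<not> bi (rv c) \<le> j" using bi_add_bi_rv[of c] ij by linarith
      then show ?thesis using z v by (auto simp: vec_eq_iff crd_def)
    qed (use u in \<open>auto simp: crd_def\<close>)
    then have "u = 0" by (simp add: vec_eq_iff)
    then show "x \<in> {0}" using u by simp
  qed
qed

text \<open>Every neighbourhood of \<open>F\<close> contains a flag in general position, since the determinants
  of \<open>pair_mat\<close> are nonzero polynomials along the segment from a lift of \<open>F\<close> to \<open>sg\<close>.\<close>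

lemma general_pos_dense:
  assumes W: "openin (flag_top dims) W" "F \<in> W"
  shows "\<exists>G\<in>W. general_pos G"
proof -
  have "F \<in> flags dims" using W openin_subset by fastforce
  then obtain g1 where g1: "g1 \<in> SL_C" "act g1 bf = F" using flags_transitive by blast
  define g :: "real \<Rightarrow> 'n cmat" where "g t = (1 - t) *\<^sub>R g1 + t *\<^sub>R sg" for t
  define top where "top = (SOME a :: 'n. True)"
  \<comment> \<open>The topology is defined through \<open>SL_C\<close>, while \<open>g t\<close>
    has varying determinant. This diagonal factor normalizes the determinant where it is nonzero and
    fixes the base flag.\<close>
  define dg :: "real \<Rightarrow> 'n cmat" where
    "dg t = (\<chi> i j. if i = j then if i = top then inverse (det (g t)) else 1 else 0)" for t
  have gpoly: "\<exists>p. \<forall>t. g t $ i $ j = poly p (of_real t)" for i j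
    by (rule exI[of _ "[:g1 $ i $ j, sg $ i $ j - g1 $ i $ j:]"])
      (simp add: g_def, simp add: scaleR_conv_of_real algebra_simps)
  have ppoly: "\<exists>p. \<forall>t. pair_mat k (g t) $ i $ j = poly p (of_real t)" for i j k
  proof (cases "bi j \<le> k")
    case True
    then show ?thesis using gpoly by (simp add: pair_mat_def)
  next
    case False
    show ?thesis
      by (rule exI[of _ "[:cnj (g1 $ i $ rv j), cnj (sg $ i $ rv j) - cnj (g1 $ i $ rv j):]"])
        (use False in \<open>simp add: pair_mat_def g_def, simp add: scaleR_conv_of_real algebra_simps\<close>)
  qed
  have "general_pos (act (sg :: 'n cmat) bf)"
    by (intro isotropic_general_pos isotropic_unitary sg_unitary cj_column_sg)
  then have "\<forall>i. i + 2 \<le> r \<longrightarrow> det (pair_mat i (g 1)) \<noteq> 0"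
    using general_pos_iff_det[OF unitary_invertible[OF sg_unitary]] by (simp add: g_def)
  then have "\<forall>\<^sub>F t in at 0. det (pair_mat i (g t)) \<noteq> 0" if "i + 2 \<le> r" for i
    using that by (intro eventually_det_nonzero[where s = 1, OF ppoly]) blast
  then have ev0: "\<forall>i\<in>{i. i + 2 \<le> r}. \<forall>\<^sub>F t in at 0. det (pair_mat i (g t)) \<noteq> 0"
    by blast
  have "finite {i. i + 2 \<le> r}" by (rule finite_subset[of _ "{..r}"]) auto
  from eventually_ball_finite[OF this ev0] have ev1: "\<forall>\<^sub>F t in at 0. \<forall>i\<in>{i. i + 2 \<le> r}. det (pair_mat i (g t)) \<noteq> 0"
    .
  have "det (g 1) \<noteq> 0"
    using unitary_invertible[OF sg_unitary] by (simp add: g_def invertible_iff_det)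
  then have ev2: "\<forall>\<^sub>F t in at 0. det (g t) \<noteq> 0"
    using eventually_det_nonzero[OF gpoly] by blast
  have det0: "det (g 0) = 1" using g1 by (simp add: g_def SL_C_def)
  have cg: "continuous_on UNIV (\<lambda>t. det (g t))"
    unfolding g_def by (intro continuous_on_det continuous_intros)
  have detdg: "det (dg t) = inverse (det (g t))" for t
  proof -
    have "det (dg t) = (\<Prod>i\<in>UNIV. if i = top then inverse (det (g t)) else 1)"
      by (subst det_lower_triangular) (auto simp: dg_def)
    then show ?thesis by simp
  qed
  define S where "S = {t. det (g t) \<noteq> 0}"
  have opS: "open S" unfolding S_def by (intro open_Collect_neq cg continuous_intros)
  have SL: "g t ** dg t \<in> SL_C" if "t \<in> S" for t
    using that by (simp add: S_def SL_C_def det_mul detdg)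
  have actS: "act (g t ** dg t) bf = act (g t) bf" if "t \<in> S" for t
  proof -
    have "act (dg t) bf = bf"
    proof (rule parabolic_act_bf)
      show "invertible (dg t)" using that by (simp add: invertible_iff_det detdg S_def)
    qed (auto simp: dg_def)
    then show ?thesis by (simp add: act_act[symmetric])
  qed
  have dgc: "continuous_on S (\<lambda>t. dg t)"
    unfolding dg_def
  proof (intro continuous_on_vec_lambda)
    fix i j show "continuous_on S (\<lambda>t. if i = j then if i = top then inverse (det (g t)) else 1 else 0)"
      using cg by (cases "i = j"; cases "i = top")
        (auto intro!: continuous_on_inverse intro: continuous_on_subset simp: S_def)
  qed
  have "openin (top_of_set S) {t \<in> S. act (g t ** dg t) bf \<in> W}"
  proof (rule openin_act_vimage[OF _ _ W(1)])
    show "continuous_on S (\<lambda>t. g t ** dg t)"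
      unfolding g_def by (intro continuous_intros dgc)
  qed (use SL in auto)
  then have "open {t \<in> S. act (g t ** dg t) bf \<in> W}"
    using opS by (simp add: openin_open_eq)
  moreover have "act (g 0) bf = F" using g1 by (simp add: g_def)
  then have "0 \<in> {t \<in> S. act (g t ** dg t) bf \<in> W}"
    using W(2) actS[of 0] det0 by (simp add: S_def)
  ultimately have "\<forall>\<^sub>F t in at 0. t \<in> {t \<in> S. act (g t ** dg t) bf \<in> W}"
    unfolding eventually_at_topological by blast
  then have "\<forall>\<^sub>F t in at 0. t \<in> {t \<in> S. act (g t ** dg t) bf \<in> W} \<and>
      (\<forall>i\<in>{i. i + 2 \<le> r}. det (pair_mat i (g t)) \<noteq> 0) \<and> det (g t) \<noteq> 0"
    using ev1 ev2 by (intro eventually_conj)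
  then obtain t where t: "t \<in> S" "act (g t ** dg t) bf \<in> W"
      "\<forall>i\<in>{i. i + 2 \<le> r}. det (pair_mat i (g t)) \<noteq> 0" "det (g t) \<noteq> 0"
    using eventually_happens'[OF at_neq_bot] by blast
  then have "act (g t) bf \<in> W" by (simp add: actS)
  moreover have "general_pos (act (g t) bf)"
    using general_pos_iff_det[of "g t"] t by (simp add: invertible_iff_det)
  ultimately show ?thesis by blast
qed

lemma orbit_SL_R_subset: "F \<in> flags dims \<Longrightarrow> orbit SL_R F \<subseteq> flags dims"
  by (auto simp: orbit_def SL_R_iff act_flags SL_C_invertible)

lemma open_orbit_general_pos:
  assumes "open_orbit dims D" "F \<in> D"
  shows "general_pos F" "F \<in> flags dims"
proof -
  obtain F1 where F1: "F1 \<in> flags dims" "D = orbit SL_R F1" "openin (flag_top dims) D"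
    using assms by (auto simp: open_orbit_def)
  show F: "F \<in> flags dims" using assms F1 orbit_SL_R_subset by blast
  obtain G where G: "G \<in> D" "general_pos G"
    using general_pos_dense[OF F1(3) assms(2)] by blast
  obtain h k where h: "h \<in> SL_R" "F = act h F1" and k: "k \<in> SL_R" "G = act k F1"
    using assms(2) F1(2) G by (auto simp: orbit_def)
  have hi: "invertible h" "real_mat h" using h by (auto simp: SL_R_iff SL_C_invertible)
  have "F1 = act (matrix_inv h) F"
    using h act_cancel[OF hi(1), of F1 F] by simp
  then have "G = act (k ** matrix_inv h) F" using k by (simp add: act_act)
  moreover have "k ** matrix_inv h \<in> SL_R"
    using h k hi by (auto simp: SL_R_iff SL_C_mult SL_C_inv real_mat_mult real_mat_inv)
  ultimately show "general_pos F"
    using SL_R_general_pos F G(2) by blast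
qed

end

section \<open>Base cycles\<close>

interpretation mm: bounded_bilinear "(**) :: complex^'n^'m \<Rightarrow> complex^'p^'n \<Rightarrow> complex^'p^'m"
  by (rule bounded_bilinear_matrix_mult)

lemmas mat_distribs = mm.diff_left mm.diff_right mm.add_left mm.add_right mm.minus_left mm.minus_right

definition cm :: "complex^'n^'m \<Rightarrow> complex^'n^'m" where
  "cm A = (\<chi> i j. cnj (A $ i $ j))"

lemma cm_nth [simp]: "cm A $ i $ j = cnj (A $ i $ j)"
  by (simp add: cm_def)

lemma cm_mult: "cm (A ** B) = cm A ** cm B"
  and cm_diff: "cm (A - B) = cm A - cm B"
  and cm_add: "cm (A + B) = cm A + cm B"
  and cm_cm [simp]: "cm (cm A) = A"
  and cm_one [simp]: "cm (mat 1) = mat 1"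
  by (simp_all add: vec_eq_iff matrix_matrix_mult_def mat_def)

lemma cm_adj: "cm (adj A) = adj (cm A)"
  by (simp add: vec_eq_iff)

lemma adj_diff: "adj (A - B) = adj A - adj B"
  and adj_add: "adj (A + B) = adj A + adj B"
  and adj_one [simp]: "adj (mat 1) = mat 1"
  by (simp_all add: vec_eq_iff mat_def)

lemma cj_mult_cm: "cj (A *v x) = cm A *v cj x"
  by (simp add: vec_eq_iff matrix_vector_mult_def)

lemma real_mat_cm: "real_mat A \<longleftrightarrow> cm A = A"
  by (auto simp: real_mat_def vec_eq_iff Reals_cnj_iff)

lemma trace_cm: "trace (cm A) = cnj (trace A)"
  by (simp add: trace_def)

lemma trace_diff: "trace (A - B) = trace A - trace B" for A :: "complex^'n^'n"
  by (rule trace_sub)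

lemma norm_adj_mult: "trace (adj A ** A) = of_real ((norm A)\<^sup>2)" for A :: "complex^'n^'n"
proof -
  have "trace (adj A ** A) = (\<Sum>j\<in>UNIV. \<Sum>i\<in>UNIV. of_real ((norm (A $ i $ j))\<^sup>2))"
    by (simp add: trace_def matrix_matrix_mult_def complex_norm_square mult.commute del: of_real_power)
  also have "\<dots> = (\<Sum>i\<in>UNIV. \<Sum>j\<in>UNIV. of_real ((norm (A $ i $ j))\<^sup>2))"
    by (rule sum.swap)
  also have "\<dots> = of_real ((norm A)\<^sup>2)"
    by (simp add: norm_vec_def L2_set_def sum_nonneg del: of_real_power)
  finally show ?thesis .
qed

lemma adj_mult_self_eq_0: "adj A ** A = 0 \<Longrightarrow> A = 0" for A :: "complex^'n^'n"
  using norm_adj_mult[of A] by (simp add: trace_def)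

definition is_proj :: "complex^'n^'n \<Rightarrow> (complex^'n) set \<Rightarrow> bool" where
  "is_proj P V \<longleftrightarrow> adj P = P \<and> P ** P = P \<and> (\<forall>x. P *v x \<in> V) \<and> (\<forall>x\<in>V. P *v x = x)"

lemma is_proj_conj:
  assumes "is_proj P V" "adj k ** k = mat 1"
  shows "is_proj (k ** P ** adj k) ((*v) k ` V)"
  unfolding is_proj_def
proof (intro conjI allI ballI)
  have P: "adj P = P" "P ** P = P" using assms by (auto simp: is_proj_def)
  show "adj (k ** P ** adj k) = k ** P ** adj k" by (simp add: adj_mult P matrix_mul_assoc)
  have "k ** P ** adj k ** (k ** P ** adj k) = k ** P ** (adj k ** k) ** P ** adj k"
    by (simp add: matrix_mul_assoc)
  also have "\<dots> = k ** (P ** P) ** adj k" by (simp add: assms matrix_mul_assoc)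
  finally show "k ** P ** adj k ** (k ** P ** adj k) = k ** P ** adj k" by (simp add: P)
  show "k ** P ** adj k *v x \<in> (*v) k ` V" for x
    using assms(1) by (auto simp: is_proj_def matrix_vector_mul_assoc[symmetric])
  fix x assume "x \<in> (*v) k ` V"
  then obtain v where v: "v \<in> V" "x = k *v v" by blast
  have "k ** P ** adj k *v x = k *v (P *v ((adj k ** k) *v v))"
    by (simp add: v matrix_vector_mul_assoc matrix_mul_assoc)
  also have "\<dots> = x" using assms v by (simp add: is_proj_def)
  finally show "k ** P ** adj k *v x = x" .
qed

lemma is_proj_cm: "is_proj P V \<Longrightarrow> is_proj (cm P) (cj ` V)"
  unfolding is_proj_def
proof (intro conjI allI ballI)
  assume P: "adj P = P \<and> P ** P = P \<and> (\<forall>x. P *v x \<in> V) \<and> (\<forall>x\<in>V. P *v x = x)"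
  show "adj (cm P) = cm P" "cm P ** cm P = cm P"
    using P by (simp_all add: cm_adj[symmetric] cm_mult[symmetric])
  show "cm P *v x \<in> cj ` V" for x
    using P cj_mult_cm[of P "cj x"] by (metis cj_cj imageI)
  show "cm P *v x = x" if "x \<in> cj ` V" for x
    using that P by (auto simp: cj_mult_cm[symmetric])
qed

text \<open>First variation of an orthogonal projection whose range is moved by \<open>G\<close>, when the
  projections stay unitarily conjugate. With \<open>R = Pt - P\<close>, constancy of the rank gives
  \<open>\<parallel>R\<parallel> = \<surd>2 \<parallel>R P\<parallel>\<close> in the Frobenius norm, so that \<open>R\<^sup>2\<close> is negligible in
  \<open>R = R P + P R + R\<^sup>2\<close>.\<close>

lemma projection_identities:
  assumes P: "adj P = P" "P ** P = P" and Pt: "adj Pt = Pt" "Pt ** Pt = Pt" and tr: "trace Pt = trace P"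
  shows "norm (Pt - P) = sqrt 2 * norm ((Pt - P) ** P)"
    and "Pt - P = (Pt - P) ** P + adj ((Pt - P) ** P) + (Pt - P) ** (Pt - P)"
proof -
  have PP: "X ** P ** P = X ** P" for X by (metis matrix_mul_assoc P(2))
  have PtPt: "X ** Pt ** Pt = X ** Pt" for X by (metis matrix_mul_assoc Pt(2))
  let ?R = "Pt - P"
  have a: "adj ?R = ?R" by (simp add: adj_diff P Pt)
  have b: "adj (?R ** P) = P ** ?R" by (simp add: adj_mult a P)
  have "trace (adj ?R ** ?R) = trace Pt - trace (Pt ** P) - (trace (P ** Pt) - trace P)"
    by (simp add: a mat_distribs matrix_mul_assoc P Pt trace_diff)
  also have "\<dots> = 2 * (trace P - trace (Pt ** P))"
    using tr trace_mul_sym[of P Pt] by simp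
  finally have 1: "trace (adj ?R ** ?R) = 2 * (trace P - trace (Pt ** P))" .
  have "adj (?R ** P) ** (?R ** P) = P - P ** Pt ** P"
    unfolding b by (simp add: mat_distribs matrix_mul_assoc P Pt PP PtPt)
  then have "trace (adj (?R ** P) ** (?R ** P)) = trace P - trace (P ** Pt ** P)"
    by (simp add: trace_diff)
  also have "trace (P ** Pt ** P) = trace (P ** P ** Pt)"
    by (metis matrix_mul_assoc trace_mul_sym)
  also have "\<dots> = trace (Pt ** P)" by (simp add: P trace_mul_sym[of P Pt])
  finally have "trace (adj ?R ** ?R) = 2 * trace (adj (?R ** P) ** (?R ** P))"
    using 1 by simp
  then have "(norm ?R)\<^sup>2 = 2 * (norm (?R ** P))\<^sup>2"
    unfolding norm_adj_mult by (metis of_real_eq_iff of_real_mult of_real_numeral)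
  then have "sqrt ((norm ?R)\<^sup>2) = sqrt (2 * (norm (?R ** P))\<^sup>2)" by simp
  then show "norm ?R = sqrt 2 * norm (?R ** P)" by (simp add: real_sqrt_mult)
  show "?R = ?R ** P + adj (?R ** P) + ?R ** ?R"
    unfolding b by (simp add: mat_distribs matrix_mul_assoc P Pt)
qed

text \<open>\<open>Pt t\<close> fixes the range of \<open>G t ** P\<close>, so the increment of the
  projection times \<open>P\<close> is \<open>t\<close> times an expression \<open>q t\<close> in
  the difference quotient of \<open>G\<close>. The identities for projections of equal trace recover
  the rest of the increment; continuity of \<open>Pt\<close> is part of the conclusion.\<close>

lemma projection_derivative:
  fixes P :: "complex^'n^'n" and Pt G :: "real \<Rightarrow> complex^'n^'n"
  assumes P: "is_proj P V" and G0: "G 0 = mat 1" and G: "(G has_vector_derivative K) (at 0)"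
    and ev: "\<forall>\<^sub>F t in at 0. is_proj (Pt t) ((*v) (G t) ` V) \<and> trace (Pt t) = trace P"
  shows "((\<lambda>t. (1 / t) *\<^sub>R (Pt t - P)) \<longlongrightarrow> (mat 1 - P) ** K ** P + adj ((mat 1 - P) ** K ** P)) (at 0)"
    and "(Pt \<longlongrightarrow> P) (at 0)"
proof -
  let ?D = "(mat 1 - P) ** K ** P"
  define B where "B t = (1 / t) *\<^sub>R (G t - G 0)" for t
  define R where "R t = Pt t - P" for t
  define q where "q t = (mat 1 - Pt t) ** B t ** P" for t
  have P': "adj P = P" "P ** P = P" using P by (auto simp: is_proj_def)
  have B: "(B \<longlongrightarrow> K) (at 0)"
    unfolding B_def by (rule vector_derivative_quotient[OF G])
  obtain k where k: "0 < k" "\<And>X Y. norm ((X :: complex^'n^'n) ** (Y :: complex^'n^'n)) \<le> norm X * norm Y * k"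
    using mm.pos_bounded by blast
  have ev': "\<forall>\<^sub>F t in at 0. R t ** P = t *\<^sub>R q t \<and> norm (R t) = sqrt 2 * \<bar>t\<bar> * norm (q t)
      \<and> (1 / t) *\<^sub>R R t = q t + adj (q t) + R t ** ((1 / t) *\<^sub>R R t) \<and> norm (Pt t) = norm P"
  proof -
    have nz: "\<forall>\<^sub>F t in at (0::real). t \<noteq> 0" by (rule eventually_neq_at_within)
    show ?thesis
      using ev nz
    proof eventually_elim
      case (elim t)
      have Pt: "adj (Pt t) = Pt t" "Pt t ** Pt t = Pt t" and tr: "trace (Pt t) = trace P"
        using elim by (auto simp: is_proj_def)
      have "(Pt t ** (G t ** P)) *v x = (G t ** P) *v x" for x
        using elim P by (auto simp: is_proj_def matrix_vector_mul_assoc[symmetric])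
      then have 1: "Pt t ** (G t ** P) = G t ** P" by (simp add: matrix_eq)
      have Gt: "G t = mat 1 + t *\<^sub>R B t" using elim G0 by (simp add: B_def)
      have RP: "R t ** P = t *\<^sub>R q t"
        using 1 unfolding Gt R_def q_def
        by (simp add: mat_distribs mm.scaleR_left mm.scaleR_right P' matrix_mul_assoc algebra_simps)
      note ids = projection_identities[OF P' Pt tr, folded R_def, unfolded RP]
      have "(1 / t) *\<^sub>R R t = (1 / t) *\<^sub>R (t *\<^sub>R q t + adj (t *\<^sub>R q t) + R t ** R t)"
        using ids(2) by simp
      also have "adj (t *\<^sub>R q t) = t *\<^sub>R adj (q t)" by (simp add: vec_eq_iff)
      also have "(1 / t) *\<^sub>R (t *\<^sub>R q t + t *\<^sub>R adj (q t) + R t ** R t)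
          = q t + adj (q t) + R t ** ((1 / t) *\<^sub>R R t)"
        using elim(2) by (simp add: scaleR_add_right mm.scaleR_right)
      finally have 3: "(1 / t) *\<^sub>R R t = q t + adj (q t) + R t ** ((1 / t) *\<^sub>R R t)" .
      have "(norm (Pt t))\<^sup>2 = (norm P)\<^sup>2"
        using norm_adj_mult[of "Pt t"] norm_adj_mult[of P] unfolding Pt P' tr
        by (metis of_real_eq_iff)
      then have "norm (Pt t) = norm P" by simp
      with RP ids(1) 3 show ?case by simp
    qed
  qed
  let ?c = "norm (mat 1 :: complex^'n^'n) + norm P"
  \<comment> \<open>This crude bound uses only that \<open>Pt t\<close> has the norm of
    \<open>P\<close>. It forces the increments to 0, and the resulting convergence of
    \<open>Pt\<close> is then fed back to obtain the limit of \<open>q\<close>.\<close>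
  have qb: "\<forall>\<^sub>F t in at 0. norm (q t) \<le> ?c * norm (B t) * k * norm P * k"
    using ev'
  proof eventually_elim
    case (elim t)
    have "norm (q t) \<le> norm ((mat 1 - Pt t) ** B t) * norm P * k" unfolding q_def by (rule k)
    also have "\<dots> \<le> (norm (mat 1 - Pt t) * norm (B t) * k) * norm P * k"
      using k by (intro mult_right_mono k(2)) auto
    also have "\<dots> \<le> (?c * norm (B t) * k) * norm P * k"
      using k elim norm_triangle_ineq4[of "mat 1" "Pt t"] by (intro mult_right_mono) auto
    finally show ?case by simp
  qed
  have Rb: "\<forall>\<^sub>F t in at 0. norm (R t) \<le> sqrt 2 * \<bar>t\<bar> * (?c * norm (B t) * k * norm P * k)"
    using ev' qb
  proof eventually_elim
    case (elim t)
    then have "norm (R t) = sqrt 2 * \<bar>t\<bar> * norm (q t)" by simp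
    also have "\<dots> \<le> sqrt 2 * \<bar>t\<bar> * (?c * norm (B t) * k * norm P * k)"
      using elim by (intro mult_left_mono) auto
    finally show ?case .
  qed
  have "((\<lambda>t. sqrt 2 * \<bar>t\<bar> * (?c * norm (B t) * k * norm P * k)) \<longlongrightarrow> sqrt 2 * \<bar>0\<bar> * (?c * norm K * k * norm P * k)) (at 0)"
    by (intro tendsto_intros B)
  then have "((\<lambda>t. sqrt 2 * \<bar>t\<bar> * (?c * norm (B t) * k * norm P * k)) \<longlongrightarrow> 0) (at 0)" by simp
  then have R0: "(R \<longlongrightarrow> 0) (at 0)"
    by (rule Lim_null_comparison[OF Rb])
  then show Pt: "(Pt \<longlongrightarrow> P) (at 0)"
    unfolding R_def by (rule LIM_zero_cancel)
  have q: "(q \<longlongrightarrow> ?D) (at 0)"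
    unfolding q_def by (intro mm.tendsto tendsto_intros Pt B)
  have adjq: "((\<lambda>t. adj (q t)) \<longlongrightarrow> adj ?D) (at 0)"
    unfolding adj_def by (intro tendsto_intros q)
  have RRb: "\<forall>\<^sub>F t in at 0. norm (R t ** ((1 / t) *\<^sub>R R t)) \<le> norm (R t) * (sqrt 2 * norm (q t)) * k"
    using ev' eventually_neq_at_within[of 0 0 UNIV]
  proof eventually_elim
    case (elim t)
    then have "norm ((1 / t) *\<^sub>R R t) = sqrt 2 * norm (q t)" by simp
    then show ?case using k(2)[of "R t" "(1 / t) *\<^sub>R R t"] by metis
  qed
  have "((\<lambda>t. norm (R t) * (sqrt 2 * norm (q t)) * k) \<longlongrightarrow> norm (0 :: complex^'n^'n) * (sqrt 2 * norm ?D) * k) (at 0)"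
    by (intro tendsto_intros q R0)
  then have "((\<lambda>t. norm (R t) * (sqrt 2 * norm (q t)) * k) \<longlongrightarrow> 0) (at 0)" by simp
  then have RR: "((\<lambda>t. R t ** ((1 / t) *\<^sub>R R t)) \<longlongrightarrow> 0) (at 0)"
    by (rule Lim_null_comparison[OF RRb])
  have "((\<lambda>t. q t + adj (q t) + R t ** ((1 / t) *\<^sub>R R t)) \<longlongrightarrow> ?D + adj ?D + 0) (at 0)"
    by (intro tendsto_add q adjq RR)
  moreover have "\<forall>\<^sub>F t in at 0. q t + adj (q t) + R t ** ((1 / t) *\<^sub>R R t) = (1 / t) *\<^sub>R (Pt t - P)"
    using ev' by eventually_elim (simp add: R_def)
  ultimately show "((\<lambda>t. (1 / t) *\<^sub>R (Pt t - P)) \<longlongrightarrow> ?D + adj ?D) (at 0)"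
    by (simp add: Lim_transform_eventually)
qed

lemma adj_real: "cm A = A \<Longrightarrow> adj A = transpose A"
  by (simp add: vec_eq_iff transpose_def)

lemma SO_R_iff: "k \<in> SO_R \<longleftrightarrow> cm k = k \<and> adj k ** k = mat 1 \<and> det k = 1"
  using adj_real[of k] matrix_left_right_inverse[of "transpose k" k]
  by (auto simp: SO_R_def SL_R_def orthogonal_matrix_def simp flip: real_mat_cm) (auto simp: real_mat_def)

lemma SO_R_mult: "a \<in> SO_R \<Longrightarrow> b \<in> SO_R \<Longrightarrow> a ** b \<in> SO_R"
proof -
  assume a: "a \<in> SO_R" and b: "b \<in> SO_R"
  have "adj (a ** b) ** (a ** b) = adj b ** (adj a ** a) ** b"
    by (simp add: adj_mult matrix_mul_assoc)
  then show ?thesis using a b by (simp add: SO_R_iff cm_mult det_mul)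
qed

lemma adj_inverse:
  assumes "adj k ** k = mat 1"
  shows "k ** adj k = mat 1" "matrix_inv k = adj k"
proof -
  show 1: "k ** adj k = mat 1" using assms matrix_left_right_inverse by blast
  have "matrix_inv k = (adj k ** k) ** matrix_inv k" by (simp add: assms)
  also have "\<dots> = adj k"
    using unitary_invertible[OF assms] by (simp add: matrix_mul_assoc[symmetric] matrix_inv_right)
  finally show "matrix_inv k = adj k" .
qed

lemma SO_R_adj: "k \<in> SO_R \<Longrightarrow> adj k \<in> SO_R"
  using adj_inverse(1)[of k] by (simp add: SO_R_iff cm_adj) (metis adj_real det_transpose)

lemma orbit_SO_R_act: "F \<in> orbit SO_R F0 \<Longrightarrow> k \<in> SO_R \<Longrightarrow> act k F \<in> orbit SO_R F0"
  by (auto simp: orbit_def act_act intro!: imageI SO_R_mult)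

lemma orbit_SO_R_trans:
  assumes "F \<in> orbit SO_R F0" "F' \<in> orbit SO_R F0"
  shows "\<exists>k\<in>SO_R. F' = act k F"
proof -
  obtain a b where a: "a \<in> SO_R" "F = act a F0" and b: "b \<in> SO_R" "F' = act b F0"
    using assms by (auto simp: orbit_def)
  have "act (b ** adj a) F = act (b ** (adj a ** a)) F0"
    by (simp only: a(2) act_act matrix_mul_assoc)
  also have "\<dots> = F'" using a b by (simp add: SO_R_iff)
  finally show ?thesis using SO_R_mult[OF b(1) SO_R_adj[OF a(1)]] by metis
qed

section \<open>Rotations and the tangent spaces of orbits of the real special orthogonal
  group\<close>

definition gen :: "'n \<Rightarrow> 'n \<Rightarrow> complex^'n^'n" where
  "gen a b = (\<chi> i j. (if i = b \<and> j = a then 1 else 0) - (if i = a \<and> j = b then 1 else 0))"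

definition rot :: "'n \<Rightarrow> 'n \<Rightarrow> real \<Rightarrow> complex^'n^'n" where
  "rot a b t = mat 1 + (cos t - 1) *\<^sub>R (\<chi> i j. if i = j \<and> (i = a \<or> i = b) then 1 else 0) + sin t *\<^sub>R gen a b"

lemma hm_axis: "hm (axis i 1) (axis j 1) = (if i = j then 1 else 0)"
  by (simp add: hm_def axis_def if_distrib[of "\<lambda>x. x * _"] cong: if_cong)

lemma hm_diff_left: "hm (x - y) z = hm x z - hm y z"
  and hm_diff_right: "hm z (x - y) = hm z x - hm z y"
  by (simp_all add: hm_def sum_subtractf algebra_simps)

lemma rot_column:
  assumes "a \<noteq> b"
  shows "column j (rot a b t) = (if j = a then of_real (cos t) *s axis a 1 + of_real (sin t) *s axis b 1
     else if j = b then of_real (cos t) *s axis b 1 + (- of_real (sin t)) *s axis a 1 else axis j 1)"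
  using assms
  by (auto simp: vec_eq_iff column_def rot_def gen_def mat_def axis_def)
    (auto simp: scaleR_conv_of_real algebra_simps)

lemma rot_orthogonal:
  assumes "a \<noteq> b"
  shows "adj (rot a b t) ** rot a b t = mat 1"
proof -
  have cs: "complex_of_real (cos t) * complex_of_real (cos t) + complex_of_real (sin t) * complex_of_real (sin t) = 1"
    by (metis of_real_1 of_real_add of_real_mult power2_eq_square sin_cos_squared_add2)
  have "hm (column j (rot a b t)) (column i (rot a b t)) = (if i = j then 1 else 0)" for i j
    unfolding rot_column[OF assms]
    using assms cs
    by (auto simp: hm_add_left hm_add_right hm_diff_left hm_diff_right hm_scale_left hm_scale_right hm_axis add.commute)
  then show ?thesis by (simp add: vec_eq_iff adj_mult_nth mat_def)
qed

lemma rot_0: "rot a b 0 = mat 1"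
  by (simp add: rot_def)

lemma rot_derivative: "(rot a b has_vector_derivative gen a b) (at 0)"
  unfolding rot_def by (auto intro!: derivative_eq_intros)

text \<open>The determinant squares to 1 and is continuous in \<open>t\<close>, so it keeps its
  value 1 near 0.\<close>

lemma rot_SO_R:
  assumes "a \<noteq> b"
  shows "\<forall>\<^sub>F t in at 0. rot a b t \<in> SO_R"
proof -
  have re: "cm (rot a b t) = rot a b t" for t
    by (auto simp: vec_eq_iff rot_def gen_def mat_def)
  have sq: "det (rot a b t) * det (rot a b t) = 1" for t
  proof -
    have "det (transpose (rot a b t) ** rot a b t) = 1"
      using rot_orthogonal[OF assms, of t] adj_real[OF re[of t]] by simp
    then show ?thesis by (simp add: det_mul det_transpose)
  qed
  have "continuous_on UNIV (\<lambda>t. det (rot a b t))"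
    unfolding rot_def by (intro continuous_on_det continuous_intros)
  then have "isCont (\<lambda>t. det (rot a b t)) 0"
    using continuous_on_eq_continuous_at open_UNIV by blast
  then have "((\<lambda>t. det (rot a b t)) \<longlongrightarrow> 1) (at 0)"
    by (simp add: isCont_def rot_0)
  moreover have "open (- {-1 :: complex})" by (intro open_Compl) auto
  ultimately have "\<forall>\<^sub>F t in at 0. det (rot a b t) \<in> - {-1}"
    by (rule topological_tendstoD) simp
  then show ?thesis
  proof eventually_elim
    case (elim t)
    have "det (rot a b t) = 1" using sq[of t] elim by (simp add: square_eq_1_iff)
    then show ?case using re rot_orthogonal[OF assms] by (simp add: SO_R_iff)
  qed
qed

lemma bounded_linear_mvec: "bounded_linear (\<lambda>A :: complex^'n^'n. \<chi> k. A $ fst k $ snd k)"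
  unfolding linear_conv_bounded_linear[symmetric] by (rule linearI) (auto simp: vec_eq_iff)

lemma bounded_linear_vmat: "bounded_linear (\<lambda>X :: complex^('n::finite \<times> 'n). \<chi> i j. X $ (i, j))"
  unfolding linear_conv_bounded_linear[symmetric] by (rule linearI) (auto simp: vec_eq_iff)

context dim_seq
begin

text \<open>The differential of \<open>Lam\<close> at the identity matrix, as shown in
  \<open>Lam_curve\<close>.\<close>

definition lowp :: "'n cmat \<Rightarrow> complex^('n \<times> 'n)" where
  "lowp A = (\<chi> k. if k \<in> Low then A $ fst k $ snd k else 0)"

lemma exists_proj:
  fixes F :: "'n flag"
  assumes F: "F \<in> flags dims" and i: "i < r"
  shows "\<exists>P. is_proj P (F ! i)"
proof -
  obtain U where U: "adj U ** U = mat 1" "act U bf = F" using adapted_unitary[OF F] by blast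
  let ?E = "(\<chi> a c. if a = c then if bi a \<le> i then 1 else 0 else 0) :: 'n cmat"
  have E: "?E *v x = (\<chi> a. if bi a \<le> i then x $ a else 0)" for x
    by (auto simp: vec_eq_iff matrix_vector_mult_def if_distrib[of "\<lambda>x. x * _"] cong: if_cong conj_cong)
  have "?E ** ?E = ?E"
    unfolding matrix_eq by (simp add: matrix_vector_mul_assoc[symmetric] E) (simp add: fun_eq_iff)
  then have "is_proj ?E (crd {a. bi a \<le> i})"
    by (auto simp: is_proj_def E) (auto simp: vec_eq_iff crd_def)
  from is_proj_conj[OF this U(1)] show ?thesis
    using U(2) i by (auto simp: nth_bf' simp del: nth_bf)
qed

text \<open>The derivative is determined on two complementary coordinate subspaces: on
  \<open>crd Low\<close> the composite is the identity, and for small \<open>X\<close> supported off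
  \<open>Low\<close> the matrix \<open>lo X\<close> is an invertible block upper triangular one,
  where \<open>Lam\<close> vanishes.\<close>

lemma Lam_derivative:
  "((\<lambda>X. Lam (lo X)) has_derivative (\<lambda>X. \<chi> k. if k \<in> Low then X $ k else 0)) (at (0 :: complex^('n \<times> 'n)))"
proof -
  have "holo (\<lambda>X. Lam (lo X) $ k) (0 :: complex^('n \<times> 'n))" for k
  proof (rule holo_Lam)
    show "holo (\<lambda>X. lo X $ i $ j) 0" for i j unfolding lo_nth by (intro holo_add holo_const holo_coord)
    show "lo 0 \<in> (Om :: 'n cmat set)" by (rule lo_Om) (simp add: vec.subspace_0)
  qed
  then obtain f' where f': "Vector_Spaces.linear (*s) (*s) f'" "((\<lambda>X. Lam (lo X)) has_derivative f') (at (0 :: complex^('n \<times> 'n)))"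
    using holo_imp_derivative[of "\<lambda>X. Lam (lo X)" 0] by blast
  have curve: "((\<lambda>t. Lam (lo (0 + t *\<^sub>R X))) has_vector_derivative f' X) (at 0)" for X
    by (rule curve_compose[where U = UNIV]) (use f' line_derivative[of 0 X] in auto)
  have 1: "f' X = X" if X: "X \<in> crd Low" for X
  proof -
    have "((\<lambda>t. Lam (lo (0 + t *\<^sub>R X))) has_vector_derivative X) (at 0)"
    proof (rule has_vector_derivative_eventually[OF line_derivative])
      have *: "0 + t *\<^sub>R X = Lam (lo (0 + t *\<^sub>R X))" for t
        by (rule Lam_lo[symmetric]) (use X in \<open>auto simp: crd_def\<close>)
      then show "\<forall>\<^sub>F t in at 0. 0 + t *\<^sub>R X = Lam (lo (0 + t *\<^sub>R X))" by simp
      show "0 + 0 *\<^sub>R X = Lam (lo (0 + 0 *\<^sub>R X))" by (rule *)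
    qed
    with curve show ?thesis by (rule vector_derivative_unique_at)
  qed
  have 2: "f' X = 0" if X: "X \<in> crd (- Low)" for X
  proof -
    have "continuous_on UNIV (\<lambda>t. det (lo (0 + t *\<^sub>R X)))"
      by (intro continuous_on_det continuous_intros)
    then have "isCont (\<lambda>t. det (lo (0 + t *\<^sub>R X))) 0"
      using continuous_on_eq_continuous_at open_UNIV by blast
    then have "((\<lambda>t. det (lo (0 + t *\<^sub>R X))) \<longlongrightarrow> 1) (at 0)"
      by (simp add: isCont_def)
    moreover have "open (- {0 :: complex})" by (intro open_Compl) auto
    ultimately have "\<forall>\<^sub>F t in at 0. det (lo (0 + t *\<^sub>R X)) \<in> - {0}"
      by (rule topological_tendstoD) simp
    then have ev: "\<forall>\<^sub>F t in at 0. 0 = Lam (lo (0 + t *\<^sub>R X))"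
    proof eventually_elim
      case (elim t)
      have "lo (0 + t *\<^sub>R X) $ p $ c = 0" if "bi c < bi p" for p c
        using that X by (auto simp: lo_nth crd_def Low_def)
      then show ?case using Lam_parabolic(2)[of "lo (0 + t *\<^sub>R X)"] elim
        by (simp add: invertible_iff_det)
    qed
    have "((\<lambda>t. Lam (lo (0 + t *\<^sub>R X))) has_vector_derivative 0) (at 0)"
    proof (rule has_vector_derivative_eventually[OF _ ev])
      show "0 = Lam (lo (0 + 0 *\<^sub>R X))" using Lam_lo[of 0] by (simp add: vec.subspace_0)
    qed simp
    with curve show ?thesis by (rule vector_derivative_unique_at)
  qed
  have "f' X = (\<chi> k. if k \<in> Low then X $ k else 0)" for X
  proof -
    let ?X1 = "\<chi> k. if k \<in> Low then X $ k else 0" and ?X2 = "\<chi> k. if k \<in> Low then 0 else X $ k"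
    have "X = ?X1 + ?X2" by (simp add: vec_eq_iff)
    then have "f' X = f' ?X1 + f' ?X2"
      using f'(1) unfolding Vector_Spaces.linear_iff by metis
    then show ?thesis using 1[of ?X1] 2[of ?X2] by (simp add: crd_def)
  qed
  then have "f' = (\<lambda>X. \<chi> k. if k \<in> Low then X $ k else 0)" by blast
  with f'(2) show ?thesis by simp
qed

lemma Lam_curve:
  fixes A :: "real \<Rightarrow> 'n cmat"
  assumes "A 0 = mat 1" "(A has_vector_derivative K) (at 0)"
  shows "((\<lambda>t. Lam (A t)) has_vector_derivative lowp K) (at 0)" "\<forall>\<^sub>F t in at 0. A t \<in> Om"
proof -
  let ?X = "\<lambda>t. \<chi> k. (A t - mat 1) $ fst k $ snd k"
  have lo: "lo (?X t) = A t" for t by (simp add: vec_eq_iff lo_nth mat_def)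
  have "((\<lambda>t. A t - mat 1) has_vector_derivative K) (at 0)"
    using assms(2) by (auto intro!: derivative_eq_intros)
  then have X: "(?X has_vector_derivative (\<chi> k. K $ fst k $ snd k)) (at 0)"
    by (rule bounded_linear.has_vector_derivative[OF bounded_linear_mvec])
  have X0: "?X 0 = 0" using assms(1) by (simp add: vec_eq_iff)
  have "((\<lambda>t. Lam (lo (?X t))) has_vector_derivative (\<chi> k. if k \<in> Low then (\<chi> k. K $ fst k $ snd k) $ k else 0)) (at 0)"
    by (rule curve_compose[where U = UNIV, OF _ X]) (use Lam_derivative X0 in auto)
  then show "((\<lambda>t. Lam (A t)) has_vector_derivative lowp K) (at 0)"
    unfolding lo lowp_def vec_lambda_beta .
  have "lo 0 \<in> (Om :: 'n cmat set)" by (rule lo_Om) (simp add: vec.subspace_0)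
  then show "\<forall>\<^sub>F t in at 0. A t \<in> Om"
    by (intro curve_in_nbhd[OF assms(2), of UNIV Om]) (simp_all add: open_Om assms(1))
qed

text \<open>A rotation in the plane of \<open>a\<close> and \<open>b\<close> moves the base point
  inside the orbit, and in the chart centred by \<open>g\<close> it appears conjugated by
  \<open>g\<close>. Equal indices are split off because \<open>rot a a\<close> is not orthogonal in
  general.\<close>

lemma tangent_gen:
  assumes g: "g \<in> SL_C" and C: "act g bf \<in> orbit SO_R F0"
  shows "lowp (matrix_inv g ** gen a b ** g) \<in> tg g (orbit SO_R F0) \<or> a = b"
proof (cases "a = b")
  case False
  have gi: "matrix_inv g ** g = mat 1" "g ** matrix_inv g = mat 1"
    using SL_C_invertible[OF g] by (simp_all add: matrix_inv_left matrix_inv_right)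
  let ?A = "\<lambda>t. matrix_inv g ** rot a b t ** g"
  have A0: "?A 0 = mat 1" by (simp add: rot_0 gi)
  have "((\<lambda>t. matrix_inv g ** rot a b t) has_vector_derivative matrix_inv g ** gen a b) (at 0)"
    by (rule bounded_linear.has_vector_derivative[OF mm.bounded_linear_right rot_derivative])
  then have A: "(?A has_vector_derivative matrix_inv g ** gen a b ** g) (at 0)"
    by (rule bounded_linear.has_vector_derivative[OF mm.bounded_linear_left])
  have "Lam (?A 0) = 0" using A0 Lam_lo[of 0] by (simp add: vec.subspace_0)
  moreover have "\<forall>\<^sub>F t in at 0. Lam (?A t) \<in> {X \<in> crd Low. chart_param dims g X \<in> orbit SO_R F0}"
    using Lam_curve(2)[OF A0 A] rot_SO_R[OF False]
  proof eventually_elim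
    case (elim t)
    have "chart_param dims g (Lam (?A t)) = act g (act (?A t) bf)"
      using Om_act(2)[OF elim(1)] by (simp add: chart_param_eq act_act[symmetric])
    also have "\<dots> = act ((g ** matrix_inv g) ** rot a b t ** g) bf"
      by (simp only: act_act matrix_mul_assoc)
    also have "\<dots> = act (rot a b t) (act g bf)" by (simp add: gi act_act)
    finally show ?case using orbit_SO_R_act[OF C elim(2)] Lam_in by simp
  qed
  ultimately have "lowp (matrix_inv g ** gen a b ** g) \<in> tg g (orbit SO_R F0)"
    unfolding tg_def tang_def
    by (intro CollectI exI[of _ "\<lambda>t. Lam (?A t)"] conjI Lam_curve(1)[OF A0 A])
  then show ?thesis ..
qed simp

lemma lowp_conj_gen:
  "lowp (A ** gen a b ** B) $ (p, c) = (if (p, c) \<in> Low then A $ p $ b * B $ a $ c - A $ p $ a * B $ b $ c else 0)"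
proof -
  have *: "(\<Sum>i\<in>UNIV. A $ p $ i * gen a b $ i $ j) = (if j = a then A $ p $ b else 0) - (if j = b then A $ p $ a else 0)" for j
  proof -
    have "(\<Sum>i\<in>UNIV. A $ p $ i * gen a b $ i $ j) = (\<Sum>i\<in>UNIV. (if i = b then if j = a then A $ p $ b else 0 else 0)
        - (if i = a then if j = b then A $ p $ a else 0 else 0))"
      by (rule sum.cong) (auto simp: gen_def)
    then show ?thesis by (simp add: sum_subtractf)
  qed
  have "(A ** gen a b ** B) $ p $ c = (\<Sum>j\<in>UNIV. (\<Sum>i\<in>UNIV. A $ p $ i * gen a b $ i $ j) * B $ j $ c)"
    by (simp add: matrix_matrix_mult_def)
  also have "\<dots> = (\<Sum>j\<in>UNIV. ((if j = a then A $ p $ b else 0) - (if j = b then A $ p $ a else 0)) * B $ j $ c)"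
    unfolding * ..
  also have "(\<Sum>j\<in>UNIV. ((if j = a then A $ p $ b else 0) - (if j = b then A $ p $ a else 0)) * B $ j $ c)
      = (\<Sum>j\<in>UNIV. (if j = a then A $ p $ b * B $ a $ c else 0) - (if j = b then A $ p $ a * B $ b $ c else 0))"
    by (rule sum.cong) auto
  finally show ?thesis by (simp add: lowp_def sum_subtractf)
qed

text \<open>\<open>Z\<close> may have complex entries: the tangent space is a complex subspace
  containing the real generators, and these span all complex antisymmetric matrices. This is how
  complexity of the submanifold enters.\<close>

lemma tangent_antisym:
  assumes g: "g \<in> SL_C" and C: "act g bf \<in> orbit SO_R F0"
    and sub: "complex_submanifold dims d (orbit SO_R F0)" and Z: "transpose Z = - Z"
  shows "lowp (matrix_inv g ** Z ** g) \<in> tg g (orbit SO_R F0)"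
proof -
  let ?T = "tg g (orbit SO_R F0)"
  let ?gi = "matrix_inv g"
  have T: "vec.subspace ?T" by (rule tg_subspace(1)[OF sub g C])
  have gen_in: "lowp (?gi ** gen a b ** g) \<in> ?T" for a b
  proof (cases "a = b")
    case True
    then have "lowp (?gi ** gen a b ** g) = 0"
      unfolding vec_eq_iff by (auto simp: lowp_conj_gen)
    then show ?thesis using T by (simp add: vec.subspace_0)
  qed (use tangent_gen[OF g C] in blast)
  have anti: "Z $ i $ j = - Z $ j $ i" for i j
  proof -
    have "transpose Z $ j $ i = (- Z) $ j $ i" by (simp only: Z)
    then show ?thesis by (simp add: transpose_def)
  qed
  \<comment> \<open>The sum over ordered pairs counts each generator twice with the same sign,
    whence the division by 2.\<close>
  have "lowp (?gi ** Z ** g) = (\<Sum>a\<in>UNIV. \<Sum>b\<in>UNIV. (Z $ b $ a / 2) *s lowp (?gi ** gen a b ** g))"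
  proof -
    have "lowp (?gi ** Z ** g) $ (p, c) = (\<Sum>a\<in>UNIV. \<Sum>b\<in>UNIV. (Z $ b $ a / 2) *s lowp (?gi ** gen a b ** g)) $ (p, c)" for p c
    proof (cases "(p, c) \<in> Low")
      case True
      let ?S = "\<Sum>a\<in>UNIV. \<Sum>b\<in>UNIV. Z $ b $ a * (?gi $ p $ b * g $ a $ c)"
      have sw: "(\<Sum>a\<in>UNIV. \<Sum>b\<in>UNIV. Z $ b $ a * (?gi $ p $ a * g $ b $ c)) = - ?S"
      proof -
        have "(\<Sum>a\<in>UNIV. \<Sum>b\<in>UNIV. Z $ b $ a * (?gi $ p $ a * g $ b $ c))
            = (\<Sum>b\<in>UNIV. \<Sum>a\<in>UNIV. Z $ b $ a * (?gi $ p $ a * g $ b $ c))" by (rule sum.swap)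
        also have "\<dots> = (\<Sum>b\<in>UNIV. \<Sum>a\<in>UNIV. - (Z $ a $ b * (?gi $ p $ a * g $ b $ c)))"
          by (intro sum.cong refl) (subst anti, simp)
        finally show ?thesis by (simp add: sum_negf)
      qed
      have "lowp (?gi ** Z ** g) $ (p, c) = ?S"
        using True by (simp add: lowp_def matrix_matrix_mult_def sum_distrib_right sum_distrib_left algebra_simps)
      also have "\<dots> = (\<Sum>a\<in>UNIV. \<Sum>b\<in>UNIV. (Z $ b $ a / 2) * (?gi $ p $ b * g $ a $ c))
          - (\<Sum>a\<in>UNIV. \<Sum>b\<in>UNIV. (Z $ b $ a / 2) * (?gi $ p $ a * g $ b $ c))"
        using sw by (simp add: sum_divide_distrib[symmetric])
      also have "\<dots> = (\<Sum>a\<in>UNIV. \<Sum>b\<in>UNIV. (Z $ b $ a / 2) * (?gi $ p $ b * g $ a $ c - ?gi $ p $ a * g $ b $ c))"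
        by (simp add: sum_subtractf right_diff_distrib)
      finally show ?thesis using True by (simp add: lowp_conj_gen)
    next
      case False
      then show ?thesis by (simp add: lowp_conj_gen) (simp add: lowp_def)
    qed
    then show ?thesis by (simp add: vec_eq_iff)
  qed
  also have "\<dots> \<in> ?T"
    by (intro vec.subspace_sum T vec.subspace_scale gen_in)
  finally show ?thesis .
qed

end

section \<open>The critical point equation for traces of projections\<close>

lemma trace_cycle: "trace (A ** B ** C) = trace (C ** A ** B)" for A :: "complex^'n^'n"
  using trace_mul_sym[of "A ** B" C] by (simp add: matrix_mul_assoc)

lemma trace_neg: "trace (- A) = - trace A" for A :: "complex^'n^'n"
  by (simp add: trace_def sum_negf)

lemma trace_scaleR: "trace (c *\<^sub>R A) = c *\<^sub>R trace A" for A :: "complex^'n^'n"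
  by (simp add: trace_def scaleR_sum_right)

lemma tendsto_trace:
  fixes A :: "'a \<Rightarrow> complex^'n^'n"
  assumes "(A \<longlongrightarrow> B) F"
  shows "((\<lambda>x. trace (A x)) \<longlongrightarrow> trace B) F"
  unfolding trace_def by (intro tendsto_intros assms)

lemma tendsto_cm:
  fixes A :: "'a \<Rightarrow> complex^'n^'n"
  assumes "(A \<longlongrightarrow> B) F"
  shows "((\<lambda>x. cm (A x)) \<longlongrightarrow> cm B) F"
  unfolding cm_def by (intro tendsto_intros assms)

text \<open>The algebra behind the isotropy of base cycles: for projections \<open>P \<le> Q\<close>, the critical point
  equation of \<open>trace (P conj Q)\<close> forces \<open>P conj Q P\<close> to be a projection into
  \<open>V \<inter> conj W\<close>, which vanishes in general position.\<close>

lemma isotropic_of_critical: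
  fixes P Q :: "complex^'n^'n"
  assumes P: "is_proj P V" and Q: "is_proj Q W" and VW: "V \<subseteq> W"
    and 0: "V \<inter> cj ` W \<subseteq> {0}"
    and cP: "cm P ** P ** cm P + cm P ** P ** cm P = P ** cm P ** P + P ** cm P ** P"
    and cPQ: "cm Q ** P ** cm Q + cm P ** Q ** cm P = P ** cm Q ** P + Q ** cm P ** Q"
  shows "cm Q ** P = 0"
proof -
  have p: "adj P = P" "P ** P = P" "\<And>x. P *v x \<in> V" "\<And>x. x \<in> V \<Longrightarrow> P *v x = x"
    using P by (auto simp: is_proj_def)
  have q: "adj Q = Q" "Q ** Q = Q" "\<And>x. Q *v x \<in> W" "\<And>x. x \<in> W \<Longrightarrow> Q *v x = x"
    using Q by (auto simp: is_proj_def)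
  have cp: "is_proj (cm P) (cj ` V)" and cq: "is_proj (cm Q) (cj ` W)"
    using is_proj_cm P Q by blast+
  have cp': "adj (cm P) = cm P" "cm P ** cm P = cm P" and cq': "adj (cm Q) = cm Q" "cm Q ** cm Q = cm Q"
    using cp cq by (auto simp: is_proj_def)
  have QP: "Q ** P = P"
    unfolding matrix_eq matrix_vector_mul_assoc[symmetric] using p(3) q(4) VW by blast
  then have PQ: "P ** Q = P" by (metis adj_mult p(1) q(1))
  \<comment> \<open>By the first equation the range of this matrix lies in \<open>V\<close> as well
    as in the conjugate of \<open>V\<close>, which is contained in the conjugate of
    \<open>W\<close>.\<close>
  have 1: "P ** cm P ** P = 0"
    unfolding matrix_eq
  proof
    fix x
    have eq: "cm P ** P ** cm P = P ** cm P ** P"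
      using cP by (simp add: vec_eq_iff)
    have "P ** cm P ** P *v x = P *v (cm P *v (P *v x))"
      by (simp add: matrix_vector_mul_assoc matrix_mul_assoc)
    then have "P ** cm P ** P *v x \<in> V" using p(3) by metis
    moreover have "P ** cm P ** P *v x = cm P *v (P *v (cm P *v x))"
      by (simp add: matrix_vector_mul_assoc matrix_mul_assoc flip: eq)
    then have "P ** cm P ** P *v x \<in> cj ` V" using cp by (auto simp: is_proj_def)
    ultimately show "P ** cm P ** P *v x = 0 *v x" using 0 VW by auto
  qed
  have "adj (cm P ** P) ** (cm P ** P) = P ** (cm P ** cm P) ** P"
    by (simp add: adj_mult p cp'(1) matrix_mul_assoc)
  also have "\<dots> = 0" using 1 cp' by simp
  finally have cPP: "cm P ** P = 0" by (rule adj_mult_self_eq_0)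
  let ?T = "P ** cm Q ** P"
  \<comment> \<open>Multiplying the second equation by \<open>P\<close> on both sides removes the
    terms with \<open>cm P\<close>; what remains says that \<open>?T\<close> is idempotent.\<close>
  have "P ** (cm Q ** P ** cm Q + cm P ** Q ** cm P) ** P = P ** (P ** cm Q ** P + Q ** cm P ** Q) ** P"
    by (simp only: cPQ)
  then have "P ** cm Q ** P ** cm Q ** P + P ** cm P ** Q ** (cm P ** P)
      = (P ** P) ** cm Q ** (P ** P) + (P ** Q) ** cm P ** (Q ** P)"
    by (simp add: mat_distribs matrix_mul_assoc)
  then have TT: "P ** cm Q ** P ** cm Q ** P = ?T"
    by (simp add: cPP PQ QP p(2)) (use 1 in simp)
  have "?T *v x = 0" for x
  proof -
    define u where "u = ?T *v x"
    have yV: "u \<in> V" unfolding u_def using p(3) by (metis matrix_mul_assoc matrix_vector_mul_assoc)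
    have "P *v (cm Q *v (P *v u)) = u"
      unfolding u_def using TT p(2) by (simp add: matrix_vector_mul_assoc matrix_mul_assoc)
    then have y: "P *v (cm Q *v u) = u" using p(4)[OF yV] by simp
    have "hm u (cm Q *v u) = hm (P *v u) (cm Q *v u)" using p(4)[OF yV] by simp
    also have "\<dots> = hm u (P *v (cm Q *v u))" by (simp add: hm_adj p)
    finally have a: "hm u (cm Q *v u) = hm u u" using y by simp
    have b: "hm (cm Q *v u) (cm Q *v u) = hm u (cm Q *v u)"
      by (simp add: hm_adj cq' matrix_vector_mul_assoc)
    have c: "hm (cm Q *v u) u = hm u (cm Q *v u)" by (simp add: hm_adj cq')
    \<comment> \<open>A vector fixed by \<open>P\<close> that returns to itself under
      \<open>cm Q\<close> followed by \<open>P\<close> loses no norm under the projection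
      \<open>cm Q\<close>, so it is fixed by \<open>cm Q\<close> and lies in the conjugate of
      \<open>W\<close>.\<close>
    have "hm (u - cm Q *v u) (u - cm Q *v u) = 0"
      by (simp only: hm_diff_left hm_diff_right a b c diff_self)
    then have "cm Q *v u = u" by simp
    moreover have "cm Q *v u \<in> cj ` W" using cq by (auto simp: is_proj_def)
    ultimately show "?T *v x = 0" using 0 yV unfolding u_def by auto
  qed
  then have T: "?T = 0" unfolding matrix_eq by simp
  have "adj (cm Q ** P) ** (cm Q ** P) = P ** (cm Q ** cm Q) ** P"
    by (simp add: adj_mult p cq'(1) matrix_mul_assoc)
  also have "\<dots> = 0" using T cq' by simp
  finally show ?thesis by (rule adj_mult_self_eq_0)
qed

context dim_seq
begin

text \<open>The trace of \<open>P ** cm Q\<close> is constant on the orbit, and the two summands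
  come from the product rule. The matrix \<open>H\<close> is complex: the tangent space supplies a
  curve of flags with its velocity even if no curve of real rotations has it.\<close>

lemma first_variation:
  assumes g: "g \<in> SL_C" and C: "act g bf \<in> orbit SO_R F0"
    and sub: "complex_submanifold dims d (orbit SO_R F0)" and H: "transpose H = - H"
    and P: "is_proj P (act g bf ! i)" "i < r" and Q: "is_proj Q (act g bf ! j)" "j < r"
  defines "DP \<equiv> (mat 1 - P) ** H ** P" and "DQ \<equiv> (mat 1 - Q) ** H ** Q"
  shows "trace ((DP + adj DP) ** cm Q) + trace (P ** cm (DQ + adj DQ)) = 0"
proof -
  let ?F = "act g bf"
  let ?gi = "matrix_inv g"
  have gi: "?gi ** g = mat 1" "g ** ?gi = mat 1" and ginv: "invertible g"
    using SL_C_invertible[OF g] by (simp_all add: matrix_inv_left matrix_inv_right)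
  define v where "v = lowp (?gi ** H ** g)"
  have "v \<in> tg g (orbit SO_R F0)" unfolding v_def by (rule tangent_antisym[OF g C sub H])
  then obtain c where c: "c 0 = 0" "\<forall>\<^sub>F t in at 0. c t \<in> {X \<in> crd Low. chart_param dims g X \<in> orbit SO_R F0}"
    "(c has_vector_derivative v) (at 0)" by (auto simp: tg_def tang_def)
  define G where "G t = g ** lo (c t) ** ?gi" for t
  define K where "K = g ** (\<chi> i j. v $ (i, j)) ** ?gi"
  have G0: "G 0 = mat 1" by (simp add: G_def c gi)
  have "((\<lambda>t. \<chi> i j. c t $ (i, j)) has_vector_derivative (\<chi> i j. v $ (i, j))) (at 0)"
    by (rule bounded_linear.has_vector_derivative[OF bounded_linear_vmat c(3)])
  then have "((\<lambda>t. lo (c t)) has_vector_derivative (\<chi> i j. v $ (i, j))) (at 0)"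
    unfolding lo_def by (auto intro!: derivative_eq_intros)
  then have "((\<lambda>t. g ** lo (c t)) has_vector_derivative g ** (\<chi> i j. v $ (i, j))) (at 0)"
    by (rule bounded_linear.has_vector_derivative[OF mm.bounded_linear_right])
  then have G: "(G has_vector_derivative K) (at 0)"
    unfolding G_def K_def by (rule bounded_linear.has_vector_derivative[OF mm.bounded_linear_left])
  have actG: "act (G t) ?F = chart_param dims g (c t)" for t
  proof -
    have "act (G t) ?F = act (g ** lo (c t) ** (?gi ** g)) bf"
      by (simp only: G_def act_act matrix_mul_assoc)
    then show ?thesis by (simp add: gi chart_param_eq)
  qed
  \<comment> \<open>A pointwise choice, about which nothing but orthogonality and the effect on the
    flag is known.\<close>
  define k where "k t = (SOME k. k \<in> SO_R \<and> act (G t) ?F = act k ?F)" for t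
  have k: "\<forall>\<^sub>F t in at 0. k t \<in> SO_R \<and> act (G t) ?F = act (k t) ?F"
    using c(2)
  proof eventually_elim
    case (elim t)
    then have "\<exists>k. k \<in> SO_R \<and> act (G t) ?F = act k ?F"
      using orbit_SO_R_trans[OF C, of "act (G t) ?F"] by (auto simp: actG)
    then show ?case unfolding k_def by (rule someI_ex)
  qed
  have ev: "\<forall>\<^sub>F t in at 0. is_proj (k t ** A ** adj (k t)) ((*v) (G t) ` (?F ! i)) \<and> trace (k t ** A ** adj (k t)) = trace A"
    if A: "is_proj A (?F ! i)" "i < r" for A i
    using k
  proof eventually_elim
    case (elim t)
    have kk: "adj (k t) ** k t = mat 1" using elim by (simp add: SO_R_iff)
    have "act (G t) ?F ! i = act (k t) ?F ! i" using elim by simp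
    then have "(*v) (G t) ` (?F ! i) = (*v) (k t) ` (?F ! i)" using A(2) by simp
    then show ?case
      using is_proj_conj[OF A(1) kk] trace_cycle[of "k t" A "adj (k t)"] by (simp add: kk)
  qed
  \<comment> \<open>The velocity \<open>K\<close> agrees with \<open>H\<close> up to a conjugate by
    \<open>g\<close> of a block upper triangular matrix. Such a difference preserves each flag
    member, so it is annihilated between \<open>mat 1 - A\<close> and \<open>A\<close>.\<close>
  have KH: "(mat 1 - A) ** K ** A = (mat 1 - A) ** H ** A" if A: "is_proj A (?F ! i)" "i < r" for A i
  proof -
    let ?N = "?gi ** H ** g - (\<chi> i j. v $ (i, j))"
    have "g ** ?N ** ?gi = (g ** ?gi) ** H ** (g ** ?gi) - K"
      by (simp add: K_def mat_distribs matrix_mul_assoc)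
    then have N: "H = K + g ** ?N ** ?gi" by (simp add: gi)
    have "(mat 1 - A) ** (g ** ?N ** ?gi) ** A *v x = 0" for x
    proof -
      have "A *v x \<in> ?F ! i" using A by (simp add: is_proj_def)
      then obtain y where y: "A *v x = g *v y" "y \<in> crd {a. bi a \<le> i}"
        using A(2) by (auto simp: nth_bf' simp del: nth_bf)
      have "?N $ p $ c = 0" if "bi c < bi p" for p c
        using that by (simp add: v_def lowp_def Low_def)
      then have "?N $ p $ c * y $ c = 0" if "\<not> bi p \<le> i" for p c
        using that y(2) by (cases "bi c < bi p") (auto simp: crd_def)
      then have "(\<Sum>c\<in>UNIV. ?N $ p $ c * y $ c) = 0" if "\<not> bi p \<le> i" for p
        using that by (intro sum.neutral) blast
      then have Ny: "?N *v y \<in> crd {a. bi a \<le> i}"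
        unfolding crd_def matrix_vector_mult_def by simp
      have "g *v (?N *v (?gi *v (A *v x))) = g *v (?N *v ((?gi ** g) *v y))"
        by (simp only: y matrix_vector_mul_assoc)
      also have "\<dots> = g *v (?N *v y)" by (simp add: gi)
      also have "\<dots> \<in> ?F ! i" using Ny A(2) by (simp add: nth_bf' del: nth_bf)
      finally have "A *v (g *v (?N *v (?gi *v (A *v x)))) = g *v (?N *v (?gi *v (A *v x)))"
        using A(1) by (simp add: is_proj_def)
      then show ?thesis
        by (simp only: matrix_vector_mul_assoc[symmetric] matrix_vector_mult_diff_rdistrib matrix_vector_mul_lid) simp
    qed
    then have "(mat 1 - A) ** (g ** ?N ** ?gi) ** A = 0" unfolding matrix_eq by simp
    then show ?thesis by (subst N) (simp only: mm.add_left mm.add_right, simp)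
  qed
  have limP: "((\<lambda>t. (1 / t) *\<^sub>R (k t ** P ** adj (k t) - P)) \<longlongrightarrow> DP + adj DP) (at 0)"
    using projection_derivative(1)[OF P(1) G0 G ev[OF P]] unfolding KH[OF P] DP_def .
  have limQ: "((\<lambda>t. (1 / t) *\<^sub>R (k t ** Q ** adj (k t) - Q)) \<longlongrightarrow> DQ + adj DQ) (at 0)"
    using projection_derivative(1)[OF Q(1) G0 G ev[OF Q]] unfolding KH[OF Q] DQ_def .
  have limQ0: "((\<lambda>t. k t ** Q ** adj (k t)) \<longlongrightarrow> Q) (at 0)"
    by (rule projection_derivative(2)[OF Q(1) G0 G ev[OF Q]])
  \<comment> \<open>A discrete product rule: the increment of \<open>P\<close> is paired with the
    moved \<open>Q\<close>, that of \<open>Q\<close> with the fixed \<open>P\<close>.\<close>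
  let ?f = "\<lambda>t. trace ((1 / t) *\<^sub>R (k t ** P ** adj (k t) - P) ** cm (k t ** Q ** adj (k t)))
      + trace (P ** cm ((1 / t) *\<^sub>R (k t ** Q ** adj (k t) - Q)))"
  have "(?f \<longlongrightarrow> trace ((DP + adj DP) ** cm Q) + trace (P ** cm (DQ + adj DQ))) (at 0)"
    by (intro tendsto_add tendsto_trace mm.tendsto tendsto_cm limP limQ limQ0 tendsto_const)
  moreover have "\<forall>\<^sub>F t in at 0. ?f t = 0"
    using k
  proof eventually_elim
    case (elim t)
    have kk: "adj (k t) ** k t = mat 1" "cm (k t) = k t" using elim by (simp_all add: SO_R_iff)
    have cms: "cm (a *\<^sub>R A) = a *\<^sub>R cm A" for a and A :: "'n cmat" by (simp add: vec_eq_iff)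
    have "k t ** P ** adj (k t) ** cm (k t ** Q ** adj (k t)) = k t ** P ** (adj (k t) ** k t) ** cm Q ** adj (k t)"
      by (simp add: cm_mult cm_adj kk(2) matrix_mul_assoc)
    then have "trace (k t ** P ** adj (k t) ** cm (k t ** Q ** adj (k t))) = trace (k t ** (P ** cm Q) ** adj (k t))"
      by (simp add: kk matrix_mul_assoc)
    also have "\<dots> = trace (P ** cm Q)"
      using trace_cycle[of "k t" "P ** cm Q" "adj (k t)"] by (simp add: kk)
    finally have tr: "trace (k t ** P ** adj (k t) ** cm (k t ** Q ** adj (k t))) = trace (P ** cm Q)" .
    have "?f t = (1 / t) *\<^sub>R (trace (k t ** P ** adj (k t) ** cm (k t ** Q ** adj (k t))) - trace (P ** cm Q))"
      by (simp add: cms cm_diff mat_distribs mm.scaleR_left mm.scaleR_right trace_scaleR trace_diff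
          scaleR_add_right[symmetric])
    then show ?case using tr by simp
  qed
  then have "(?f \<longlongrightarrow> 0) (at 0)" by (rule tendsto_eventually)
  ultimately show ?thesis
    by (rule tendsto_unique[OF at_neq_bot])
qed

text \<open>For Hermitian \<open>H\<close> with \<open>cm H = - H\<close>, the vanishing first
  variation reads \<open>trace (H ** M) = 0\<close>, where \<open>M\<close> is the difference
  \<open>cm Q ** P ** cm Q - P ** cm Q ** P\<close>. Testing with \<open>H = M - cm M\<close> makes
  the Frobenius norm of \<open>H\<close> vanish, so \<open>M\<close> is real, which is the claimed
  equation.\<close>

lemma critical_equation:
  assumes g: "g \<in> SL_C" and C: "act g bf \<in> orbit SO_R F0"
    and sub: "complex_submanifold dims d (orbit SO_R F0)"
    and P: "is_proj P (act g bf ! i)" "i < r" and Q: "is_proj Q (act g bf ! j)" "j < r"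
  shows "cm Q ** P ** cm Q + cm P ** Q ** cm P = P ** cm Q ** P + Q ** cm P ** Q"
proof -
  have p: "adj P = P" "P ** P = P" using P by (auto simp: is_proj_def)
  have q: "adj Q = Q" "Q ** Q = Q" using Q by (auto simp: is_proj_def)
  let ?M = "cm Q ** P ** cm Q - P ** cm Q ** P"
  have main: "trace (H ** ?M) = 0" if H: "adj H = H" "cm H = - H" for H
  proof -
    have tH: "transpose H = - H"
    proof -
      have "transpose H = cm (adj H)" by (simp add: vec_eq_iff transpose_def)
      then show ?thesis by (simp only: H)
    qed
    let ?DP = "(mat 1 - P) ** H ** P" and ?DQ = "(mat 1 - Q) ** H ** Q"
    have 0: "trace ((?DP + adj ?DP) ** cm Q) + trace (P ** cm (?DQ + adj ?DQ)) = 0"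
      by (rule first_variation[OF g C sub tH P Q])
    have DP: "?DP + adj ?DP = H ** P - P ** H ** P + (P ** H - P ** H ** P)"
      by (simp add: adj_mult adj_diff p H mat_distribs matrix_mul_assoc)
    have a: "?DQ = H ** Q - Q ** H ** Q"
      by (simp add: mat_distribs matrix_mul_assoc)
    have b: "adj ?DQ = Q ** H - Q ** H ** Q"
      by (simp add: adj_mult adj_diff q H mat_distribs matrix_mul_assoc)
    have DQ: "cm (?DQ + adj ?DQ) = - (H ** cm Q) + cm Q ** H ** cm Q + (- (cm Q ** H) + cm Q ** H ** cm Q)"
      unfolding b unfolding a
      by (simp only: cm_add cm_diff cm_mult H mm.minus_left mm.minus_right diff_minus_eq_add)
    have t1: "trace (P ** H ** P ** cm Q) = trace (H ** P ** cm Q ** P)"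
      using trace_mul_sym[of P "H ** P ** cm Q"] by (simp add: matrix_mul_assoc)
    have t2: "trace (P ** H ** cm Q) = trace (H ** cm Q ** P)"
      using trace_mul_sym[of P "H ** cm Q"] by (simp add: matrix_mul_assoc)
    have t3: "trace (P ** cm Q ** H) = trace (H ** P ** cm Q)"
      using trace_mul_sym[of "P ** cm Q" H] by (simp add: matrix_mul_assoc)
    have t4: "trace (P ** cm Q ** H ** cm Q) = trace (H ** cm Q ** P ** cm Q)"
      using trace_mul_sym[of "P ** cm Q" "H ** cm Q"] by (simp add: matrix_mul_assoc)
    have "2 * trace (H ** cm Q ** P ** cm Q) - 2 * trace (H ** P ** cm Q ** P) = 0"
      using 0 unfolding DP DQ
      by (simp only: mat_distribs matrix_mul_assoc trace_diff trace_add t1 t2 t3 t4 trace_neg) (simp add: algebra_simps)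
    then show ?thesis by (simp add: mat_distribs matrix_mul_assoc trace_diff)
  qed
  define M where "M = ?M"
  have aM: "adj M = M"
    by (simp add: M_def adj_diff adj_mult p q cm_adj[symmetric] matrix_mul_assoc)
  define H where "H = M - cm M"
  have H: "adj H = H" "cm H = - H"
    by (simp_all add: H_def adj_diff aM cm_adj[symmetric] cm_diff)
  have z: "trace (H ** M) = 0" unfolding M_def by (rule main[OF H])
  have "cnj (trace (H ** M)) = trace (cm H ** cm M)" by (simp only: trace_cm[symmetric] cm_mult)
  then have "trace (H ** cm M) = 0" using z by (simp add: H(2) mm.minus_left trace_neg)
  then have "trace (H ** (M - cm M)) = 0" using z by (simp add: mm.diff_right trace_diff)
  then have "trace (adj H ** H) = 0" by (simp add: H(1) flip: H_def)
  then have "H = 0" unfolding norm_adj_mult by simp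
  then have "M = cm M" by (simp add: H_def)
  also have "cm M = Q ** cm P ** Q - cm P ** Q ** cm P" by (simp add: M_def cm_diff cm_mult)
  finally show ?thesis by (simp add: M_def algebra_simps)
qed

end

context sym_seq
begin

text \<open>Conjugate symmetry reduces the claim to \<open>i \<le> j\<close>, where the two members
  are nested. The critical equation is then used for the smaller projection with itself and for the
  pair.\<close>

lemma base_cycle_isotropic:
  assumes D: "open_orbit dims D" and C: "base_cycle dims D C" and F: "F \<in> C"
  shows "isotropic F" "F \<in> flags dims"
proof -
  obtain F0 d where F0: "C = orbit SO_R F0" "complex_submanifold dims d C" and CD: "C \<subseteq> D"
    using C by (auto simp: base_cycle_def)
  have FD: "F \<in> D" using F CD by blast
  have Ff: "F \<in> flags dims" and gp: "general_pos F" using open_orbit_general_pos[OF D FD] by auto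
  show "F \<in> flags dims" by (rule Ff)
  obtain g where g: "g \<in> SL_C" "act g bf = F" using flags_transitive[OF Ff] by blast
  have gC: "act g bf \<in> orbit SO_R F0" using F g F0 by simp
  have sub: "complex_submanifold dims d (orbit SO_R F0)" using F0 by simp
  have main: "hm x (cj y) = 0" if ij: "i + j + 2 = r" "i \<le> j" and x: "x \<in> F ! i" and y: "y \<in> F ! j" for i j x y
  proof -
    have r: "i < r" "j < r" using ij by auto
    obtain P Q where P: "is_proj P (F ! i)" and Q: "is_proj Q (F ! j)" using exists_proj[OF Ff] r by meson
    have P': "is_proj P (act g bf ! i)" and Q': "is_proj Q (act g bf ! j)" using P Q g by auto
    have "cm Q ** P = 0"
    proof (rule isotropic_of_critical[OF P Q])
      show "F ! i \<subseteq> F ! j" by (rule nth_subset_flags[OF Ff ij(2) r(2)])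
      show "F ! i \<inter> cj ` (F ! j) \<subseteq> {0}" using gp ij unfolding general_pos_def by blast
      show "cm P ** P ** cm P + cm P ** P ** cm P = P ** cm P ** P + P ** cm P ** P"
        by (rule critical_equation[OF g(1) gC sub P' r(1) P' r(1)])
      show "cm Q ** P ** cm Q + cm P ** Q ** cm P = P ** cm Q ** P + Q ** cm P ** Q"
        by (rule critical_equation[OF g(1) gC sub P' r(1) Q' r(2)])
    qed
    then have "cm Q *v (P *v x) = 0" by (simp add: matrix_vector_mul_assoc)
    moreover have "P *v x = x" using P x by (simp add: is_proj_def)
    moreover have "cm Q *v cj y = cj y" "adj (cm Q) = cm Q" using is_proj_cm[OF Q] y by (auto simp: is_proj_def)
    ultimately show ?thesis using hm_adj[of "cm Q" x "cj y"] by simp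
  qed
  show "isotropic F"
    unfolding isotropic_def
  proof (intro allI impI ballI)
    fix i j x y assume ij: "i + j + 2 = r" and x: "x \<in> F ! i" and y: "y \<in> F ! j"
    show "hm x (cj y) = 0"
    proof (cases "i \<le> j")
      case True
      then show ?thesis using main ij x y by blast
    next
      case False
      then have "hm y (cj x) = 0" using main[of j i y x] ij x y by simp
      then show ?thesis using hm_cj[of y "cj x"] hm_commute[of x "cj y"] by simp
    qed
  qed
qed

end

section \<open>Isotropic flags\<close>

text \<open>For a complex unit vector \<open>u\<close> orthogonal to the given real vectors, one of
  \<open>u + cj u\<close> and \<open>\<i> *s (u - cj u)\<close> is nonzero, and both are real and
  orthogonal to the same vectors.\<close>

lemma exists_real_unit_orthogonal:
  fixes x :: "'n::finite \<Rightarrow> complex^'n"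
  assumes "\<And>a. a \<in> I \<Longrightarrow> cj (x a) = x a" "I \<noteq> UNIV"
  shows "\<exists>z. cj z = z \<and> hm z z = 1 \<and> (\<forall>a\<in>I. hm z (x a) = 0)"
proof -
  let ?W = "vec.span (x ` I)"
  have "vec.dim ?W \<le> card (x ` I)" unfolding vec.dim_span by (rule vec.dim_le_card') simp
  also have "\<dots> \<le> card I" by (rule card_image_le) simp
  also have "\<dots> < CARD('n)" using assms(2) by (simp add: psubset_card_mono psubset_eq)
  finally have "vec.dim ?W < vec.dim (UNIV :: (complex^'n) set)" unfolding vec_dim_card .
  then have "?W \<noteq> UNIV" by (metis less_irrefl)
  then have "?W \<subset> UNIV" by blast
  then obtain u where u: "hm u u = 1" "\<And>y. y \<in> ?W \<Longrightarrow> hm u y = 0"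
    using exists_unit_orthogonal[OF vec.subspace_UNIV vec.subspace_span] by blast
  have ux: "hm u (x a) = 0" "hm (cj u) (x a) = 0" if "a \<in> I" for a
  proof -
    show 1: "hm u (x a) = 0" by (rule u(2)) (use that in \<open>simp add: vec.span_base\<close>)
    show "hm (cj u) (x a) = 0" using hm_cj[of u "x a"] assms(1)[OF that] 1 by simp
  qed
  have "u + cj u \<noteq> 0 \<or> \<i> *s (u - cj u) \<noteq> 0"
  proof (rule ccontr)
    assume "\<not> ?thesis"
    then have "u + cj u = 0" "u - cj u = 0" by auto
    then have "u = 0" by (simp add: vec_eq_iff)
    then show False using u by simp
  qed
  then obtain y where y: "y = u + cj u \<or> y = \<i> *s (u - cj u)" "y \<noteq> 0" by blast
  have cy: "cj y = y" using y(1) by (auto simp: vec_eq_iff)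
  have yx: "hm y (x a) = 0" if "a \<in> I" for a
    using y(1) ux[OF that] by (auto simp: hm_add_left hm_scale_left hm_diff_left)
  let ?c = "complex_of_real (inverse (norm y))"
  have "hm (?c *s y) (?c *s y) = ?c * (cnj ?c * hm y y)" by (simp only: hm_scale_left hm_scale_right mult.left_commute)
  also have "\<dots> = of_real (inverse (norm y) * (inverse (norm y) * (norm y)\<^sup>2))"
    by (simp only: hm_self complex_cnj_complex_of_real of_real_mult)
  also have "inverse (norm y) * (inverse (norm y) * (norm y)\<^sup>2) = 1"
    using y(2) by (simp add: power2_eq_square field_simps)
  finally have "hm (?c *s y) (?c *s y) = 1" by simp
  moreover have "cj (?c *s y) = ?c *s y" unfolding cj_scale cy by simp
  moreover have "\<forall>a\<in>I. hm (?c *s y) (x a) = 0" unfolding hm_scale_left by (simp add: yx)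
  ultimately show ?thesis by blast
qed

text \<open>Real unit vectors are added one at a time; the sign of the determinant is left
  open.\<close>

lemma extend_real_orthonormal:
  fixes x :: "'n::finite \<Rightarrow> complex^'n"
  assumes "\<And>a. a \<in> I \<Longrightarrow> cj (x a) = x a" "\<And>a b. a \<in> I \<Longrightarrow> b \<in> I \<Longrightarrow> hm (x a) (x b) = (if a = b then 1 else 0)"
  shows "\<exists>k. cm k = k \<and> adj k ** k = mat 1 \<and> (\<forall>a\<in>I. column a k = x a)"
proof -
  have "\<exists>z. (\<forall>a\<in>I. z a = x a) \<and> (\<forall>a. cj (z a) = z a) \<and> (\<forall>a b. hm (z a) (z b) = (if a = b then 1 else 0))"
    using assms
  proof (induction "CARD('n) - card I" arbitrary: I x)
    case 0
    then have "card I = CARD('n)" by (metis card_mono diff_is_0_eq finite le_antisym subset_UNIV)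
    then have "I = UNIV" by (metis card_subset_eq finite subset_UNIV)
    with 0 show ?case by (intro exI[of _ x]) auto
  next
    case (Suc n)
    then have "I \<noteq> UNIV" by auto
    then obtain b where b: "b \<notin> I" by blast
    obtain z where z: "cj z = z" "hm z z = 1" "\<And>a. a \<in> I \<Longrightarrow> hm z (x a) = 0"
      using exists_real_unit_orthogonal[of I x] Suc.prems \<open>I \<noteq> UNIV\<close> by blast
    have z': "hm (x a) z = 0" if "a \<in> I" for a using z(3)[OF that] hm_commute[of "x a" z] by simp
    have "n = CARD('n) - card (insert b I)" using Suc.hyps(2) b by simp
    then have "\<exists>w. (\<forall>a\<in>insert b I. w a = (x(b := z)) a) \<and> (\<forall>a. cj (w a) = w a)
        \<and> (\<forall>a c. hm (w a) (w c) = (if a = c then 1 else 0))"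
      by (rule Suc.hyps(1)) (use Suc.prems z z' b in auto)
    then show ?case using b by (metis (no_types, lifting) fun_upd_apply insertCI)
  qed
  then obtain z where z: "\<And>a. a \<in> I \<Longrightarrow> z a = x a" "\<And>a. cj (z a) = z a"
    "\<And>a b. hm (z a) (z b) = (if a = b then 1 else 0)" by blast
  let ?k = "\<chi> p a. z a $ p"
  have col: "column a ?k = z a" for a by (simp add: column_def vec_eq_iff)
  have "cm ?k = ?k" using z(2) by (simp add: vec_eq_iff)
  moreover have "adj ?k ** ?k = mat 1"
    by (auto simp: vec_eq_iff adj_mult_nth col z(3) mat_def)
  ultimately show ?thesis using col z(1) by (intro exI[of _ ?k]) auto
qed

text \<open>Conjugation is only antilinear, so a spanning set is carried over by hand instead of
  using a dimension formula for linear images.\<close>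

lemma linear_cj_dim:
  assumes "vec.subspace V"
  shows "vec.dim V \<le> vec.dim (cj ` V)"
proof -
  obtain B where B: "B \<subseteq> cj ` V" "vec.independent B" "cj ` V \<subseteq> vec.span B" "card B = vec.dim (cj ` V)"
    using vec.basis_exists by blast
  have "finite B" by (rule vec.finiteI_independent[OF B(2)])
  have "V \<subseteq> vec.span (cj ` B)"
  proof
    fix v assume v: "v \<in> V"
    have sub: "vec.subspace (cj ` vec.span (cj ` B))" by (intro subspace_cj vec.subspace_span)
    have "B \<subseteq> cj ` vec.span (cj ` B)"
    proof
      fix b assume "b \<in> B"
      then have "cj b \<in> vec.span (cj ` B)" by (simp add: vec.span_base)
      then show "b \<in> cj ` vec.span (cj ` B)" by (metis cj_cj imageI)
    qed
    then have "vec.span B \<subseteq> cj ` vec.span (cj ` B)" using sub by (rule vec.span_minimal)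
    then obtain w where "w \<in> vec.span (cj ` B)" "cj v = cj w" using v B(3) by blast
    then show "v \<in> vec.span (cj ` B)" by (metis cj_cj)
  qed
  then have "vec.dim V \<le> card (cj ` B)" by (rule vec.dim_le_card) (simp add: \<open>finite B\<close>)
  also have "\<dots> \<le> card B" by (rule card_image_le[OF \<open>finite B\<close>])
  finally show ?thesis using B(4) by simp
qed

lemma dim_cj:
  assumes "vec.subspace V"
  shows "vec.dim (cj ` V) = vec.dim V"
proof (rule antisym)
  have "cj ` cj ` V = V" by (simp add: image_comp o_def)
  then show "vec.dim (cj ` V) \<le> vec.dim V" using linear_cj_dim[OF subspace_cj[OF assms]] by simp
qed (rule linear_cj_dim[OF assms])

lemma column_mult: "column a (A ** B) = A *v column a B"
  by (simp add: vec_eq_iff column_def matrix_matrix_mult_def matrix_vector_mult_def)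

lemma mult_axis: "A *v axis c 1 = column c A" for A :: "complex^'n^'m"
  by (simp add: vec_eq_iff column_def)

lemma sg_column:
  "a < rv a \<Longrightarrow> column a sg = of_real (1 / sqrt 2) *s axis a 1 + (- \<i> / sqrt 2) *s axis (rv a) 1"
  "rv a < a \<Longrightarrow> column a sg = of_real (1 / sqrt 2) *s axis (rv a) 1 + (\<i> / sqrt 2) *s axis a 1"
  "rv a = a \<Longrightarrow> column a sg = axis a 1"
  by (auto simp: vec_eq_iff column_def sg_def axis_def)

context sym_seq
begin

text \<open>By dimension, a proper member in the upper half is the full orthogonal complement of the
  conjugate of its partner in the lower half, and the last member is the whole space. The lower half
  therefore determines the flag.\<close>

lemma isotropic_eqI:
  assumes F: "F \<in> flags dims" "isotropic F" and G: "G \<in> flags dims" "isotropic G"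
    and eq: "\<And>i. 2 * i + 2 \<le> r \<Longrightarrow> F ! i = G ! i"
  shows "F = G"
proof (rule nth_equalityI)
  show "length F = length G" using F G by (simp add: flags_length)
  fix i assume "i < length F"
  then have i: "i < r" using F by (simp add: flags_length)
  consider "2 * i + 2 \<le> r" | "i = r - 1" | "r < 2 * i + 2" "i + 2 \<le> r" using i by linarith
  then show "F ! i = G ! i"
  proof cases
    case 1
    then show ?thesis by (rule eq)
  next
    case 2
    then have "Suc i = r" using i by linarith
    then have dimU: "vec.dim (A ! i) = vec.dim (UNIV :: 'n cvec set)" if "A \<in> flags dims" for A :: "'n flag"
      using flags_dim[OF that i] m_r unfolding vec_dim_card by simp
    have "A ! i = UNIV" if "A \<in> flags dims" for A :: "'n flag"
      by (rule vec.subspace_dim_equal[OF flags_subspace[OF that i] vec.subspace_UNIV subset_UNIV])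
        (rule order_eq_refl[OF dimU[OF that, symmetric]])
    then show ?thesis using F G by simp
  next
    case 3
    let ?j = "r - 2 - i"
    have ij: "i + ?j + 2 = r" "?j < r" using 3 by auto
    have j: "F ! ?j = G ! ?j" by (rule eq) (use 3 in linarith)
    let ?O = "{x. \<forall>y\<in>F ! ?j. hm x (cj y) = 0}"
    have O: "vec.subspace ?O" by (auto simp: vec.subspace_def hm_add_left hm_scale_left)
    have cjV: "vec.subspace (cj ` (F ! ?j))" by (intro subspace_cj flags_subspace F ij)
    have "?O \<inter> cj ` (F ! ?j) \<subseteq> {0}" by auto
    then have "vec.dim (?O \<inter> cj ` (F ! ?j)) = 0" unfolding vec.dim_eq_0 .
    then have "vec.dim ?O + vec.dim (cj ` (F ! ?j)) \<le> CARD('n)"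
      using vec.dim_sums_Int[OF O cjV] dim_subset_UNIV_cart_gen[of "{x + y |x y. x \<in> ?O \<and> y \<in> cj ` (F ! ?j)}"] by linarith
    moreover have "vec.dim (cj ` (F ! ?j)) = m (Suc ?j)"
      using dim_cj[OF flags_subspace[OF F(1) ij(2)]] flags_dim[OF F(1) ij(2)] by simp
    moreover have "m (Suc i) + m (Suc ?j) = CARD('n)"
    proof -
      have "r - Suc i = Suc ?j" using 3 by linarith
      then show ?thesis using m_rev[of "Suc i"] i by simp
    qed
    ultimately have dO: "vec.dim ?O \<le> m (Suc i)" by linarith
    have "A ! i = ?O" if A: "A \<in> flags dims" "isotropic A" "A ! ?j = F ! ?j" for A
    proof (rule vec.subspace_dim_equal[OF flags_subspace[OF A(1) i] O])
      show "A ! i \<subseteq> ?O" using A ij(1) unfolding isotropic_def by auto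
      show "vec.dim ?O \<le> vec.dim (A ! i)" using dO flags_dim[OF A(1) i] by simp
    qed
    then show ?thesis using F G j by simp
  qed
qed

text \<open>In an adapted unitary basis the vectors of the lower half are orthogonal to all
  conjugates of vectors of the lower half. Their real and imaginary parts, scaled by \<surd>2, are
  thus real orthonormal, and a real orthogonal extension carries the standard isotropic flag to
  \<open>F\<close>.\<close>

lemma isotropic_orbit:
  assumes F: "F \<in> flags dims" "isotropic F"
  shows "\<exists>k. cm k = k \<and> adj k ** k = mat 1 \<and> F = act (k ** sg) bf"
proof -
  obtain U where U: "adj U ** U = mat 1" "act U bf = F" using adapted_unitary[OF F(1)] by blast
  define u where "u a = column a U" for a
  have uu: "hm (u a) (u b) = (if a = b then 1 else 0)" for a b
  proof -
    have "(adj U ** U) $ b $ a = mat 1 $ b $ a" by (simp only: U)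
    then show ?thesis unfolding adj_mult_nth u_def by (auto simp: mat_def)
  qed
  have uF: "u a \<in> F ! i" if "bi a \<le> i" "i < r" for a i
    using that U(2) by (auto simp: nth_act_bf u_def simp flip: mult_axis simp del: nth_act)
  \<comment> \<open>The member ending with the block of \<open>a\<close> is contained in its partner
    of complementary dimension.\<close>
  define low where "low a \<longleftrightarrow> 2 * bi a + 2 \<le> r" for a
  have low_less: "a < rv a" if "low a" for a
    by (rule bi_less_imp) (use that bi_add_bi_rv[of a] in \<open>unfold low_def, linarith\<close>)
  have uc: "hm (u a) (cj (u b)) = 0" if "low a" "low b" for a b
  proof -
    let ?j = "r - 2 - bi a"
    have "bi a + ?j + 2 = r" "bi b \<le> ?j" using that unfolding low_def by linarith+
    then show ?thesis
      using F(2) uF[of a "bi a"] uF[of b ?j] unfolding isotropic_def by auto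
  qed
  have uc': "hm (cj (u a)) (u b) = 0" if "low a" "low b" for a b
    using uc[OF that(2,1)] hm_commute[of "cj (u a)" "u b"] by simp
  have ucc: "hm (cj (u a)) (cj (u b)) = (if a = b then 1 else 0)" for a b
    unfolding hm_cj uu by simp
  have s2: "complex_of_real (sqrt 2) * complex_of_real (sqrt 2) = 2"
    by (metis of_real_mult of_real_numeral real_sqrt_mult_self abs_numeral)
  define I where "I = {a. low a \<or> low (rv a)}"
  \<comment> \<open>These are \<surd>2 times the real part of \<open>u a\<close>, and -\<surd>2
    times the imaginary part of \<open>u (rv a)\<close>. The sign matches the coefficient
    \<open>- \<i>\<close> in the columns of \<open>sg\<close>.\<close>
  define x where "x a = (if low a then of_real (1 / sqrt 2) *s (u a + cj (u a))
     else (\<i> / sqrt 2) *s (u (rv a) - cj (u (rv a))))" for a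
  have not_both: "\<not> low (rv a)" if "low a" for a using low_less[OF that] low_less[of "rv a"] by auto
  have "\<exists>k. cm k = k \<and> adj k ** k = mat 1 \<and> (\<forall>a\<in>I. column a k = x a)"
  proof (rule extend_real_orthonormal)
    show "cj (x a) = x a" if "a \<in> I" for a
      by (simp add: x_def vec_eq_iff)
    show "hm (x a) (x b) = (if a = b then 1 else 0)" if "a \<in> I" "b \<in> I" for a b
    proof -
      have half: "complex_of_real (1 / sqrt 2) * complex_of_real (1 / sqrt 2) = 1 / 2"
        using s2 by (simp add: field_simps)
      show ?thesis
      proof (cases "low a"; cases "low b")
        assume l: "low a" "low b"
        have "hm (x a) (x b) = (complex_of_real (1 / sqrt 2) * complex_of_real (1 / sqrt 2)) * (if a = b then 2 else 0)"
          using l by (simp add: x_def hm_add_left hm_add_right hm_scale_left hm_scale_right uu uc uc' ucc)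
        then show ?thesis unfolding half by (cases "a = b") simp_all
      next
        assume l: "low a" "\<not> low b"
        then have l': "low (rv b)" using that by (simp add: I_def)
        show ?thesis
          using l l' by (auto simp: x_def hm_add_left hm_add_right hm_diff_left hm_diff_right hm_scale_left hm_scale_right uu uc uc' ucc)
      next
        assume l: "\<not> low a" "low b"
        then have l': "low (rv a)" using that by (simp add: I_def)
        show ?thesis
          using l l' by (auto simp: x_def hm_add_left hm_add_right hm_diff_left hm_diff_right hm_scale_left hm_scale_right uu uc uc' ucc)
      next
        assume l: "\<not> low a" "\<not> low b"
        then have l': "low (rv a)" "low (rv b)" using that by (auto simp: I_def)
        have "hm (x a) (x b) = (complex_of_real (1 / sqrt 2) * complex_of_real (1 / sqrt 2)) * (if a = b then 2 else 0)"
          using l l' by (simp add: x_def hm_diff_left hm_diff_right hm_scale_left hm_scale_right uu uc uc' ucc)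
        then show ?thesis unfolding half by (cases "a = b") simp_all
      qed
    qed
  qed
  then obtain k where k: "cm k = k" "adj k ** k = mat 1" "\<And>a. a \<in> I \<Longrightarrow> column a k = x a" by blast
  have col: "column a (k ** sg) = u a" if l: "low a" for a
  proof -
    have "column a (k ** sg) = k *v (of_real (1 / sqrt 2) *s axis a 1 + (- \<i> / sqrt 2) *s axis (rv a) 1)"
      unfolding column_mult sg_column(1)[OF low_less[OF l]] ..
    also have "\<dots> = of_real (1 / sqrt 2) *s column a k + (- \<i> / sqrt 2) *s column (rv a) k"
      by (simp only: matrix_vector_right_distrib vector_scalar_commute mult_axis)
    also have "\<dots> = of_real (1 / sqrt 2) *s (of_real (1 / sqrt 2) *s (u a + cj (u a)))
        + (- \<i> / sqrt 2) *s ((\<i> / sqrt 2) *s (u a - cj (u a)))"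
      using l not_both[OF l] k(3)[of a] k(3)[of "rv a"] by (simp add: I_def x_def)
    also have "\<dots> = u a"
      using s2 by (simp add: vec_eq_iff)
    finally show ?thesis .
  qed
  have un: "adj (k ** sg) ** (k ** sg) = mat 1"
  proof -
    have "adj (k ** sg) ** (k ** sg) = adj sg ** (adj k ** k) ** sg" by (simp add: adj_mult matrix_mul_assoc)
    then show ?thesis by (simp add: k(2) sg_unitary)
  qed
  have iso: "isotropic (act (k ** sg) bf)"
  proof (rule isotropic_unitary[OF un])
    show "cj (column a (k ** sg)) = column (rv a) (k ** sg)" for a
      by (simp only: column_mult cj_mult_cm k(1) cj_column_sg)
  qed
  have inv: "invertible (k ** sg)" by (rule unitary_invertible[OF un])
  have "F = act (k ** sg) bf"
  proof (rule isotropic_eqI[OF F _ iso])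
    show "act (k ** sg) bf \<in> flags dims" by (rule act_flags[OF inv bf_flags])
    fix i assume i: "2 * i + 2 \<le> r"
    then have ir: "i < r" by simp
    have "(*v) (k ** sg) ` crd {a. bi a \<le> i} = F ! i"
    proof (rule image_crd_eqI[OF inv flags_subspace[OF F(1) ir]])
      show "vec.dim (F ! i) = card {a. bi a \<le> i}" using ir F by (simp add: flags_dim card_bi_le)
      fix j assume j: "j \<in> {a. bi a \<le> i}"
      then have "low j" using i by (simp add: low_def)
      then show "column j (k ** sg) \<in> F ! i" using uF j ir by (simp add: col)
    qed
    then show "F ! i = act (k ** sg) bf ! i" using ir by (simp add: nth_act_bf del: nth_act)
  qed
  then show ?thesis using k by blast
qed

end

section \<open>Combinatorics of double box contraction\<close>

text \<open>No pair straddles \<open>x\<close>: its members are neighbours in \<open>R\<close>, and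
  \<open>x\<close> is an element of \<open>R\<close> different from the larger one.\<close>

lemma balanced_of_pairs:
  fixes prs :: "('a::linorder \<times> 'a) set"
  assumes imm: "\<forall>(l, k) \<in> prs. immediate_left R l k"
    and disj: "pairwise (\<lambda>(l, k) (l', k'). disjnt {l, k} {l', k'}) prs"
    and A: "A = snd ` prs" and B: "B = fst ` prs" and x: "x \<in> R" "x \<notin> A"
  shows "card (B \<inter> {..<x}) = card (A \<inter> {..<x})"
proof -
  have iff: "fst p < x \<longleftrightarrow> snd p < x" if "p \<in> prs" for p
  proof -
    have il: "immediate_left R (fst p) (snd p)" using imm that by auto
    have "snd p \<noteq> x" using x A that by auto
    then show ?thesis using il x unfolding immediate_left_def by (metis less_trans linorder_neqE)
  qed
  have "inj_on fst prs" "inj_on snd prs"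
    using disj by (auto simp: inj_on_def pairwise_def disjnt_def split: prod.splits) fastforce+
  moreover have "B \<inter> {..<x} = fst ` {p \<in> prs. fst p < x}" "A \<inter> {..<x} = snd ` {p \<in> prs. snd p < x}"
    using A B by auto
  moreover have "{p \<in> prs. fst p < x} = {p \<in> prs. snd p < x}" using iff by blast
  ultimately show ?thesis
    by (metis (no_types, lifting) card_image inj_on_subset mem_Collect_eq subsetI)
qed

text \<open>The pairs join each element of \<open>B\<close> to its successor in \<open>R\<close>.
  The successor exists because the totals agree, and it lies in \<open>A\<close>, since otherwise
  balance would hold at both ends although only the element of \<open>B\<close> is counted in
  between.\<close>

lemma pairs_of_balanced:
  fixes A B R :: "'a::{finite,linorder} set"
  assumes AR: "A \<subseteq> R" and BR: "B \<subseteq> R" and AB: "A \<inter> B = {}" and card: "card A = card B"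
    and bal: "\<And>x. x \<in> R \<Longrightarrow> x \<notin> A \<Longrightarrow> card (B \<inter> {..<x}) = card (A \<inter> {..<x})"
  shows "\<exists>prs. card prs = card B \<and> (\<forall>(l, k) \<in> prs. immediate_left R l k) \<and>
     pairwise (\<lambda>(l, k) (l', k'). disjnt {l, k} {l', k'}) prs \<and> A = snd ` prs \<and> B = fst ` prs"
proof -
  define nxt where "nxt l = Min {y \<in> R. l < y}" for l
  have step: "immediate_left R l (nxt l) \<and> nxt l \<in> A" if l: "l \<in> B" for l
  proof -
    have lR: "l \<in> R" "l \<notin> A" using l BR AB by auto
    have ne: "{y \<in> R. l < y} \<noteq> {}"
    proof
      assume "{y \<in> R. l < y} = {}"
      then have le: "y \<le> l" if "y \<in> R" for y using that by (auto simp: not_less)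
      have "B \<inter> {..<l} = B - {l}" "A \<inter> {..<l} = A" using le BR AR lR by (auto simp: less_le)
      then have "card (B - {l}) = card B" using bal[OF lR] card by simp
      then show False using l by (metis card_Diff1_less finite less_irrefl)
    qed
    have nl: "nxt l \<in> R" "l < nxt l" using Min_in[OF _ ne] unfolding nxt_def by auto
    have no: "\<not> y < nxt l" if "y \<in> R" "l < y" for y
      using that unfolding nxt_def by (simp add: not_less)
    have il: "immediate_left R l (nxt l)" using lR nl no by (auto simp: immediate_left_def)
    have "nxt l \<in> A"
    proof (rule ccontr)
      assume "nxt l \<notin> A"
      then have "card (B \<inter> {..<nxt l}) = card (A \<inter> {..<nxt l})" using bal nl by blast
      moreover have "B \<inter> {..<nxt l} = insert l (B \<inter> {..<l})"
        using no BR l nl by (auto simp: not_less) (metis linorder_cases no subsetD)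
      moreover have "A \<inter> {..<nxt l} = A \<inter> {..<l}"
        using no AR lR nl by auto (metis linorder_cases no subsetD)
      ultimately show False using bal[OF lR] by simp
    qed
    with il show ?thesis by simp
  qed
  have mono: "nxt l < nxt l'" if "l \<in> B" "l' \<in> B" "l < l'" for l l'
  proof -
    have "immediate_left R l (nxt l)" "immediate_left R l' (nxt l')" "l' \<in> R" using step that BR by auto
    then show ?thesis using that unfolding immediate_left_def by (metis le_less_trans not_less)
  qed
  have inj: "inj_on nxt B"
    by (rule inj_onI) (metis mono less_irrefl linorder_neqE)
  have img: "nxt ` B = A"
    by (rule card_subset_eq) (use step in \<open>auto simp: card_image inj card\<close>)
  let ?prs = "(\<lambda>l. (l, nxt l)) ` B"
  have "card ?prs = card B" by (rule card_image) (auto simp: inj_on_def)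
  moreover have "\<forall>(l, k) \<in> ?prs. immediate_left R l k" using step by auto
  moreover have "pairwise (\<lambda>(l, k) (l', k'). disjnt {l, k} {l', k'}) ?prs"
    using inj AB step by (auto simp: pairwise_def disjnt_def inj_on_eq_iff)
  moreover have "A = snd ` ?prs" "B = fst ` ?prs" using img by (auto simp: image_image)
  ultimately show ?thesis by blast
qed

text \<open>A permutation is recorded by the function \<open>\<beta>\<close> sending a value to the index of its block.
  The total excess of the inversion number over the codimension of the base cycle is the sum of the
  terms \<open>excess (J (\<beta> x)) {..<x}\<close>, where \<open>excess j S\<close> compares the first \<open>j\<close> mirror
  blocks with the first \<open>j\<close> blocks inside \<open>S\<close>; all terms are nonnegative as soon as the
  Schubert variety meets the base cycle.\<close>

locale block_fun =
  fixes \<beta> :: "'n::{finite,linorder} \<Rightarrow> nat" and r :: nat and \<tau> :: "'n \<Rightarrow> 'n"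
  assumes \<beta>_less: "\<beta> x < r" and \<tau>: "bij \<tau>" and \<beta>_\<tau>: "\<beta> (\<tau> x) = r - 1 - \<beta> x"
begin

text \<open>Chosen so that \<open>j < J (\<beta> x)\<close> says that \<open>x\<close> is still
  present at stage \<open>j\<close> and not in the left block \<open>j\<close>. A value of a mirror
  block thus counts its own stage, a value of a left or middle block does not.\<close>

definition J :: "nat \<Rightarrow> nat" where "J p = min p (r - p)"

definition gg :: "nat \<Rightarrow> nat \<Rightarrow> int" where
  "gg q j = of_bool (r \<le> q + j) - of_bool (q < j)"

definition excess :: "nat \<Rightarrow> 'n set \<Rightarrow> int" where
  "excess j S = (\<Sum>y\<in>S. gg (\<beta> y) j)"

definition layer :: "nat \<Rightarrow> 'n set \<Rightarrow> int" where
  "layer j S = int (card {y \<in> S. \<beta> y = r - 1 - j}) - int (card {y \<in> S. \<beta> y = j})"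

definition invs :: nat where
  "invs = card {(y, x). y < x \<and> \<beta> x < \<beta> y}"

lemma sum_mirror: "(\<Sum>y\<in>UNIV. f (\<beta> y)) = (\<Sum>y\<in>UNIV. f (r - 1 - \<beta> y))"
proof -
  have "(\<Sum>y\<in>UNIV. f (\<beta> (\<tau> y))) = (\<Sum>y\<in>UNIV. f (\<beta> y))"
    using \<tau> by (rule sum.reindex_bij_betw)
  then show ?thesis by (simp add: \<beta>_\<tau>)
qed

lemma excess_UNIV: "excess j UNIV = 0"
proof -
  have "(\<Sum>y\<in>UNIV. of_bool (r \<le> \<beta> y + j) :: int) = (\<Sum>y\<in>UNIV. of_bool (r \<le> r - 1 - \<beta> y + j))"
    by (rule sum_mirror[of "\<lambda>q. of_bool (r \<le> q + j)"])
  also have "\<dots> = (\<Sum>y\<in>UNIV. of_bool (\<beta> y < j))"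
  proof (intro sum.cong refl arg_cong[of _ _ of_bool])
    fix y show "(r \<le> r - 1 - \<beta> y + j) = (\<beta> y < j)" using \<beta>_less[of y] by linarith
  qed
  finally show ?thesis by (simp add: excess_def gg_def sum_subtractf)
qed

lemma sum_pairs_card: "(\<Sum>y\<in>UNIV. \<Sum>x\<in>UNIV. of_bool (P y x)) = int (card {(y :: 'n, x :: 'n). P y x})"
proof -
  have "(\<Sum>y\<in>UNIV. \<Sum>x\<in>UNIV. of_bool (P y x)) = (\<Sum>p\<in>(UNIV :: ('n \<times> 'n) set). of_bool (P (fst p) (snd p)) :: int)"
    unfolding sum.cartesian_product UNIV_Times_UNIV case_prod_beta ..
  also have "\<dots> = int (card {p. P (fst p) (snd p)})" by (simp add: of_bool_def sum.If_cases)
  finally show ?thesis unfolding case_prod_beta .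
qed

text \<open>The difference between the inversion indicator and the excess summand is symmetric in the
  two block indices, so its sum over \<open>y < x\<close> is half of its sum over all \<open>y \<noteq> x\<close>.\<close>

lemma kappa_sym:
  assumes "p < r" "q < r"
  shows "of_bool (p < q) - gg q (J p) = of_bool (q < p) - gg p (J q)"
  using assms unfolding gg_def J_def by (auto simp: min_def)

lemma kappa_diag:
  assumes "p < r"
  shows "of_bool (p < p) - gg p (J p) = - of_bool (r \<le> 2 * p)"
  using assms unfolding gg_def J_def by (auto simp: min_def)

text \<open>The two cardinalities add up to twice the codimension of the base cycle, by
  \<open>card_Low\<close>, so the sum of the excesses is the defect in the dimension
  condition.\<close>

lemma invs_excess:
  "2 * int invs = 2 * (\<Sum>x\<in>UNIV. excess (J (\<beta> x)) {..<x})
     + int (card {(x, y). \<beta> x < \<beta> y}) + int (card {x. r \<le> 2 * \<beta> x})"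
proof -
  define \<kappa> where "\<kappa> y x = of_bool (\<beta> x < \<beta> y) - gg (\<beta> y) (J (\<beta> x))" for y x
  have sym: "\<kappa> y x = \<kappa> x y" for x y unfolding \<kappa>_def by (rule kappa_sym) (rule \<beta>_less)+
  let ?L = "\<Sum>x\<in>UNIV. \<Sum>y\<in>UNIV. of_bool (y < x) * \<kappa> y x"
  have split: "\<kappa> y x = of_bool (y < x) * \<kappa> y x + of_bool (x < y) * \<kappa> x y + of_bool (y = x) * \<kappa> x x" for x y
    using sym[of x y] by (cases x y rule: linorder_cases) auto
  have "(\<Sum>x\<in>UNIV. \<Sum>y\<in>UNIV. \<kappa> y x) = ?L + (\<Sum>x\<in>UNIV. \<Sum>y\<in>UNIV. of_bool (x < y) * \<kappa> x y)
      + (\<Sum>x\<in>UNIV. \<Sum>y\<in>UNIV. of_bool (y = x) * \<kappa> x x)"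
    by (subst split) (simp only: sum.distrib)
  also have "(\<Sum>x\<in>UNIV. \<Sum>y\<in>UNIV. of_bool (x < y) * \<kappa> x y) = ?L" by (rule sum.swap)
  also have "(\<Sum>x\<in>UNIV. \<Sum>y\<in>UNIV. of_bool (y = x) * \<kappa> x x) = (\<Sum>x\<in>UNIV. \<kappa> x x)"
    by (rule sum.cong) (simp_all add: of_bool_def if_distrib[of "\<lambda>x. x * _"] cong: if_cong)
  also have "(\<Sum>x\<in>UNIV. \<kappa> x x) = - int (card {x. r \<le> 2 * \<beta> x})"
  proof -
    have "(\<Sum>x\<in>UNIV. \<kappa> x x) = (\<Sum>x\<in>UNIV. - of_bool (r \<le> 2 * \<beta> x))"
      unfolding \<kappa>_def by (intro sum.cong refl kappa_diag \<beta>_less)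
    then show ?thesis by (simp add: sum_negf of_bool_def sum.If_cases)
  qed
  also have "(\<Sum>x\<in>UNIV. \<Sum>y\<in>UNIV. \<kappa> y x) = int (card {(x, y). \<beta> x < \<beta> y})"
  proof -
    have "(\<Sum>x\<in>UNIV. \<Sum>y\<in>UNIV. \<kappa> y x) = (\<Sum>x\<in>UNIV. \<Sum>y\<in>UNIV. of_bool (\<beta> x < \<beta> y)) - (\<Sum>x\<in>UNIV. excess (J (\<beta> x)) UNIV)"
      unfolding \<kappa>_def excess_def by (simp only: sum_subtractf)
    then show ?thesis by (simp only: excess_UNIV sum_pairs_card sum.neutral_const diff_zero)
  qed
  finally have tot: "int (card {(x, y). \<beta> x < \<beta> y}) = 2 * ?L - int (card {x. r \<le> 2 * \<beta> x})" by simp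
  have "?L = (\<Sum>x\<in>UNIV. \<Sum>y\<in>UNIV. of_bool (y < x) * of_bool (\<beta> x < \<beta> y)) - (\<Sum>x\<in>UNIV. \<Sum>y\<in>UNIV. of_bool (y < x) * gg (\<beta> y) (J (\<beta> x)))"
    unfolding \<kappa>_def by (simp only: right_diff_distrib sum_subtractf)
  also have "(\<Sum>x\<in>UNIV. \<Sum>y\<in>UNIV. of_bool (y < x) * of_bool (\<beta> x < \<beta> y)) = int invs"
  proof -
    have "(\<Sum>x\<in>UNIV. \<Sum>y\<in>UNIV. of_bool (y < x) * of_bool (\<beta> x < \<beta> y)) = (\<Sum>y\<in>UNIV. \<Sum>x\<in>UNIV. of_bool (y < x \<and> \<beta> x < \<beta> y) :: int)"
      by (subst sum.swap) (simp add: of_bool_conj)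
    then show ?thesis by (simp only: sum_pairs_card invs_def)
  qed
  also have "(\<Sum>x\<in>UNIV. \<Sum>y\<in>UNIV. of_bool (y < x) * gg (\<beta> y) (J (\<beta> x))) = (\<Sum>x\<in>UNIV. excess (J (\<beta> x)) {..<x})"
  proof (rule sum.cong[OF refl])
    fix x
    have "(\<Sum>y\<in>UNIV. of_bool (y < x) * gg (\<beta> y) (J (\<beta> x))) = (\<Sum>y\<in>UNIV. if y \<in> {..<x} then gg (\<beta> y) (J (\<beta> x)) else 0)"
      by (rule sum.cong) auto
    then show "(\<Sum>y\<in>UNIV. of_bool (y < x) * gg (\<beta> y) (J (\<beta> x))) = excess (J (\<beta> x)) {..<x}"
      by (simp add: excess_def sum.If_cases lessThan_def)
  qed
  finally show ?thesis using tot by simp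
qed

lemma excess_Suc:
  assumes "2 * j + 2 \<le> r"
  shows "excess (Suc j) S = excess j S + layer j S"
proof -
  have "gg q (Suc j) = gg q j + (of_bool (q = r - 1 - j) - of_bool (q = j))" if "q < r" for q
    using assms that unfolding gg_def by auto
  then have "excess (Suc j) S = (\<Sum>y\<in>S. gg (\<beta> y) j + (of_bool (\<beta> y = r - 1 - j) - of_bool (\<beta> y = j)))"
    unfolding excess_def by (intro sum.cong refl) (simp add: \<beta>_less)
  also have "\<dots> = excess j S + layer j S"
    by (simp add: excess_def layer_def sum.distrib sum_subtractf of_bool_def sum.If_cases Int_def)
  finally show ?thesis .
qed

lemma excess_0: "excess 0 S = 0"
  unfolding excess_def gg_def by (rule sum.neutral) (use \<beta>_less in \<open>auto simp: not_le\<close>)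

lemma excess_layers: "2 * j \<le> r \<Longrightarrow> excess j S = (\<Sum>i<j. layer i S)"
  by (induction j) (auto simp: excess_0 excess_Suc)

lemma J_le: "2 * J p \<le> r"
  by (auto simp: J_def min_def)

definition meets :: bool where
  "meets \<longleftrightarrow> (\<forall>k i. 0 < i \<longrightarrow> i < r \<longrightarrow>
     card {y \<in> ini k. \<beta> y < i} + card {y \<in> ini k. \<beta> y < r - i} \<le> card (ini k :: 'n set))"

lemma excess_nonneg:
  assumes "meets" "j < r"
  shows "0 \<le> excess j (ini k)"
proof (cases "j = 0")
  case False
  have "card (ini k :: 'n set) = card {y \<in> ini k. \<beta> y < r - j} + card {y \<in> ini k. r - j \<le> \<beta> y}"
    by (subst card_Un_disjoint[symmetric]) (auto intro!: arg_cong[of _ _ card])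
  moreover have "card {y \<in> ini k. \<beta> y < j} + card {y \<in> ini k. \<beta> y < r - j} \<le> card (ini k :: 'n set)"
    using assms False unfolding meets_def by blast
  ultimately have le: "card {y \<in> ini k. \<beta> y < j} \<le> card {y \<in> ini k. r - j \<le> \<beta> y}" by linarith
  have "excess j (ini k) = int (card {y \<in> ini k. r \<le> \<beta> y + j}) - int (card {y \<in> ini k. \<beta> y < j})"
    by (simp add: excess_def gg_def sum_subtractf of_bool_def sum.If_cases Int_def)
  moreover have "{y \<in> ini k. r \<le> \<beta> y + j} = {y \<in> ini k. r - j \<le> \<beta> y}" using assms(2) by auto
  ultimately show ?thesis using le by simp
qed (simp add: excess_0)

definition contracted :: bool where
  "contracted \<longleftrightarrow> (\<forall>x j. j < J (\<beta> x) \<longrightarrow> layer j {..<x} = 0)"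

lemma contracted_excess: "contracted \<Longrightarrow> excess (J (\<beta> x)) {..<x} = 0"
  unfolding excess_layers[OF J_le] contracted_def by simp

text \<open>A vanishing excess is a vanishing sum of layers, so it suffices that layers are
  nonnegative on initial segments. Layer \<open>j\<close> can only drop when a value of the left
  block \<open>j\<close> is added; at that moment the excess for \<open>j\<close> is 0 and the
  excess for \<open>Suc j\<close> is nonnegative, and their difference is the layer.\<close>

lemma excess_zero_contracted:
  assumes meets and zero: "\<And>x. excess (J (\<beta> x)) {..<x} = 0"
  shows contracted
proof -
  have nonneg: "\<forall>j. 2 * j + 2 \<le> r \<longrightarrow> 0 \<le> layer j (ini k)" for k
  proof (induction k)
    case 0
    then show ?case by (simp add: layer_def)
  next
    case (Suc k)
    show ?case
    proof (cases "k < CARD('n)")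
      case False
      then have "ini (Suc k) = (UNIV :: 'n set)" "ini k = (UNIV :: 'n set)" by auto
      then show ?thesis using Suc by simp
    next
      case True
      then obtain x :: 'n where x: "pos x = k" using pos_surj by blast
      have ini: "ini (Suc k) = insert x (ini k)" "x \<notin> ini k" unfolding x[symmetric] ini_Suc by auto
      show ?thesis
      proof (intro allI impI)
        fix j assume j: "2 * j + 2 \<le> r"
        show "0 \<le> layer j (ini (Suc k))"
        proof (cases "\<beta> x = j")
          case False
          have "{y \<in> ini (Suc k). \<beta> y = j} = {y \<in> ini k. \<beta> y = j}" using False ini by auto
          moreover have "card {y \<in> ini k. \<beta> y = r - 1 - j} \<le> card {y \<in> ini (Suc k). \<beta> y = r - 1 - j}"
            by (rule card_mono) (use ini in auto)
          ultimately show ?thesis using Suc j unfolding layer_def by fastforce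
        next
          case True
          have "J (\<beta> x) = j" using True j by (simp add: J_def)
          then have "excess j (ini k) = 0" using zero[of x] unfolding lessThan_eq_ini x by simp
          moreover have "excess j (ini (Suc k)) = excess j (ini k)"
            using True j ini by (simp add: excess_def gg_def)
          moreover have "0 \<le> excess (Suc j) (ini (Suc k))"
            by (rule excess_nonneg) (use assms j in auto)
          ultimately show ?thesis using excess_Suc[OF j] by simp
        qed
      qed
    qed
  qed
  show contracted
    unfolding contracted_def
  proof (intro allI impI)
    fix x j assume j: "j < J (\<beta> x)"
    have "(\<Sum>i<J (\<beta> x). layer i {..<x}) = 0" using zero[of x] unfolding excess_layers[OF J_le] .
    moreover have "0 \<le> layer i {..<x}" if "i < J (\<beta> x)" for i
      using nonneg[of "pos x"] that J_le[of "\<beta> x"] unfolding lessThan_eq_ini by simp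
    ultimately show "layer j {..<x} = 0"
      using sum_nonneg_eq_0_iff[of "{..<J (\<beta> x)}" "\<lambda>i. layer i {..<x}"] j by auto
  qed
qed

lemma contracted_invs:
  assumes contracted
  shows "2 * invs = card {(x, y). \<beta> x < \<beta> y} + card {x. r \<le> 2 * \<beta> x}"
proof -
  have "2 * int invs = int (card {(x, y). \<beta> x < \<beta> y}) + int (card {x. r \<le> 2 * \<beta> x})"
    using invs_excess contracted_excess[OF assms] by simp
  then show ?thesis by linarith
qed

lemma invs_contracted:
  assumes meets "2 * invs = card {(x, y). \<beta> x < \<beta> y} + card {x. r \<le> 2 * \<beta> x}"
  shows contracted
proof -
  have "2 * int invs = int (card {(x, y). \<beta> x < \<beta> y}) + int (card {x. r \<le> 2 * \<beta> x})"
    using assms(2) by linarith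
  then have "(\<Sum>x\<in>UNIV. excess (J (\<beta> x)) {..<x}) = 0"
    using invs_excess by simp
  moreover have "0 \<le> excess (J (\<beta> x)) {..<x}" for x
    unfolding lessThan_eq_ini
    by (rule excess_nonneg[OF assms(1)]) (use \<beta>_less[of x] in \<open>auto simp: J_def min_def\<close>)
  ultimately have "excess (J (\<beta> x)) {..<x} = 0" for x
    using sum_nonneg_eq_0_iff[of UNIV "\<lambda>x. excess (J (\<beta> x)) {..<x}"] by simp
  then show contracted by (rule excess_zero_contracted[OF assms(1)])
qed

definition stage :: "nat \<Rightarrow> bool" where
  "stage j \<longleftrightarrow> (\<exists>prs :: ('n \<times> 'n) set. card prs = card {x. \<beta> x = j} \<and>
     (\<forall>(l, k) \<in> prs. immediate_left {x. j \<le> \<beta> x \<and> \<beta> x + j < r} l k) \<and>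
     pairwise (\<lambda>(l, k) (l', k'). disjnt {l, k} {l', k'}) prs \<and>
     {x. \<beta> x = j} = snd ` prs \<and> {x. \<beta> x = r - 1 - j} = fst ` prs)"

lemma card_mirror: "j < r \<Longrightarrow> card {x. \<beta> x = r - 1 - j} = card {x. \<beta> x = j}"
proof -
  assume "j < r"
  then have "\<beta> x = r - 1 - j \<longleftrightarrow> \<beta> (\<tau> x) = j" for x
    using \<beta>_less[of x] unfolding \<beta>_\<tau> by linarith
  then have "{x. \<beta> x = r - 1 - j} = \<tau> -` {x. \<beta> x = j}" by auto
  moreover have "card (\<tau> -` {x. \<beta> x = j}) = card (\<tau> ` (\<tau> -` {x. \<beta> x = j}))"
    by (rule card_image[symmetric]) (use \<tau> in \<open>auto simp: bij_def intro: inj_on_subset\<close>)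
  moreover have "\<tau> ` (\<tau> -` {x. \<beta> x = j}) = {x. \<beta> x = j}"
    by (rule surj_image_vimage_eq[OF bij_is_surj[OF \<tau>]])
  ultimately show ?thesis by simp
qed

lemma stage_iff:
  assumes j: "2 * j + 2 \<le> r"
  shows "stage j \<longleftrightarrow> (\<forall>x. j < J (\<beta> x) \<longrightarrow> layer j {..<x} = 0)"
proof -
  let ?R = "{x. j \<le> \<beta> x \<and> \<beta> x + j < r}" and ?A = "{x. \<beta> x = j}" and ?B = "{x. \<beta> x = r - 1 - j}"
  have mem: "j < J (\<beta> x) \<longleftrightarrow> x \<in> ?R \<and> x \<notin> ?A" for x
    using \<beta>_less[of x] by (auto simp: J_def)
  have lay: "layer j {..<x} = 0 \<longleftrightarrow> card (?B \<inter> {..<x}) = card (?A \<inter> {..<x})" for x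
    by (simp add: layer_def Int_def conj_commute)
  show ?thesis
  proof
    assume "stage j"
    then obtain prs :: "('n \<times> 'n) set" where prs: "\<forall>(l, k) \<in> prs. immediate_left ?R l k"
      "pairwise (\<lambda>(l, k) (l', k'). disjnt {l, k} {l', k'}) prs" "?A = snd ` prs" "?B = fst ` prs"
      unfolding stage_def by blast
    show "\<forall>x. j < J (\<beta> x) \<longrightarrow> layer j {..<x} = 0"
      unfolding mem lay using balanced_of_pairs[OF prs] by blast
  next
    assume "\<forall>x. j < J (\<beta> x) \<longrightarrow> layer j {..<x} = 0"
    then have bal: "card (?B \<inter> {..<x}) = card (?A \<inter> {..<x})" if "x \<in> ?R" "x \<notin> ?A" for x
      using that unfolding mem lay by blast
    have c: "card ?A = card ?B" using card_mirror[of j] j by simp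
    have "\<exists>prs. card prs = card ?B \<and> (\<forall>(l, k) \<in> prs. immediate_left ?R l k) \<and>
        pairwise (\<lambda>(l, k) (l', k'). disjnt {l, k} {l', k'}) prs \<and> ?A = snd ` prs \<and> ?B = fst ` prs"
      by (rule pairs_of_balanced[OF _ _ _ c bal]) (use j in auto)
    then show "stage j" unfolding stage_def c .
  qed
qed

lemma contracted_iff_stages: "contracted \<longleftrightarrow> (\<forall>j. 2 * j + 2 \<le> r \<longrightarrow> stage j)"
proof -
  have "2 * j + 2 \<le> r" if "j < J p" for j p
    using that J_le[of p] by linarith
  then show ?thesis unfolding contracted_def using stage_iff by blast
qed

end

section \<open>The dimension of the base cycle and its intersection with Schubert cells\<close>

lemma mat_mult_nth: "(mat c ** A) $ i $ j = c * A $ i $ j" for A :: "complex^'n^'m"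
  by (simp add: matrix_matrix_mult_def mat_def if_distrib[of "\<lambda>x. x * _"] cong: if_cong)

lemma mult_mat_nth: "(A ** mat c) $ i $ j = c * A $ i $ j" for A :: "complex^'n^'m"
  by (simp add: matrix_matrix_mult_def mat_def if_distrib[of "\<lambda>x. _ * x"] mult.commute cong: if_cong)

lemma mat_commute: "mat c ** A = A ** mat c" for A :: "complex^'n^'n"
  by (simp add: vec_eq_iff mat_mult_nth mult_mat_nth)

context sym_seq
begin

text \<open>One representative from each two-element orbit of the reflection
  \<open>(p, c) \<mapsto> (rv c, rv p)\<close> of \<open>Low\<close>.\<close>

definition half :: "('n \<times> 'n) set" where
  "half = {(p, c) \<in> Low. rv p < c}"

text \<open>The bilinear relations between the columns, linearized at an isotropic basis whose Gram
  matrix pairs \<open>a\<close> with \<open>rv a\<close>.\<close>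

definition tanC :: "(complex^('n \<times> 'n)) set" where
  "tanC = {X \<in> crd Low. \<forall>a b. X $ (rv a, b) + X $ (rv b, a) = 0}"

lemma Low_mirror: "(rv a, b) \<in> Low \<longleftrightarrow> bi a + bi b + 2 \<le> r"
  using bi_add_bi_rv[of a] by (auto simp: Low_def)

lemma Low_iff: "(p, c) \<in> Low \<longleftrightarrow> bi (rv p) + bi c + 2 \<le> r"
  using Low_mirror[of "rv p" c] by simp

lemma dim_tanC: "vec.dim tanC = card half"
proof -
  define L where "L Y = (\<chi> k. if rv (fst k) < snd k then Y $ k
      else if snd k < rv (fst k) then - Y $ (rv (snd k), rv (fst k)) else 0)" for Y :: "complex^('n \<times> 'n)"
  have L: "Vector_Spaces.linear (*s) (*s) L"
    unfolding Vector_Spaces.linear_iff by (auto simp: L_def vec_eq_iff intro: vec.vector_space_axioms)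
  have "L ` crd half = tanC"
  proof (intro subset_antisym subsetI)
    fix X assume "X \<in> L ` crd half"
    then obtain Y where Y: "Y \<in> crd half" "X = L Y" by blast
    have "X $ (p, c) = 0" if "(p, c) \<notin> Low" for p c
    proof -
      have "(p, c) \<notin> half" "(rv c, rv p) \<notin> half" using that by (auto simp: half_def Low_iff add.commute)
      then show ?thesis using Y by (simp add: L_def crd_def)
    qed
    then have "X \<in> crd Low" by (auto simp: crd_def)
    moreover have "X $ (rv a, b) + X $ (rv b, a) = 0" for a b
      unfolding Y(2) L_def by (cases a b rule: linorder_cases) auto
    ultimately show "X \<in> tanC" by (simp add: tanC_def)
  next
    fix X assume X: "X \<in> tanC"
    let ?Y = "\<chi> k. if k \<in> half then X $ k else 0"
    have "X $ (p, c) = L ?Y $ (p, c)" for p c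
    proof (cases "rv p" c rule: linorder_cases)
      case less
      then show ?thesis using X by (auto simp: L_def half_def tanC_def crd_def)
    next
      case equal
      then have "X $ (rv c, c) + X $ (rv c, c) = 0" "p = rv c" using X by (auto simp: tanC_def)
      then show ?thesis using equal by (simp add: L_def)
    next
      case greater
      have "X $ (rv (rv p), c) + X $ (rv c, rv p) = 0" using X unfolding tanC_def by blast
      then have "X $ (p, c) = - X $ (rv c, rv p)" by (simp add: eq_neg_iff_add_eq_0)
      moreover have "X $ (rv c, rv p) = 0" if "(rv c, rv p) \<notin> Low"
        using X that by (simp add: tanC_def crd_def)
      ultimately show ?thesis using greater by (auto simp: L_def half_def)
    qed
    then have "X = L ?Y" by (simp add: vec_eq_iff)
    moreover have "?Y \<in> crd half" by (simp add: crd_def)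
    ultimately show "X \<in> L ` crd half" by blast
  qed
  moreover have "inj_on L (vec.span (crd half))"
  proof (rule inj_onI)
    fix X Y assume "X \<in> vec.span (crd half)" "Y \<in> vec.span (crd half)" and eq: "L X = L Y"
    then have XY: "X \<in> crd half" "Y \<in> crd half"
      using vec.span_eq_iff[THEN iffD2, OF subspace_crd, of half] by auto
    have "X $ (p, c) = Y $ (p, c)" for p c
    proof (cases "rv p < c")
      case True
      then have "L X $ (p, c) = X $ (p, c)" "L Y $ (p, c) = Y $ (p, c)" by (simp_all add: L_def)
      with eq show ?thesis by simp
    qed (use XY in \<open>auto simp: crd_def half_def\<close>)
    then show "X = Y" by (simp add: vec_eq_iff)
  qed
  ultimately show ?thesis
    using vec.dim_image_eq[OF L, of "crd half"] by simp
qed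

text \<open>The reflection exchanges \<open>half\<close> with its opposite and fixes the pairs
  \<open>(a, rv a)\<close>, which lie in \<open>Low\<close> for \<open>a\<close> in a block of the
  second half.\<close>

lemma card_Low: "card Low = 2 * card half + card {a. r \<le> 2 * bi a}"
proof -
  let ?f = "\<lambda>(p, c). (rv c, rv p)"
  let ?H = "{(p, c) \<in> Low. c < rv p}" and ?D = "{(p, c) \<in> Low. c = rv p}"
  have H: "?H = ?f ` half"
  proof (intro subset_antisym subsetI)
    fix k assume "k \<in> ?H"
    then have "?f k \<in> half" "k = ?f (?f k)" by (auto simp: half_def Low_iff add.commute)
    then show "k \<in> ?f ` half" by blast
  qed (auto simp: half_def Low_iff add.commute)
  have cH: "card ?H = card half"
    unfolding H by (rule card_image) (auto simp: inj_on_def)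
  have D: "?D = (\<lambda>a. (a, rv a)) ` {a. r \<le> 2 * bi a}"
  proof -
    have "(a, rv a) \<in> Low \<longleftrightarrow> r \<le> 2 * bi a" for a
      using bi_add_bi_rv[of a] bi_props(1)[of a] by (auto simp: Low_def)
    then show ?thesis by auto
  qed
  have cD: "card ?D = card {a. r \<le> 2 * bi a}"
    unfolding D by (rule card_image) (auto simp: inj_on_def)
  have "Low = half \<union> (?H \<union> ?D)" by (auto simp: half_def)
  then have "card Low = card (half \<union> (?H \<union> ?D))" by simp
  also have "\<dots> = card half + card (?H \<union> ?D)"
    by (rule card_Un_disjoint) (auto simp: half_def)
  also have "card (?H \<union> ?D) = card ?H + card ?D"
    by (rule card_Un_disjoint) auto
  finally show ?thesis using cH cD by simp
qed

lemma isotropic_columns: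
  assumes A: "invertible A" and iso: "isotropic (act A bf)" and ab: "(rv a, b) \<in> Low"
  shows "(\<Sum>p\<in>UNIV. A $ p $ a * A $ p $ b) = 0"
proof -
  let ?j = "r - 2 - bi a"
  have ij: "bi a + ?j + 2 = r" "bi b \<le> ?j" using ab unfolding Low_mirror by linarith+
  then have "A *v axis a 1 \<in> act A bf ! bi a" "A *v axis b 1 \<in> act A bf ! ?j"
    by (simp_all add: nth_act_bf del: nth_act)
  then have "hm (A *v axis a 1) (cj (A *v axis b 1)) = 0"
    using iso ij unfolding isotropic_def by blast
  then show ?thesis by (simp add: hm_def)
qed

lemma transpose_mult_isotropic:
  assumes "adj g ** g = mat 1" "\<And>a. cj (column a g) = column (rv a) g"
  shows "(transpose g ** g) $ a $ b = (if rv a = b then 1 else 0)"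
    "(adj g ** cm g) $ a $ b = (if rv a = b then 1 else 0)"
proof -
  have c: "cnj (g $ p $ a) = g $ p $ rv a" for p a
    using assms(2)[of a] by (simp add: vec_eq_iff column_def)
  have 1: "(adj g ** g) $ rv a $ b = (if rv a = b then 1 else 0)" for a b
    by (simp add: assms(1)) (simp add: mat_def)
  have t: "(transpose g ** g) $ a $ b = (adj g ** g) $ rv a $ b" for a b
    by (simp add: matrix_matrix_mult_def transpose_def c)
  show 2: "(transpose g ** g) $ a $ b = (if rv a = b then 1 else 0)" for a b
    unfolding t by (rule 1)
  have "(adj g ** cm g) $ a $ b = cnj ((transpose g ** g) $ a $ b)"
    by (simp add: matrix_matrix_mult_def transpose_def)
  then show "(adj g ** cm g) $ a $ b = (if rv a = b then 1 else 0)" by (simp add: 2)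
qed

text \<open>One inclusion differentiates the isotropy relations along a curve in the orbit; the
  other realizes each solution of the linear equations by a complex antisymmetric matrix through
  \<open>tangent_antisym\<close>.\<close>

lemma tangent_base_cycle:
  assumes sub: "complex_submanifold dims d (orbit SO_R F0)" and CF: "orbit SO_R F0 \<subseteq> flags dims"
    and iso: "\<And>F. F \<in> orbit SO_R F0 \<Longrightarrow> isotropic F" and F: "F \<in> orbit SO_R F0"
  shows "d = card half"
proof -
  let ?C = "orbit SO_R F0"
  obtain k where k: "cm k = k" "adj k ** k = mat 1" "F = act (k ** sg) bf"
    using isotropic_orbit CF iso F by blast
  define g0 where "g0 = k ** sg"
  have un: "adj g0 ** g0 = mat 1"
  proof -
    have "adj g0 ** g0 = adj sg ** (adj k ** k) ** sg" by (simp add: g0_def adj_mult matrix_mul_assoc)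
    then show ?thesis by (simp add: k(2) sg_unitary)
  qed
  have cg: "cj (column a g0) = column (rv a) g0" for a
    by (simp only: g0_def column_mult cj_mult_cm k(1) cj_column_sg)
  obtain c where c: "c \<noteq> 0" "mat c ** g0 \<in> SL_C" "act (mat c ** g0) bf = act g0 bf"
    using scalar_to_SL[OF unitary_invertible[OF un]] bf_flags by blast
  \<comment> \<open>The centre of the chart is unitary up to a scalar; the bilinear relations only
    acquire the nonzero factor \<open>c * c\<close>.\<close>
  define g where "g = mat c ** g0"
  have g: "g \<in> SL_C" "act g bf \<in> ?C" using c k F by (simp_all add: g_def g0_def)
  have gi: "invertible g" by (rule SL_C_invertible[OF g(1)])
  have gn: "g $ p $ a = c * g0 $ p $ a" for p a by (simp add: g_def mat_mult_nth)
  have "tg g ?C = tanC"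
  proof (intro subset_antisym subsetI)
    fix v assume "v \<in> tg g ?C"
    then obtain c' where c': "c' 0 = 0" "\<forall>\<^sub>F t in at 0. c' t \<in> {X \<in> crd Low. chart_param dims g X \<in> ?C}"
      "(c' has_vector_derivative v) (at 0)" by (auto simp: tg_def tang_def)
    define A where "A t = g ** lo (c' t)" for t
    define K where "K = g ** (\<chi> i j. v $ (i, j))"
    have vLow: "v \<in> crd Low"
    proof (rule curve_derivative_in_subspace[OF c'(3)])
      show "\<forall>\<^sub>F t in at 0. c' t \<in> crd Low" using c'(2) by eventually_elim simp
    qed (use c'(1) in \<open>auto simp: vec.subspace_0 intro: real_subspace closed_csubspace\<close>)
    have "((\<lambda>t. \<chi> i j. c' t $ (i, j)) has_vector_derivative (\<chi> i j. v $ (i, j))) (at 0)"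
      by (rule bounded_linear.has_vector_derivative[OF bounded_linear_vmat c'(3)])
    then have "((\<lambda>t. lo (c' t)) has_vector_derivative (\<chi> i j. v $ (i, j))) (at 0)"
      unfolding lo_def by (auto intro!: derivative_eq_intros)
    then have A: "(A has_vector_derivative K) (at 0)"
      unfolding A_def K_def by (rule bounded_linear.has_vector_derivative[OF mm.bounded_linear_right])
    have An: "((\<lambda>t. A t $ p $ a) has_vector_derivative K $ p $ a) (at 0)" for p a
      by (rule bounded_linear.has_vector_derivative[OF bounded_linear_vec_nth bounded_linear.has_vector_derivative[OF bounded_linear_vec_nth A]])
    have A0: "A 0 = g" by (simp add: A_def c')
    have "v $ (rv a, b) + v $ (rv b, a) = 0" for a b
    proof (cases "(rv a, b) \<in> Low")
      case False
      then have "(rv b, a) \<notin> Low" by (simp add: Low_mirror add.commute)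
      then show ?thesis using False vLow by (simp add: crd_def)
    next
      case True
      let ?f = "\<lambda>t. \<Sum>p\<in>UNIV. A t $ p $ a * A t $ p $ b"
      have "(?f has_vector_derivative (\<Sum>p\<in>UNIV. A 0 $ p $ a * K $ p $ b + K $ p $ a * A 0 $ p $ b)) (at 0)"
        by (intro has_vector_derivative_sum has_vector_derivative_mult An)
      moreover have "(?f has_vector_derivative 0) (at 0)"
      proof (rule has_vector_derivative_eventually[of "\<lambda>_. 0"])
        show "\<forall>\<^sub>F t in at 0. 0 = ?f t"
          using c'(2)
        proof eventually_elim
          case (elim t)
          then have "invertible (A t)" "isotropic (act (A t) bf)"
            using iso by (simp_all add: A_def chart_param_eq SL_C_invertible SL_C_mult[OF g(1)] lo_SL)
          then show ?case using isotropic_columns[OF _ _ True, of "A t"] by simp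
        qed
        show "0 = ?f 0" using isotropic_columns[OF gi iso[OF g(2)] True] by (simp add: A0)
      qed simp
      ultimately have "(\<Sum>p\<in>UNIV. g $ p $ a * K $ p $ b + K $ p $ a * g $ p $ b) = 0"
        unfolding A0 by (rule vector_derivative_unique_at)
      then have s: "(transpose g ** K) $ a $ b + (transpose g ** K) $ b $ a = 0"
        by (simp add: matrix_matrix_mult_def transpose_def sum.distrib mult.commute)
      have tg: "(transpose g ** K) $ a $ b = c * c * v $ (rv a, b)" for a b
      proof -
        have tgg: "(transpose g ** g) $ a $ b = c * c * (transpose g0 ** g0) $ a $ b" for a b
          by (simp add: matrix_matrix_mult_def transpose_def gn sum_distrib_left mult_ac)
        have "(transpose g ** K) $ a $ b = ((transpose g ** g) ** (\<chi> i j. v $ (i, j))) $ a $ b"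
          by (simp add: K_def matrix_mul_assoc)
        also have "\<dots> = (\<Sum>q\<in>UNIV. (transpose g ** g) $ a $ q * v $ (q, b))"
          by (simp only: matrix_matrix_mult_def[of "transpose g ** g"] vec_lambda_beta)
        also have "\<dots> = (\<Sum>q\<in>UNIV. if rv a = q then c * c * v $ (q, b) else 0)"
          unfolding tgg transpose_mult_isotropic(1)[OF un cg] by (intro sum.cong) auto
        finally show ?thesis by simp
      qed
      show ?thesis using s c(1) unfolding tg by (simp flip: distrib_left)
    qed
    then show "v \<in> tanC" using vLow by (simp add: tanC_def)
  next
    fix X assume X: "X \<in> tanC"
    define S :: "'n cmat" where "S = (\<chi> a b. X $ (rv a, b))"
    \<comment> \<open>The product \<open>adj g0 ** cm g0\<close> is the matrix of the order
      reversal. It turns \<open>S\<close> back into the matrix of \<open>X\<close>, so the conjugate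
      of \<open>Z\<close> by \<open>g\<close> has lower part \<open>X\<close>.\<close>
    define Z where "Z = cm g0 ** S ** adj g0"
    have "transpose S = - S"
      using X by (simp add: S_def tanC_def vec_eq_iff transpose_def eq_neg_iff_add_eq_0)
    moreover have "transpose (cm g0) = adj g0" "transpose (adj g0) = cm g0"
      by (simp_all add: vec_eq_iff transpose_def)
    ultimately have Zt: "transpose Z = - Z"
      by (simp add: Z_def matrix_transpose_mul mm.minus_left mm.minus_right matrix_mul_assoc)
    have "matrix_inv g ** Z ** g = adj g0 ** Z ** g0"
    proof -
      have "g ** (adj g0 ** Z ** g0) = mat c ** (g0 ** adj g0) ** Z ** g0"
        by (simp add: g_def matrix_mul_assoc)
      also have "\<dots> = Z ** g" by (simp add: adj_inverse(1)[OF un] g_def mat_commute[of c Z] matrix_mul_assoc)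
      finally have eq: "g ** (adj g0 ** Z ** g0) = Z ** g" .
      have "matrix_inv g ** (g ** (adj g0 ** Z ** g0)) = matrix_inv g ** (Z ** g)"
        by (simp only: eq)
      then show ?thesis by (simp add: matrix_mul_assoc matrix_inv_left[OF gi])
    qed
    also have "\<dots> = (adj g0 ** cm g0) ** S ** (adj g0 ** g0)" by (simp add: Z_def matrix_mul_assoc)
    also have "\<dots> = (adj g0 ** cm g0) ** S" by (simp add: un)
    also have "\<dots> = (\<chi> a b. X $ (a, b))"
    proof -
      have "((adj g0 ** cm g0) ** S) $ a $ b = X $ (a, b)" for a b
      proof -
        have "((adj g0 ** cm g0) ** S) $ a $ b = (\<Sum>q\<in>UNIV. (if rv a = q then 1 else 0) * S $ q $ b)"
          unfolding transpose_mult_isotropic(2)[OF un cg, symmetric]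
          by (simp only: matrix_matrix_mult_def[of "adj g0 ** cm g0"] vec_lambda_beta)
        then show ?thesis by (simp add: S_def if_distrib[of "\<lambda>x. x * _"] cong: if_cong)
      qed
      then show ?thesis by (simp add: vec_eq_iff)
    qed
    finally have "lowp (matrix_inv g ** Z ** g) = X"
      using X by (auto simp: lowp_def vec_eq_iff tanC_def crd_def)
    then show "X \<in> tg g ?C" using tangent_antisym[OF g sub Zt] by simp
  qed
  then show ?thesis using tg_subspace(2)[OF sub g] dim_tanC by simp
qed

lemma complex_dim_base_cycle:
  fixes D C :: "'n flag set"
  assumes D: "open_orbit dims D" and C: "base_cycle dims D C"
  shows "complex_dim dims C = card half"
proof -
  obtain F0 d where F0: "C = orbit SO_R F0" "complex_submanifold dims d C" "F0 \<in> D"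
    using C by (auto simp: base_cycle_def)
  have fl: "C \<subseteq> flags dims" using base_cycle_isotropic(2)[OF D C] by blast
  have ne: "F0 \<in> C" unfolding F0(1) orbit_def
    by (rule image_eqI[of _ _ "mat 1"]) (simp_all add: SO_R_iff)
  have "d = card half"
    by (rule tangent_base_cycle[of d F0 F0]) (use F0 fl ne base_cycle_isotropic(1)[OF D C] in auto)
  moreover have "complex_dim dims C = d"
  proof (rule complex_dim_eqI[OF _ fl _ _ F0(2)])
    show "openin (subtopology (flag_top dims) C) C"
      using openin_topspace[of "subtopology (flag_top dims) C"] fl by (simp add: inf.absorb2)
    show "C \<subseteq> flag_top dims closure_of C" by (rule closure_of_subset) (simp add: fl)
  qed (use ne in blast)
  ultimately show ?thesis by simp
qed

text \<open>The coordinate space is stable under conjugation. It contains the first intersection and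
  the conjugate of the second, which meet only in 0 by isotropy.\<close>

lemma meets_of_isotropic:
  assumes F: "F \<in> flags dims" "isotropic F" and i: "0 < i" "i < r"
  shows "vec.dim (F ! (i - 1) \<inter> crd (ini k)) + vec.dim (F ! (r - i - 1) \<inter> crd (ini k)) \<le> card (ini k :: 'n set)"
proof -
  let ?E = "crd (ini k :: 'n set)"
  let ?A = "F ! (i - 1) \<inter> ?E" and ?B = "F ! (r - i - 1) \<inter> ?E"
  have A: "vec.subspace ?A" and B: "vec.subspace ?B"
    using i by (auto intro!: vec.subspace_inter flags_subspace[OF F(1)])
  have cB: "vec.subspace (cj ` ?B)" by (rule subspace_cj[OF B])
  have "x = 0" if "x \<in> ?A \<inter> cj ` ?B" for x
  proof -
    have "(i - 1) + (r - i - 1) + 2 = r" using i by linarith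
    moreover from that obtain y where "y \<in> F ! (r - i - 1)" "x = cj y" "x \<in> F ! (i - 1)" by blast
    ultimately have "hm x x = 0" using F(2) unfolding isotropic_def by metis
    then show ?thesis by simp
  qed
  then have "?A \<inter> cj ` ?B \<subseteq> {0}" by blast
  then have 0: "vec.dim (?A \<inter> cj ` ?B) = 0" unfolding vec.dim_eq_0 .
  have "cj y \<in> ?E" if "y \<in> ?E" for y using that by (auto simp: crd_def)
  then have "{x + y |x y. x \<in> ?A \<and> y \<in> cj ` ?B} \<subseteq> ?E"
    using vec.subspace_add[OF subspace_crd] by blast
  then have "vec.dim {x + y |x y. x \<in> ?A \<and> y \<in> cj ` ?B} \<le> vec.dim ?E" by (rule vec.dim_subset)
  then show ?thesis
    using vec.dim_sums_Int[OF A cB] 0 dim_cj[OF B] unfolding dim_crd by linarith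
qed

text \<open>The columns of the permutation matrix of \<open>v\<close> are corrected by a unipotent upper triangular
  matrix to the isotropic basis, because each correction term \<open>axis (v (rv a)) 1\<close> precedes
  \<open>axis (v a) 1\<close>. Changing the sign of one vector adjusts the determinant.\<close>

lemma cell_meets_orbit:
  fixes v :: "'n \<Rightarrow> 'n"
  assumes v: "bij v" "\<And>a. a < rv a \<Longrightarrow> v (rv a) < v a" and n: "2 \<le> CARD('n)"
    and F0: "F0 \<in> flags dims" "isotropic F0"
  shows "\<exists>b\<in>Borel. act b (act (perm_mat v) bf) \<in> orbit SO_R F0"
proof -
  obtain k where k: "cm k = k" "adj k ** k = mat 1" "F0 = act (k ** sg) bf"
    using isotropic_orbit[OF F0] by blast
  let ?P = "perm_mat v :: 'n cmat"
  define sc :: "('n \<Rightarrow> real) \<Rightarrow> 'n cmat" where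
    "sc \<epsilon> = (\<chi> p a. if p = v a then of_real (\<epsilon> a) else 0)" for \<epsilon>
  have sc_col: "column a (sc \<epsilon>) = of_real (\<epsilon> a) *s axis (v a) 1" for a \<epsilon>
    by (simp add: vec_eq_iff column_def sc_def axis_def)
  have sc_cm: "cm (sc \<epsilon>) = sc \<epsilon>" for \<epsilon> by (simp add: vec_eq_iff sc_def)
  have sc_un: "adj (sc \<epsilon>) ** sc \<epsilon> = mat 1" if "\<And>a. \<epsilon> a * \<epsilon> a = 1" for \<epsilon>
  proof -
    have "complex_of_real (\<epsilon> a) * complex_of_real (\<epsilon> a) = 1" for a using that[of a] by (metis of_real_1 of_real_mult)
    then show ?thesis using v(1)
      by (auto simp: vec_eq_iff adj_mult_nth sc_col hm_scale_left hm_scale_right hm_axis mat_def bij_is_inj inj_eq)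
  qed
  obtain z :: 'n where z: "pos z = 0" using pos_surj[of 0] n by auto
  \<comment> \<open>Flipping the sign at the single index \<open>z\<close> reverses the determinant,
    so one of the two choices brings the product with \<open>adj k\<close> into
    \<open>SO_R\<close>.\<close>
  let ?e = "\<lambda>\<sigma> a. if a = z then \<sigma> else 1 :: real"
  have ee: "?e \<sigma> a * ?e \<sigma> a = 1" if "\<sigma> = 1 \<or> \<sigma> = - 1" for \<sigma> a using that by auto
  have det_sc: "det (sc (?e (- 1))) = - det (sc (?e 1))"
  proof -
    have "sc (?e (- 1)) = sc (?e 1) ** (\<chi> i j. if i = j then if i = z then - 1 else 1 else 0)"
      by (auto simp: vec_eq_iff sc_def matrix_matrix_mult_def if_distrib[of "\<lambda>x. _ * x"] cong: if_cong)
    moreover have "det ((\<chi> i j. if i = j then if i = z then - 1 else 1 else 0) :: 'n cmat) = - 1"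
      by (subst det_lower_triangular) auto
    ultimately show ?thesis by (simp add: det_mul)
  qed
  have real_det: "det A = 1 \<or> det A = - 1" if "cm A = A" "adj A ** A = mat 1" for A :: "'n cmat"
  proof -
    have "det (transpose A ** A) = 1" using that adj_real[OF that(1)] by simp
    then show ?thesis by (simp add: det_mul det_transpose square_eq_1_iff)
  qed
  have adk: "cm (adj k) = adj k" "adj (adj k) ** adj k = mat 1"
    using k adj_inverse(1)[OF k(2)] by (simp_all add: cm_adj)
  have "det (sc (?e 1)) = 1 \<or> det (sc (?e 1)) = - 1"
    by (rule real_det[OF sc_cm sc_un]) (rule ee, simp)
  then have "det (sc (?e 1) ** adj k) = 1 \<or> det (sc (?e (- 1)) ** adj k) = 1"
    using real_det[OF adk] unfolding det_mul det_sc by auto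
  then obtain \<sigma> :: real where \<sigma>: "\<sigma> = 1 \<or> \<sigma> = - 1" "det (sc (?e \<sigma>) ** adj k) = 1"
    by blast
  define \<epsilon> where "\<epsilon> = ?e \<sigma>"
  have \<epsilon>: "\<epsilon> a * \<epsilon> a = 1" for a unfolding \<epsilon>_def by (rule ee[OF \<sigma>(1)])
  define Q where "Q = sc \<epsilon>"
  have Qk: "Q ** adj k \<in> SO_R"
  proof -
    have "adj (Q ** adj k) ** (Q ** adj k) = k ** (adj Q ** Q) ** adj k"
      by (simp add: adj_mult matrix_mul_assoc)
    then have "adj (Q ** adj k) ** (Q ** adj k) = mat 1"
      using sc_un[OF \<epsilon>] adj_inverse(1)[OF k(2)] by (simp add: Q_def)
    then show ?thesis using \<sigma>(2) sc_cm by (simp add: SO_R_iff cm_mult adk Q_def \<epsilon>_def)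
  qed
  have "act (Q ** adj k) F0 = act (Q ** (adj k ** k) ** sg) bf"
    by (simp only: k(3) act_act matrix_mul_assoc)
  then have orb: "act (Q ** sg) bf \<in> orbit SO_R F0"
    using Qk by (auto simp: orbit_def k(2) intro: rev_image_eqI)
  \<comment> \<open>The relative sign of a mirror pair; with it, column \<open>a\<close> of the
    corrected permutation matrix is proportional to the isotropic column for \<open>a\<close> in the
    first half.\<close>
  define \<eta> where "\<eta> a = \<epsilon> a * \<epsilon> (rv a)" for a
  define b where "b = (\<chi> p q. if p = q then 1 else if inv v q < rv (inv v q) \<and> p = v (rv (inv v q))
      then - \<i> * of_real (\<eta> (inv v q)) else 0)"
  have vi: "inv v (v a) = a" "v (inv v p) = p" for a p
    using v(1) by (simp_all add: bij_is_inj inv_f_f bij_is_surj surj_f_inv_f)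
  have up: "b $ p $ q = 0" if "q < p" for p q
    using that v(2)[of "inv v q"] by (auto simp: b_def vi)
  have "det b = 1" using det_upper_triangular[of b] up by (simp add: b_def)
  then have b: "b \<in> Borel" using up by (simp add: Borel_def SL_C_def)
  have bcol: "column (v a) b = (if a < rv a then axis (v a) 1 + (- \<i> * of_real (\<eta> a)) *s axis (v (rv a)) 1 else axis (v a) 1)" for a
    using v(2)[of a] by (auto simp: vec_eq_iff column_def b_def axis_def vi)
  have bP: "column a (b ** ?P) = column (v a) b" for a
    unfolding column_mult by (simp add: perm_mat_axis flip: mult_axis)
  have Qsg1: "column a (Q ** sg) = of_real (\<epsilon> a / sqrt 2) *s column a (b ** ?P)" if a: "a < rv a" for a
  proof -
    have e: "\<epsilon> a * \<eta> a = \<epsilon> (rv a)" using \<epsilon>[of a] by (simp add: \<eta>_def flip: mult.assoc)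
    have "column a (Q ** sg) = of_real (1 / sqrt 2) *s column a Q + (- \<i> / sqrt 2) *s column (rv a) Q"
      unfolding column_mult sg_column(1)[OF a]
      by (simp only: matrix_vector_right_distrib vector_scalar_commute mult_axis)
    then show ?thesis
      unfolding bP bcol Q_def sc_col using a e[symmetric]
      by (simp add: vec_eq_iff algebra_simps)
  qed
  \<comment> \<open>In the second half the isotropic column combines the columns \<open>a\<close>
    and \<open>rv a\<close>, and both lie in the flag member because \<open>rv a < a\<close>. The
    factor 2 turns the negative term contained in column \<open>rv a\<close> into a positive
    one.\<close>
  have Qsg2: "column a (Q ** sg) = of_real (\<epsilon> (rv a) / sqrt 2) *s column (rv a) (b ** ?P)
      + (2 * \<i> * of_real (\<epsilon> a) / sqrt 2) *s column a (b ** ?P)" if a: "rv a < a" for a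
  proof -
    have e: "\<epsilon> (rv a) * \<eta> (rv a) = \<epsilon> a" using \<epsilon>[of "rv a"] by (simp add: \<eta>_def flip: mult.assoc)
    have "column a (Q ** sg) = of_real (1 / sqrt 2) *s column (rv a) Q + (\<i> / sqrt 2) *s column a Q"
      unfolding column_mult sg_column(2)[OF a]
      by (simp only: matrix_vector_right_distrib vector_scalar_commute mult_axis)
    then show ?thesis
      unfolding bP bcol Q_def sc_col using a e[symmetric]
      by (simp add: vec_eq_iff algebra_simps)
  qed
  have Qsg3: "column a (Q ** sg) = of_real (\<epsilon> a) *s column a (b ** ?P)" if a: "rv a = a" for a
  proof -
    have "column a (Q ** sg) = column a Q"
      unfolding column_mult sg_column(3)[OF a] mult_axis ..
    then show ?thesis unfolding bP bcol Q_def sc_col using a by simp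
  qed
  have "act (Q ** sg) bf = act (b ** ?P) bf"
  proof (rule act_bf_eqI)
    have "adj (Q ** sg) ** (Q ** sg) = adj sg ** (adj Q ** Q) ** sg" by (simp add: adj_mult matrix_mul_assoc)
    then have "adj (Q ** sg) ** (Q ** sg) = mat 1" using sc_un[OF \<epsilon>] by (simp add: Q_def sg_unitary)
    then show "invertible (Q ** sg)" by (rule unitary_invertible)
    have inv: "invertible (b ** ?P)"
      using b v(1) by (intro invertible_mult SL_C_invertible perm_mat_invertible) (simp_all add: Borel_def)
    show fl: "act (b ** ?P) bf \<in> flags dims" by (rule act_flags[OF inv bf_flags])
    fix c i assume i: "bi c \<le> i" "i < r"
    have V: "vec.subspace (act (b ** ?P) bf ! i)" by (rule flags_subspace[OF fl i(2)])
    have colV: "column a (b ** ?P) \<in> act (b ** ?P) bf ! i" if "a \<le> c" for a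
      using bi_mono[OF that] i by (auto simp: nth_act_bf simp flip: mult_axis simp del: nth_act)
    consider "c < rv c" | "rv c < c" | "rv c = c" by (cases c "rv c" rule: linorder_cases) auto
    then show "column c (Q ** sg) \<in> act (b ** ?P) bf ! i"
      by cases (auto simp: Qsg1 Qsg2 Qsg3 intro!: vec.subspace_add[OF V] vec.subspace_scale[OF V] colV)
  qed
  then show ?thesis using b orb by (intro bexI[of _ b]) (simp_all add: act_act)
qed

end

section \<open>Blocks and the canonical rearrangement\<close>

lemma blocks_nth: "i < length dims \<Longrightarrow> blocks dims w ! i = take (dims ! i) (drop (psum dims i) w)"
proof (induction dims arbitrary: w i)
  case (Cons d dims)
  then show ?case by (cases i) (auto simp: psum_def add.commute)
qed simp

lemma length_blocks [simp]: "length (blocks dims w) = length dims"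
  by (induction dims arbitrary: w) auto

lemma concat_blocks: "length w = sum_list dims \<Longrightarrow> concat (blocks dims w) = w"
  by (induction dims arbitrary: w) auto

lemma concat_nth:
  "i < length cs \<Longrightarrow> t < length (cs ! i) \<Longrightarrow> concat cs ! (psum (map length cs) i + t) = cs ! i ! t"
proof (induction cs arbitrary: i)
  case (Cons c cs)
  then show ?case by (cases i) (auto simp: psum_def nth_append add.assoc)
qed simp

lemma immediate_left_mono:
  "immediate_left R l k \<Longrightarrow> R' \<subseteq> R \<Longrightarrow> l \<in> R' \<Longrightarrow> k \<in> R' \<Longrightarrow> immediate_left R' l k"
  by (auto simp: immediate_left_def)

lemma immediate_left_functional:
  "immediate_left R l k \<Longrightarrow> immediate_left R l k' \<Longrightarrow> k = k'"
  by (auto simp: immediate_left_def) (metis linorder_neqE)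

lemma immediate_left_less:
  "immediate_left R l k \<Longrightarrow> immediate_left R l' k' \<Longrightarrow> l < l' \<Longrightarrow> k < k'"
  unfolding immediate_left_def by (metis le_less_trans not_less)

text \<open>Taking the immediate successor in \<open>R\<close> is strictly monotone, so the pairing
  matches the two increasing lists entry by entry.\<close>

lemma sorted_pairs:
  fixes bs ls :: "'a::linorder list"
  assumes imm: "\<forall>(l, k) \<in> prs. immediate_left R l k" and B: "set bs = snd ` prs" and L: "set ls = fst ` prs"
    and s: "sorted bs" "distinct bs" "sorted ls" "distinct ls"
  shows "length bs = length ls \<and> (\<forall>t<length ls. immediate_left R (ls ! t) (bs ! t))"
proof -
  have "\<exists>f. \<forall>l\<in>set ls. (l, f l) \<in> prs" using L by (intro bchoice) force
  then obtain f where f: "\<And>l. l \<in> set ls \<Longrightarrow> (l, f l) \<in> prs" by blast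
  have il: "immediate_left R l (f l)" if "l \<in> set ls" for l using f[OF that] imm by blast
  have uniq: "k = f l" if "(l, k) \<in> prs" for l k
  proof -
    have "l \<in> set ls" using that L by force
    then show ?thesis using il[of l] that imm immediate_left_functional by blast
  qed
  have "snd ` prs = f ` set ls"
    using f uniq L by (force simp: image_iff)
  then have set: "set (map f ls) = set bs" using B by simp
  have "sorted_wrt (<) ls" using s by (simp add: strict_sorted_iff)
  then have "sorted_wrt (<) (map f ls)"
    unfolding sorted_wrt_map
    by (rule sorted_wrt_mono_rel[rotated]) (use il immediate_left_less in blast)
  then have "map f ls = bs"
    using set s by (intro sorted_distinct_set_unique) (auto simp: strict_sorted_iff)
  then show ?thesis using il by auto
qed

lemma upt_split: "i \<le> j \<Longrightarrow> j \<le> k \<Longrightarrow> [i..<k] = [i..<j] @ [j..<k]"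
  using upt_add_eq_append[of i j "k - j"] by simp

text \<open>Used for the given sequence and again for the sequence of ones, which is symmetric with
  \<open>CARD('n) div 2\<close> ones on each side and middle part
  \<open>CARD('n) mod 2\<close>.\<close>

locale sym_pair =
  fixes ds :: "nat list" and e :: nat and ty :: "'n::{finite,linorder} itself"
  assumes ds_ne: "ds \<noteq> []" and ds_pos: "\<forall>d\<in>set ds. 0 < d"
    and ds_sum: "sum_list (sym_dims ds e) = CARD('n)"

sublocale sym_pair \<subseteq> sym_seq "sym_dims ds e" ty
  by unfold_locales (use ds_pos ds_sum in \<open>auto simp: sym_dims_def\<close>)

context sym_seq
begin

text \<open>The function \<beta> of \<open>block_fun\<close> attached to \<open>w\<close>: the block
  of a value, not of a position.\<close>

definition blk :: "'n list \<Rightarrow> 'n \<Rightarrow> nat" where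
  "blk w x = bi (inv (at_pos w) x)"

lemma inv_at_pos:
  assumes "w \<in> permutations_of_set (UNIV :: 'n set)"
  shows "inv (at_pos w) (at_pos w a) = a" "at_pos w (inv (at_pos w) x) = x"
  using bij_at_pos[OF assms] by (simp_all add: bij_is_inj inv_f_f bij_is_surj surj_f_inv_f)

lemma block_fun_blk:
  assumes w: "w \<in> permutations_of_set (UNIV :: 'n set)"
  shows "block_fun (blk w) r (\<lambda>x. at_pos w (rv (inv (at_pos w) x)))"
proof
  have "bij (at_pos w \<circ> (rv \<circ> inv (at_pos w)))"
    using bij_at_pos[OF w] bij_rv by (intro bij_comp bij_imp_bij_inv)
  then show "bij (\<lambda>x. at_pos w (rv (inv (at_pos w) x)))" by (simp add: o_def)
qed (simp_all add: blk_def inv_at_pos[OF w] bi_props bi_rv)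

lemma set_take_blk:
  assumes w: "w \<in> permutations_of_set (UNIV :: 'n set)"
  shows "set (take (m i) w) = {x. blk w x < i}"
proof -
  have "x \<in> at_pos w ` {c. bi c < i} \<longleftrightarrow> blk w x < i" for x
    using inv_at_pos[OF w] by (auto simp: blk_def intro: rev_image_eqI)
  then show ?thesis unfolding set_take_eq[OF perm_list(3)[OF w]] ini_m by blast
qed

lemma card_via_at_pos:
  assumes w: "w \<in> permutations_of_set (UNIV :: 'n set)"
  shows "card {(y, x). P (inv (at_pos w) y) (inv (at_pos w) x) \<and> Q y x} = card {(a, c). P a c \<and> Q (at_pos w a) (at_pos w c)}"
proof (rule bij_betw_same_card)
  let ?u = "at_pos w"
  note u = inv_at_pos[OF w]
  show "bij_betw (map_prod (inv ?u) (inv ?u)) {(y, x). P (inv ?u y) (inv ?u x) \<and> Q y x}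
    {(a, c). P a c \<and> Q (?u a) (?u c)}"
  proof (rule bij_betw_byWitness[where f' = "map_prod ?u ?u"])
    show "\<forall>z\<in>{(y, x). P (inv ?u y) (inv ?u x) \<and> Q y x}. map_prod ?u ?u (map_prod (inv ?u) (inv ?u) z) = z"
      by (simp add: u split_paired_all)
    show "\<forall>z\<in>{(a, c). P a c \<and> Q (?u a) (?u c)}. map_prod (inv ?u) (inv ?u) (map_prod ?u ?u z) = z"
      by (simp add: u split_paired_all)
    show "map_prod (inv ?u) (inv ?u) ` {(y, x). P (inv ?u y) (inv ?u x) \<and> Q y x} \<subseteq> {(a, c). P a c \<and> Q (?u a) (?u c)}"
      by (rule image_subsetI) (simp add: u split_paired_all)
    show "map_prod ?u ?u ` {(a, c). P a c \<and> Q (?u a) (?u c)} \<subseteq> {(y, x). P (inv ?u y) (inv ?u x) \<and> Q y x}"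
      by (rule image_subsetI) (simp add: u split_paired_all)
  qed
qed

text \<open>The inversion number is \<open>card (len_set w)\<close>, and \<open>card_Low\<close>
  expresses the dimension of the base cycle; it contains a half, so the condition appears
  doubled.\<close>

lemma dim_condition_iff:
  assumes w: "w \<in> permutations_of_set (UNIV :: 'n set)"
  shows "card (len_set w) + card half = card Low \<longleftrightarrow>
    2 * block_fun.invs (blk w) = card {(x, y). blk w x < blk w y} + card {x. r \<le> 2 * blk w x}"
proof -
  interpret block_fun "blk w" r "\<lambda>x. at_pos w (rv (inv (at_pos w) x))" by (rule block_fun_blk[OF w])
  have "invs = card {(y, x). bi (inv (at_pos w) x) < bi (inv (at_pos w) y) \<and> y < x}"
    unfolding invs_def blk_def by (rule arg_cong[of _ _ card]) auto
  also have "\<dots> = card {(a, c). bi c < bi a \<and> at_pos w a < at_pos w c}"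
    by (rule card_via_at_pos[OF w])
  also have "{(a, c). bi c < bi a \<and> at_pos w a < at_pos w c} = len_set w"
    by (auto simp: len_set_def Low_def)
  finally have 1: "invs = card (len_set w)" .
  have "card {(x, y). blk w x < blk w y} = card {(p, c). bi p < bi c}"
    using card_via_at_pos[OF w, of "\<lambda>p c. bi p < bi c" "\<lambda>_ _. True"] by (simp add: blk_def)
  also have "\<dots> = card (prod.swap ` Low)"
    by (rule arg_cong[of _ _ card]) (auto simp: Low_def image_iff)
  also have "\<dots> = card Low" by (rule card_image) simp
  finally have 2: "card {(x, y). blk w x < blk w y} = card Low" .
  have "{x. r \<le> 2 * blk w x} = at_pos w ` {a. r \<le> 2 * bi a}"
    using inv_at_pos[OF w] by (auto simp: blk_def intro: rev_image_eqI)
  then have 3: "card {x. r \<le> 2 * blk w x} = card {a. r \<le> 2 * bi a}"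
    using bij_at_pos[OF w] by (simp add: card_image inj_on_subset[OF bij_is_inj])
  show ?thesis unfolding 1 2 3 using card_Low by linarith
qed

lemma set_block:
  assumes w: "w \<in> permutations_of_set (UNIV :: 'n set)" and i: "i < r"
  shows "set (blocks dims w ! i) = {x. blk w x = i}" "length (blocks dims w ! i) = dims ! i"
    "distinct (blocks dims w ! i)"
proof -
  have len: "length w = CARD('n)" "distinct w" using perm_list[OF w] by auto
  have mS: "m (Suc i) = m i + dims ! i" by (rule psum_Suc[OF i])
  have "w = concat (blocks dims w)" using concat_blocks[of w dims] len dims_sum by simp
  have le: "m (Suc i) \<le> length w" using len m_le by simp
  show l: "length (blocks dims w ! i) = dims ! i" using le i mS by (simp add: blocks_nth)
  show "distinct (blocks dims w ! i)" using len i by (simp add: blocks_nth)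
  have tk: "take (m (Suc i)) w = take (m i) w @ blocks dims w ! i"
    using i by (simp add: mS take_add blocks_nth)
  have "distinct (take (m (Suc i)) w)" using len by simp
  then have "set (blocks dims w ! i) = set (take (m (Suc i)) w) - set (take (m i) w)"
    unfolding tk by auto
  also have "\<dots> = {x. blk w x = i}" unfolding set_take_blk[OF w] by auto
  finally show "set (blocks dims w ! i) = {x. blk w x = i}" .
qed

lemma minimal_rep_eqI:
  assumes w: "minimal_rep dims (w :: 'n list)" and v: "minimal_rep dims v"
    and eq: "\<And>i. i < r \<Longrightarrow> set (take (m (Suc i)) w) = set (take (m (Suc i)) v)"
  shows "w = v"
proof -
  have wv: "w \<in> permutations_of_set UNIV" "v \<in> permutations_of_set UNIV"
    using w v by (auto simp: minimal_rep_def)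
  have lt: "{x. blk w x < i} = {x. blk v x < i}" if "i \<le> r" for i
    using that eq[of "i - 1"] unfolding set_take_blk[OF wv(1)] set_take_blk[OF wv(2)] by (cases i) auto
  have "blocks dims w = blocks dims v"
  proof (rule nth_equalityI)
    fix i assume "i < length (blocks dims w)"
    then have i: "i < r" by simp
    have "{x. blk w x = i} = {x. blk w x < Suc i} - {x. blk w x < i}" by auto
    also have "\<dots> = {x. blk v x < Suc i} - {x. blk v x < i}" using lt[of i] lt[of "Suc i"] i by simp
    also have "\<dots> = {x. blk v x = i}" by auto
    finally show "blocks dims w ! i = blocks dims v ! i"
      using w v i set_block[OF wv(1) i] set_block[OF wv(2) i]
      by (intro sorted_distinct_set_unique) (auto simp: minimal_rep_def)
  qed simp
  moreover have "concat (blocks dims x) = x" if "x \<in> permutations_of_set UNIV" for x :: "'n list"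
    by (rule concat_blocks) (rule trans[OF perm_list(3)[OF that] dims_sum[symmetric]])
  ultimately show ?thesis using wv by metis
qed

lemma cell_eqI:
  assumes w: "w \<in> permutations_of_set (UNIV :: 'n set)" and v: "v \<in> permutations_of_set (UNIV :: 'n set)"
    and eq: "\<And>i. i < r \<Longrightarrow> set (take (m (Suc i)) w) = set (take (m (Suc i)) v)"
  shows "flag_proj dims (coord_flag w) = flag_proj dims (coord_flag v)"
  unfolding flag_proj_coord_flag[OF perm_list(3)[OF w]] flag_proj_coord_flag[OF perm_list(3)[OF v]]
  using eq by simp

end

context sym_pair
begin

lemma length_sym_dims: "length (sym_dims ds e) = 2 * length ds + (if e = 0 then 0 else 1)"
  by (simp add: sym_dims_def)

lemma less_length_ds_iff: "j < length ds \<longleftrightarrow> 2 * j + 2 \<le> r"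
  unfolding length_sym_dims by (cases "e = 0") (simp_all, presburger+)

lemma two_le_card: "2 \<le> CARD('n)"
proof -
  obtain d ds' where "ds = d # ds'" using ds_ne by (cases ds) auto
  then show ?thesis using ds_pos ds_sum by (auto simp: sym_dims_def)
qed

lemma sym_dims_nth:
  "j < length ds \<Longrightarrow> sym_dims ds e ! j = ds ! j"
  "j < length ds \<Longrightarrow> sym_dims ds e ! (r - 1 - j) = ds ! j"
  "e \<noteq> 0 \<Longrightarrow> sym_dims ds e ! length ds = e"
proof -
  show 1: "sym_dims ds e ! j = ds ! j" if "j < length ds" for j
    using that by (simp add: sym_dims_def nth_append)
  show "sym_dims ds e ! (r - 1 - j) = ds ! j" if "j < length ds"
  proof -
    have "rev (sym_dims ds e) ! j = sym_dims ds e ! (r - Suc j)"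
      using that by (intro rev_nth) (simp add: length_sym_dims)
    then show ?thesis using 1[OF that] rev_dims by simp
  qed
  show "sym_dims ds e ! length ds = e" if "e \<noteq> 0"
    using that by (simp add: sym_dims_def nth_append)
qed

lemma right_block_eq: "j < length ds \<Longrightarrow> right_block ds e w j = blocks (sym_dims ds e) w ! (r - 1 - j)"
  unfolding right_block_def by (subst rev_nth) (auto simp: length_sym_dims)

text \<open>In terms of block indices, the set remaining at step \<open>j\<close> consists of the
  values whose block is neither among the first \<open>j\<close> nor among the last
  \<open>j\<close>, which makes each step of the construction a \<open>stage\<close>.\<close>

lemma contraction_iff_contracted:
  assumes w: "w \<in> permutations_of_set (UNIV :: 'n set)"
  shows "generalized_double_box_contraction ds e w \<longleftrightarrow> block_fun.contracted (blk w) r"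
proof -
  interpret B: block_fun "blk w" r "\<lambda>x. at_pos w (rv (inv (at_pos w) x))" by (rule block_fun_blk[OF w])
  have L: "set (left_block ds e w j) = {x. blk w x = j}" if "j < length ds" for j
    unfolding left_block_def by (rule set_block(1)[OF w]) (use that in \<open>simp add: length_sym_dims\<close>)
  have Rb: "set (right_block ds e w j) = {x. blk w x = r - 1 - j}" if "j < length ds" for j
    unfolding right_block_eq[OF that] by (rule set_block(1)[OF w]) (use that in \<open>simp add: length_sym_dims\<close>)
  have c: "card {x. blk w x = j} = ds ! j" if "j < length ds" for j
  proof -
    have j: "j < r" using that by (simp add: length_sym_dims)
    show ?thesis
      using set_block[OF w j] sym_dims_nth(1)[OF that] by (metis distinct_card)
  qed
  have R: "UNIV - (\<Union>i<j. set (left_block ds e w i) \<union> set (right_block ds e w i))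
      = {x. j \<le> blk w x \<and> blk w x + j < r}" if j: "j < length ds" for j
  proof -
    have "x \<in> (\<Union>i<j. set (left_block ds e w i) \<union> set (right_block ds e w i)) \<longleftrightarrow> \<not> (j \<le> blk w x \<and> blk w x + j < r)" for x
    proof -
      have "x \<in> (\<Union>i<j. set (left_block ds e w i) \<union> set (right_block ds e w i)) \<longleftrightarrow> (\<exists>i<j. blk w x = i \<or> blk w x = r - 1 - i)"
        using L Rb j by auto
      also have "\<dots> \<longleftrightarrow> \<not> (j \<le> blk w x \<and> blk w x + j < r)"
      proof
        assume "\<exists>i<j. blk w x = i \<or> blk w x = r - 1 - i"
        then show "\<not> (j \<le> blk w x \<and> blk w x + j < r)" using j by (auto simp: length_sym_dims)
      next
        assume "\<not> (j \<le> blk w x \<and> blk w x + j < r)"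
        then consider "blk w x < j" | "r - 1 - blk w x < j" "blk w x = r - 1 - (r - 1 - blk w x)"
          using B.\<beta>_less[of x] by linarith
        then show "\<exists>i<j. blk w x = i \<or> blk w x = r - 1 - i" by cases blast+
      qed
      finally show ?thesis .
    qed
    then show ?thesis by blast
  qed
  have "generalized_double_box_contraction ds e w \<longleftrightarrow> (\<forall>j<length ds. B.stage j)"
    unfolding generalized_double_box_contraction_def Let_def B.stage_def
    by (intro all_cong1 imp_cong refl) (simp only: R L Rb c)
  then show ?thesis
    unfolding B.contracted_iff_stages less_length_ds_iff .
qed

text \<open>Block \<open>i\<close> of the rearranged word. The rounding covers both parity cases;
  for odd \<open>e\<close> it puts the first entry of the middle block at the centre, which is its
  own mirror position.\<close>

definition rearranged :: "'n list \<Rightarrow> nat \<Rightarrow> 'n list" where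
  "rearranged w i = (let b = blocks (sym_dims ds e) w ! i; h = (e + 1) div 2
     in if i < length ds then b else if i < r - length ds then drop h b @ take h b else rev b)"

abbreviation hat :: "'n list \<Rightarrow> 'n list" where
  "hat w \<equiv> canonical_rearrangement ds e w"

lemma hat_eq: "hat w = concat (map (rearranged w) [0..<r])"
proof -
  let ?s = "length ds"
  have h: "(if even e then e div 2 else (e + 1) div 2) = (e + 1) div 2" by auto
  have up: "[0..<r] = [0..<?s] @ [?s..<r - ?s] @ [r - ?s..<r]"
  proof -
    have "[0..<r] = [0..<r - ?s] @ [r - ?s..<r]"
      by (rule upt_split) auto
    also have "[0..<r - ?s] = [0..<?s] @ [?s..<r - ?s]"
      by (rule upt_split) (auto simp: length_sym_dims)
    finally show ?thesis by simp
  qed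
  have hi: "[r - ?s..<r] = map (\<lambda>j. r - 1 - j) (rev [0..<?s])"
    by (rule nth_equalityI) (auto simp: rev_nth length_sym_dims)
  have 1: "map (rearranged w) [0..<?s] = map (left_block ds e w) [0..<?s]"
    by (rule map_cong) (auto simp: rearranged_def left_block_def Let_def)
  have 2: "map (rearranged w) [r - ?s..<r] = map (\<lambda>j. rev (right_block ds e w j)) (rev [0..<?s])"
    unfolding hi map_map
    by (rule map_cong) (auto simp: rearranged_def right_block_eq Let_def length_sym_dims)
  have 3: "concat (map (rearranged w) [?s..<r - ?s])
      = drop ((e + 1) div 2) (middle_block ds e w) @ take ((e + 1) div 2) (middle_block ds e w)"
    by (auto simp: rearranged_def middle_block_def Let_def length_sym_dims upt_conv_Cons)
  show ?thesis
    unfolding up map_append concat_append 1 2 3 canonical_rearrangement_def Let_def h by simp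
qed

section \<open>The canonical rearrangement pairs mirror positions in nested fashion\<close>

context
  fixes w :: "'n list"
  assumes w: "w \<in> permutations_of_set UNIV"
begin

lemma rearranged: "i < r \<Longrightarrow> set (rearranged w i) = {x. blk w x = i}"
  "i < r \<Longrightarrow> length (rearranged w i) = sym_dims ds e ! i"
proof -
  assume i: "i < r"
  have "set (drop h b @ take h b) = set b" for h and b :: "'n list"
    by (metis append_take_drop_id set_append sup_commute)
  then have "set (rearranged w i) = set (blocks (sym_dims ds e) w ! i)"
    unfolding rearranged_def Let_def by (simp del: set_append)
  then show "set (rearranged w i) = {x. blk w x = i}" using set_block(1)[OF w i] by simp
  show "length (rearranged w i) = sym_dims ds e ! i"
    using set_block(2)[OF w i] by (auto simp: rearranged_def Let_def)
qed

lemma map_length_rearranged: "map length (map (rearranged w) [0..<r]) = sym_dims ds e"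
  by (rule nth_equalityI) (auto simp: rearranged(2))

lemma hat_perm: "hat w \<in> permutations_of_set UNIV"
proof -
  have "length (hat w) = sum_list (map length (map (rearranged w) [0..<r]))"
    unfolding hat_eq by (rule length_concat)
  then have len: "length (hat w) = CARD('n)" unfolding map_length_rearranged dims_sum .
  have "blk w x < r" for x by (simp add: blk_def bi_props)
  then have "set (hat w) = UNIV" unfolding hat_eq by (auto simp: rearranged(1))
  with len show ?thesis by (simp add: permutations_of_set_def card_distinct)
qed

lemma at_pos_hat: "at_pos (hat w) a = rearranged w (bi a) ! (pos a - m (bi a))"
proof -
  have "pos a - m (bi a) < sym_dims ds e ! bi a"
    using bi_props[of a] psum_Suc[OF bi_props(1), of a] by linarith
  then have "concat (map (rearranged w) [0..<r]) ! (psum (map length (map (rearranged w) [0..<r])) (bi a) + (pos a - m (bi a)))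
      = map (rearranged w) [0..<r] ! bi a ! (pos a - m (bi a))"
    using bi_props(1)[of a] by (intro concat_nth) (simp_all add: rearranged(2))
  then show ?thesis
    unfolding map_length_rearranged hat_eq at_pos_def using bi_props(1,2)[of a] by simp
qed

lemma blk_at_pos_hat: "blk w (at_pos (hat w) a) = bi a"
proof -
  have "pos a - m (bi a) < length (rearranged w (bi a))"
    using bi_props[of a] psum_Suc[OF bi_props(1), of a] rearranged(2)[OF bi_props(1), of a] by linarith
  then have "at_pos (hat w) a \<in> set (rearranged w (bi a))" unfolding at_pos_hat by (rule nth_mem)
  then show ?thesis using rearranged(1)[OF bi_props(1)] by simp
qed

lemma set_take_hat: "set (take (m i) (hat w)) = set (take (m i) w)"
proof -
  have "blk (hat w) x = blk w x" for x
    using blk_at_pos_hat[of "inv (at_pos (hat w)) x"] inv_at_pos[OF hat_perm] by (simp add: blk_def)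
  then show ?thesis unfolding set_take_blk[OF w] set_take_blk[OF hat_perm] by simp
qed

text \<open>Reversing a right block matches its entries with those of the increasing left block in
  the pairing of the contraction, and deleting earlier pairs keeps neighbours adjacent. In the
  middle block the rotation pairs entries outward from the cut, so everything between two partners
  has been deleted before.\<close>

lemma hat_nested:
  assumes min: "minimal_rep (sym_dims ds e) w" and dbc: "generalized_double_box_contraction ds e w" and a: "a < rv a"
  shows "immediate_left (UNIV - (\<Union>b<a. {at_pos (hat w) b, at_pos (hat w) (rv b)}))
    (at_pos (hat w) (rv a)) (at_pos (hat w) a)"
proof -
  interpret B: block_fun "blk w" r "\<lambda>x. at_pos w (rv (inv (at_pos w) x))" by (rule block_fun_blk[OF w])
  let ?v = "at_pos (hat w)" and ?d = "sym_dims ds e" and ?h = "(e + 1) div 2"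
  let ?R' = "UNIV - (\<Union>b<a. {?v b, ?v (rv b)})"
  define j where "j = bi a"
  let ?R = "{x. j \<le> blk w x \<and> blk w x + j < r}"
  have inj: "?v b = ?v c \<longleftrightarrow> b = c" for b c
    using bij_at_pos[OF hat_perm] by (simp add: bij_is_inj inj_eq)
  have surj: "\<exists>b. x = ?v b" for x
    using bij_at_pos[OF hat_perm] by (metis bij_pointE)
  have in_R': "?v a \<in> ?R'" "?v (rv a) \<in> ?R'"
  proof -
    have ne: "?v a \<noteq> ?v b" "?v a \<noteq> ?v (rv b)" "?v (rv a) \<noteq> ?v b" "?v (rv a) \<noteq> ?v (rv b)" if "b < a" for b
    proof -
      have "a \<noteq> b" "rv a \<noteq> b" using that a by auto
      then show "?v a \<noteq> ?v b" "?v (rv a) \<noteq> ?v b" unfolding inj by simp_all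
      have "a \<noteq> rv b" using \<open>rv a \<noteq> b\<close> rv_rv[of b] by metis
      moreover have "rv a \<noteq> rv b" using \<open>a \<noteq> b\<close> rv_rv by metis
      ultimately show "?v a \<noteq> ?v (rv b)" "?v (rv a) \<noteq> ?v (rv b)" unfolding inj by simp_all
    qed
    show "?v a \<in> ?R'" "?v (rv a) \<in> ?R'" using ne by blast+
  qed
  \<comment> \<open>The blocks preceding that of \<open>a\<close>, together with their mirrors,
    occupy only positions that have already been deleted.\<close>
  have R'R: "?R' \<subseteq> ?R"
  proof
    fix x assume x: "x \<in> ?R'"
    obtain b where b: "x = ?v b" using surj by blast
    have "blk w x = bi b" unfolding b by (rule blk_at_pos_hat)
    moreover have "\<not> bi b < j"
      using x b bi_less_imp[of b a] by (auto simp: j_def)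
    moreover have "\<not> bi (rv b) < j"
    proof
      assume "bi (rv b) < j"
      then have "rv b < a" by (intro bi_less_imp) (simp add: j_def)
      then have "?v (rv (rv b)) \<notin> ?R'" by blast
      then show False using x b by simp
    qed
    ultimately show "x \<in> ?R" using bi_add_bi_rv[of b] bi_props(1)[of a] unfolding j_def by simp
  qed
  have sum: "pos (rv a) + pos a + 1 = CARD('n)" by (rule pos_rv)
  have jr: "j < r" unfolding j_def by (rule bi_props)
  have rvj: "bi (rv a) = r - 1 - j" unfolding j_def by (rule bi_rv)
  let ?t = "pos a - m j"
  have t: "m j + ?t = pos a" "?t < ?d ! j"
    using bi_props[of a] psum_Suc[OF jr] unfolding j_def by auto
  have mj: "m (r - 1 - j) + m (Suc j) = CARD('n)"
    using m_rev[of "Suc j"] jr by (simp add: add.commute)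
  have rvt: "pos (rv a) - m (r - 1 - j) = ?d ! j - 1 - ?t"
    using sum mj psum_Suc[OF jr] t by linarith
  have va: "?v a = rearranged w j ! ?t" unfolding j_def by (rule at_pos_hat)
  have vr: "?v (rv a) = rearranged w (r - 1 - j) ! (?d ! j - 1 - ?t)"
    unfolding at_pos_hat rvj rvt ..
  have blkj: "set (blocks ?d w ! j) = {x. blk w x = j}" "distinct (blocks ?d w ! j)" "sorted (blocks ?d w ! j)"
      "length (blocks ?d w ! j) = ?d ! j"
    using set_block[OF w jr] min jr by (auto simp: minimal_rep_def)
  show ?thesis
  proof (cases "j < length ds")
    case True
    let ?k = "r - 1 - j"
    have kr: "?k < r" using jr by simp
    have "B.stage j"
      using dbc True unfolding contraction_iff_contracted[OF w] B.contracted_iff_stages less_length_ds_iff by blast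
    then obtain prs :: "('n \<times> 'n) set" where prs: "\<forall>(l, k) \<in> prs. immediate_left ?R l k"
      "{x. blk w x = j} = snd ` prs" "{x. blk w x = ?k} = fst ` prs"
      unfolding B.stage_def by blast
    have blkk: "set (blocks ?d w ! ?k) = {x. blk w x = ?k}" "distinct (blocks ?d w ! ?k)" "sorted (blocks ?d w ! ?k)"
      "length (blocks ?d w ! ?k) = ?d ! j"
      using set_block[OF w kr] min kr sym_dims_nth(1,2)[OF True] by (auto simp: minimal_rep_def)
    have "immediate_left ?R (blocks ?d w ! ?k ! ?t) (blocks ?d w ! j ! ?t)"
    proof -
      have "set (blocks ?d w ! j) = snd ` prs" "set (blocks ?d w ! ?k) = fst ` prs"
        using blkj(1) blkk(1) prs(2,3) by (simp_all only:)
      from sorted_pairs[OF prs(1) this blkj(3,2) blkk(3,2)] show ?thesis using blkk(4) t(2) by (simp only:)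
    qed
    moreover have "?v a = blocks ?d w ! j ! ?t" unfolding va using True by (simp add: rearranged_def)
    moreover have "?v (rv a) = blocks ?d w ! ?k ! ?t"
    proof -
      have "rearranged w ?k = rev (blocks ?d w ! ?k)"
        using True by (auto simp: rearranged_def Let_def length_sym_dims)
      then have "?v (rv a) = blocks ?d w ! ?k ! (?d ! j - Suc (?d ! j - 1 - ?t))"
        unfolding vr using t(2) blkk(4) by (simp add: rev_nth)
      moreover have "?d ! j - Suc (?d ! j - 1 - ?t) = ?t" using t(2) by linarith
      ultimately show ?thesis by simp
    qed
    ultimately have "immediate_left ?R (?v (rv a)) (?v a)" by simp
    then show ?thesis by (rule immediate_left_mono[OF _ R'R in_R'(2,1)])
  next
    case False
    have "bi a \<le> bi (rv a)" using a by (intro bi_mono) simp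
    then have "2 * j + 1 \<le> r" using rvj jr unfolding j_def by linarith
    then have j: "j = length ds" "e \<noteq> 0" "r = 2 * j + 1"
      using False by (auto simp: length_sym_dims split: if_splits)
    let ?M = "blocks ?d w ! j"
    have dj: "?d ! j = e" using sym_dims_nth(3) j by simp
    have te: "2 * ?t + 1 < e"
    proof -
      have "pos a < pos (rv a)" using a by simp
      moreover have "m j + (m j + e) = CARD('n)"
        using mj psum_Suc[OF jr] j dj by simp
      ultimately show ?thesis using sum t by linarith
    qed
    have lM: "length ?M = e" using blkj dj by simp
    have rot: "rearranged w j = drop ?h ?M @ take ?h ?M"
      using j by (auto simp: rearranged_def Let_def length_sym_dims)
    have low: "?v b = ?M ! (?h + (pos b - m j))" if "bi b = j" "2 * (pos b - m j) + 1 < e" for b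
    proof -
      have "pos b - m j < e - ?h" using that(2) by linarith
      then show ?thesis
        unfolding at_pos_hat that(1) rot using lM by (simp add: nth_append)
    qed
    have high: "?v b = ?M ! (?h - 1 - u)" if "bi b = j" "pos b - m j = e - 1 - u" "2 * u + 1 < e" for b u
    proof -
      have u: "u < ?h" "?h \<le> e" using that(3) by linarith+
      have "e - h \<le> e - 1 - u \<and> e - 1 - u - (e - h) = h - 1 - u \<and> h - 1 - u < h" if "u < h" "h \<le> e" for h
        using that by auto
      from this[OF u] show ?thesis
        unfolding at_pos_hat that(1,2) rot using lM by (simp add: nth_append del: diff_diff_left)
    qed
    have bj: "bi a = j" "bi (rv a) = j" using rvj j unfolding j_def by simp_all
    have 1: "?v a = ?M ! (?h + ?t)" using low[OF bj(1)] te by simp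
    have rt: "pos (rv a) - m j = e - 1 - ?t" using rvt dj j by simp
    have 2: "?v (rv a) = ?M ! (?h - 1 - ?t)"
      by (rule high[OF bj(2) rt te])
    have sw: "sorted_wrt (<) ?M" using blkj by (simp add: strict_sorted_iff)
    have less_iff: "?M ! p < ?M ! q \<longleftrightarrow> p < q" if "p < e" "q < e" for p q
      using sorted_wrt_nth_less[OF sw, of p q] sorted_wrt_nth_less[OF sw, of q p] that lM
      by (metis less_asym less_irrefl linorder_neqE_nat)
    have he: "?h + ?t < e" "?h - 1 - ?t < e" "?h - 1 - ?t < ?h + ?t" using te by linarith+
    show ?thesis
      unfolding immediate_left_def
    proof (intro conjI in_R' notI)
      show "?v (rv a) < ?v a" unfolding 1 2 using less_iff he by blast
      assume "\<exists>x\<in>?R'. ?v (rv a) < x \<and> x < ?v a"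
      then obtain x where x: "x \<in> ?R'" "?v (rv a) < x" "x < ?v a" by blast
      have "blk w x = j" using x(1) R'R j by auto
      then have "x \<in> set ?M" unfolding blkj(1) by (rule CollectI)
      then obtain u where u: "u < e" "x = ?M ! u" unfolding in_set_conv_nth lM by blast
      have ub: "?h - 1 - ?t < u" "u < ?h + ?t" using x u less_iff he unfolding 1 2 by simp_all
      have "\<exists>b<a. x = ?v b \<or> x = ?v (rv b)"
      proof -
        \<comment> \<open>The index of the pair containing entry \<open>u\<close>, counted from the
          cut at \<open>?h\<close> to either side; lying strictly inside the pair \<open>?t\<close>
          makes it smaller.\<close>
        define t' where "t' = (if ?h \<le> u then u - ?h else ?h - 1 - u)"
        have t': "t' < ?t" using ub unfolding t'_def by auto
        have "m j + t' < CARD('n)" using t' t pos_less_card[of a] by linarith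
        then obtain b :: 'n where b: "pos b = m j + t'" using pos_surj by blast
        have ba: "b < a" using b t' t by (simp flip: pos_less_iff)
        have bb: "bi b = j" by (rule bi_eqI) (use b t' t psum_Suc[OF jr] in linarith)+
        have rb: "bi (rv b) = j" using bi_rv[of b] bb j by simp
        have "pos (rv b) - m j = e - 1 - t'"
        proof -
          have "m j + (m j + e) = CARD('n)" using mj psum_Suc[OF jr] j dj by simp
          then show ?thesis using pos_rv[of b] b t' te by linarith
        qed
        then have "?v (rv b) = ?M ! (?h - 1 - t')"
          by (rule high[OF rb]) (use t' te in linarith)
        moreover have "?v b = ?M ! (?h + t')" using low[OF bb] b t' te by simp
        ultimately show ?thesis using ba u ub unfolding t'_def by (cases "?h \<le> u") auto
      qed
      then show False using x(1) by auto
    qed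
  qed
qed

end

lemma contraction_iff_dual:
  fixes D C0 :: "'n flag set"
  assumes D: "open_orbit (sym_dims ds e) D" and C: "base_cycle (sym_dims ds e) D C0"
    and min: "minimal_rep (sym_dims ds e) w"
  shows "generalized_double_box_contraction ds e w \<longleftrightarrow>
    schubert (sym_dims ds e) w \<in> dual_schubert_varieties (sym_dims ds e) C0"
proof -
  have w: "w \<in> permutations_of_set UNIV" using min by (simp add: minimal_rep_def)
  interpret B: block_fun "blk w" r "\<lambda>x. at_pos w (rv (inv (at_pos w) x))" by (rule block_fun_blk[OF w])
  let ?S = "schubert (sym_dims ds e) w"
  have dual: "?S \<in> dual_schubert_varieties (sym_dims ds e) C0
      \<longleftrightarrow> card (len_set w) + card half = card Low \<and> ?S \<inter> C0 \<noteq> {}"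
    unfolding dual_schubert_varieties_def complex_dim_base_cycle[OF D C] complex_dim_flags
    using min complex_dim_schubert[OF w] by auto
  show ?thesis
    unfolding dual contraction_iff_contracted[OF w] dim_condition_iff[OF w]
  proof
    assume c: "B.contracted"
    then have dbc: "generalized_double_box_contraction ds e w"
      unfolding contraction_iff_contracted[OF w] .
    obtain F0 where F0: "C0 = orbit SO_R F0" "F0 \<in> D" using C by (auto simp: base_cycle_def)
    have F0C: "F0 \<in> C0" unfolding F0(1) orbit_def
      by (rule image_eqI[of _ _ "mat 1"]) (simp_all add: SO_R_iff)
    have less: "at_pos (hat w) (rv a) < at_pos (hat w) a" if "a < rv a" for a
      using hat_nested[OF w min dbc that] by (simp add: immediate_left_def)
    obtain b where b: "b \<in> Borel" "act b (act (perm_mat (at_pos (hat w))) bf) \<in> C0"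
      using cell_meets_orbit[OF bij_at_pos[OF hat_perm[OF w]] less two_le_card
          base_cycle_isotropic(2,1)[OF D C F0C]] F0(1) by blast
    have "act (perm_mat (at_pos (hat w))) bf = flag_proj (sym_dims ds e) (coord_flag (hat w))"
      by (rule flag_proj_perm[OF hat_perm[OF w], symmetric])
    \<comment> \<open>Only the sets of entries in the blocks enter the projected flag, so the
      rearranged word represents the same point as \<open>w\<close>. The rearrangement serves to put
      the larger entry first in every mirror pair.\<close>
    also have "\<dots> = flag_proj (sym_dims ds e) (coord_flag w)"
      by (rule cell_eqI[OF hat_perm[OF w] w]) (rule set_take_hat[OF w])
    finally have "act b (flag_proj (sym_dims ds e) (coord_flag w)) \<in> C0" using b by simp
    moreover have "act b (flag_proj (sym_dims ds e) (coord_flag w)) \<in> ?S"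
      using cell_subset_schubert[OF w] b(1) by (auto simp: orbit_def)
    ultimately have "?S \<inter> C0 \<noteq> {}" by blast
    moreover have "2 * B.invs = card {(x, y). blk w x < blk w y} + card {x. r \<le> 2 * blk w x}"
      by (rule B.contracted_invs[OF c])
    ultimately show "2 * B.invs = card {(x, y). blk w x < blk w y} + card {x. r \<le> 2 * blk w x} \<and> ?S \<inter> C0 \<noteq> {}"
      by blast
  next
    assume *: "2 * B.invs = card {(x, y). blk w x < blk w y} + card {x. r \<le> 2 * blk w x} \<and> ?S \<inter> C0 \<noteq> {}"
    then obtain F where F: "F \<in> ?S" "F \<in> C0" by blast
    note iso = base_cycle_isotropic(2,1)[OF D C F(2)]
    have "B.meets"
      unfolding B.meets_def
    proof (intro allI impI)
      fix k i assume i: "0 < i" "i < r"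
      have ge: "card {y \<in> ini k. blk w y < i'} \<le> vec.dim (F ! (i' - 1) \<inter> crd (ini k))" if "0 < i'" "i' < r" for i'
      proof -
        have "card (set (take (m (Suc (i' - 1))) w) \<inter> ini k) \<le> vec.dim (F ! (i' - 1) \<inter> crd (ini k))"
          by (rule schubert_dim_ge[OF w F(1)]) (use that in simp)
        moreover have "set (take (m (Suc (i' - 1))) w) \<inter> ini k = {y \<in> ini k. blk w y < i'}"
          unfolding set_take_blk[OF w] using that by auto
        ultimately show ?thesis by simp
      qed
      show "card {y \<in> ini k. blk w y < i} + card {y \<in> ini k. blk w y < r - i} \<le> card (ini k :: 'n set)"
      proof -
        have "0 < r - i" "r - i < r" using i by auto
        then show ?thesis using ge[OF i] ge[of "r - i"] meets_of_isotropic[OF iso i, of k] by linarith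
      qed
    qed
    then show "B.contracted" using B.invs_contracted * by blast
  qed
qed

lemma hat_eq_imp:
  assumes "minimal_rep (sym_dims ds e) w" "minimal_rep (sym_dims ds e) v"
    and "\<And>i. i < r \<Longrightarrow> set (take (m (Suc i)) (hat w)) = set (take (m (Suc i)) (hat v))"
  shows "w = v"
proof (rule minimal_rep_eqI[OF assms(1,2)])
  fix i assume "i < r"
  then show "set (take (m (Suc i)) w) = set (take (m (Suc i)) v)"
    using assms set_take_hat[of w "Suc i"] set_take_hat[of v "Suc i"] by (simp add: minimal_rep_def)
qed

end

section \<open>Complete flags and the lifting map\<close>

lemma blocks_replicate_1: "length w = k \<Longrightarrow> blocks (replicate k 1) w = map (\<lambda>x. [x]) w"
proof (induction k arbitrary: w)
  case (Suc k)
  then obtain x u where "w = x # u" by (cases w) auto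
  with Suc show ?case by simp
qed simp

lemma sym_dims_full: "sym_dims (replicate (k div 2) 1) (k mod 2) = replicate k 1"
proof -
  have "sym_dims (replicate (k div 2) 1) (k mod 2) = replicate (k div 2 + k mod 2 + k div 2) 1"
    by (cases "even k") (auto simp: sym_dims_def replicate_add odd_iff_mod_2_eq_one replicate_append_same)
  also have "k div 2 + k mod 2 + k div 2 = k" by presburger
  finally show ?thesis .
qed

lemma minimal_rep_full:
  "w \<in> permutations_of_set UNIV \<Longrightarrow> minimal_rep (replicate CARD('n) 1) (w :: 'n::{finite,linorder} list)"
  unfolding minimal_rep_def by (simp only: blocks_replicate_1[OF perm_list(3)]) auto

context sym_pair
begin

text \<open>For complete flags each stage consists of a single pair, the values at position
  \<open>j\<close> and at its mirror position, so the nestedness of the rearrangement is literally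
  the condition.\<close>

lemma contraction_full:
  assumes min: "minimal_rep (sym_dims ds e) w" and dbc: "generalized_double_box_contraction ds e w"
  shows "generalized_double_box_contraction (replicate (CARD('n) div 2) 1) (CARD('n) mod 2) (hat w)"
  unfolding generalized_double_box_contraction_def Let_def length_replicate
proof (intro allI impI)
  let ?ds = "replicate (CARD('n) div 2) (1 :: nat)" and ?e = "CARD('n) mod 2"
  let ?v = "at_pos (hat w)"
  have w: "w \<in> permutations_of_set UNIV" using min by (simp add: minimal_rep_def)
  note len = perm_list(3)[OF hat_perm[OF w]]
  fix j assume j: "j < CARD('n) div 2"
  have blocks: "blocks (sym_dims ?ds ?e) (hat w) = map (\<lambda>x. [x]) (hat w)"
    unfolding sym_dims_full by (rule blocks_replicate_1[OF len])
  have blk: "left_block ?ds ?e (hat w) (pos b) = [?v b]" "right_block ?ds ?e (hat w) (pos b) = [?v (rv b)]" for b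
  proof -
    have "CARD('n) - Suc (pos b) = pos (rv b)" using pos_rv[of b] by linarith
    then show "left_block ?ds ?e (hat w) (pos b) = [?v b]" "right_block ?ds ?e (hat w) (pos b) = [?v (rv b)]"
      unfolding left_block_def right_block_def blocks using len pos_less_card[of b]
      by (simp_all add: rev_map rev_nth at_pos_def)
  qed
  have "j < CARD('n)" using j by linarith
  then obtain a :: 'n where a: "pos a = j" using pos_surj by blast
  have "pos a < pos (rv a)" using pos_rv[of a] j unfolding a by linarith
  then have arv: "a < rv a" by simp
  have R: "(\<Union>i<j. set (left_block ?ds ?e (hat w) i) \<union> set (right_block ?ds ?e (hat w) i)) = (\<Union>b<a. {?v b, ?v (rv b)})"
  proof -
    have "{..<j} = pos ` {..<a}"
    proof (intro subset_antisym subsetI)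
      fix i assume i: "i \<in> {..<j}"
      then have "i < CARD('n)" using j by auto
      then obtain b :: 'n where b: "pos b = i" using pos_surj by blast
      then have "b < a" using i a by (simp flip: pos_less_iff)
      then show "i \<in> pos ` {..<a}" using b by blast
    qed (auto simp flip: a)
    then show ?thesis by (simp only: image_image blk) auto
  qed
  have nth: "?ds ! j = 1" using j by simp
  show "\<exists>prs :: ('n \<times> 'n) set. card prs = ?ds ! j \<and>
      (\<forall>(l, k) \<in> prs. immediate_left (UNIV - (\<Union>i<j. set (left_block ?ds ?e (hat w) i) \<union> set (right_block ?ds ?e (hat w) i))) l k) \<and>
      pairwise (\<lambda>(l, k) (l', k'). disjnt {l, k} {l', k'}) prs \<and>
      set (left_block ?ds ?e (hat w) j) = snd ` prs \<and> set (right_block ?ds ?e (hat w) j) = fst ` prs"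
    unfolding R nth
    by (rule exI[of _ "{(?v (rv a), ?v a)}"])
      (use hat_nested[OF w min dbc arv] blk[of a] in \<open>simp add: a\<close>)
qed

lemma lifting_map:
  fixes D C0 Dhat Chat0 :: "'n flag set"
  assumes D: "open_orbit (sym_dims ds e) D" and C: "base_cycle (sym_dims ds e) D C0"
    and Dhat: "open_orbit (replicate CARD('n) 1) Dhat" and Chat: "base_cycle (replicate CARD('n) 1) Dhat Chat0"
  shows "\<exists>f. (\<forall>w. minimal_rep (sym_dims ds e) w \<and>
        schubert (sym_dims ds e) w \<in> dual_schubert_varieties (sym_dims ds e) C0 \<longrightarrow>
        f (schubert (sym_dims ds e) w) = schubert (replicate CARD('n) 1) (hat w)) \<and>
      f ` dual_schubert_varieties (sym_dims ds e) C0 \<subseteq> dual_schubert_varieties (replicate CARD('n) 1) Chat0 \<and>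
      inj_on f (dual_schubert_varieties (sym_dims ds e) C0)"
proof -
  let ?d = "sym_dims ds e" and ?full = "replicate CARD('n) (1 :: nat)"
  let ?dual = "dual_schubert_varieties ?d C0"
  interpret Y: sym_pair "replicate (CARD('n) div 2) 1" "CARD('n) mod 2" ty
  proof
    show "replicate (CARD('n) div 2) (1 :: nat) \<noteq> []" using two_le_card by auto
    show "sum_list (sym_dims (replicate (CARD('n) div 2) 1) (CARD('n) mod 2)) = CARD('n)"
      unfolding sym_dims_full by (simp add: sum_list_replicate)
  qed simp
  have perm: "w \<in> permutations_of_set UNIV" if "minimal_rep ?d w" for w :: "'n list"
    using that by (simp add: minimal_rep_def)
  \<comment> \<open>The map is defined on varieties rather than on permutations; the choice is
    harmless because a Schubert variety determines its minimal representative.\<close>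
  define f where "f S = schubert ?full (hat (SOME w. minimal_rep ?d w \<and> schubert ?d w = S))" for S
  have unique: "w = v" if "minimal_rep ?d w" "minimal_rep ?d v" "schubert ?d w = schubert ?d v"
    for w v :: "'n list"
    using minimal_rep_eqI[OF that(1,2)] schubert_eq_imp[OF perm[OF that(1)] perm[OF that(2)] that(3)] by blast
  have f: "f (schubert ?d w) = schubert ?full (hat w)" if w: "minimal_rep ?d w" for w
  proof -
    have "(SOME v. minimal_rep ?d v \<and> schubert ?d v = schubert ?d w) = w"
      by (rule some_equality) (use w unique in blast)+
    then show ?thesis by (simp add: f_def)
  qed
  have dual: "\<exists>w. minimal_rep ?d w \<and> S = schubert ?d w" if "S \<in> ?dual" for S
    using that unfolding dual_schubert_varieties_def by blast
  have maps: "schubert ?full (hat w) \<in> dual_schubert_varieties ?full Chat0"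
    if w: "minimal_rep ?d w" and S: "schubert ?d w \<in> ?dual" for w
  proof -
    have "generalized_double_box_contraction ds e w" using contraction_iff_dual[OF D C w] S by blast
    note * = contraction_full[OF w this]
    have "minimal_rep ?full (hat w)" by (rule minimal_rep_full[OF hat_perm[OF perm[OF w]]])
    then show ?thesis
      using Y.contraction_iff_dual[unfolded sym_dims_full, OF Dhat Chat] * by blast
  qed
  have "inj_on f ?dual"
  proof (rule inj_onI)
    fix S T assume ST: "S \<in> ?dual" "T \<in> ?dual" "f S = f T"
    obtain w v where w: "minimal_rep ?d w" "S = schubert ?d w" and v: "minimal_rep ?d v" "T = schubert ?d v"
      using dual[OF ST(1)] dual[OF ST(2)] by blast
    have eq: "schubert ?full (hat w) = schubert ?full (hat v)"
      using ST(3) unfolding w(2) v(2) f[OF w(1)] f[OF v(1)] .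
    have full: "set (take (Suc k) (hat w)) = set (take (Suc k) (hat v))" if "k < CARD('n)" for k
      using Y.schubert_eq_imp[unfolded sym_dims_full, OF hat_perm[OF perm[OF w(1)]] hat_perm[OF perm[OF v(1)]] eq, of k] that
      by (simp add: psum_def sum_list_replicate)
    have "w = v"
    proof (rule hat_eq_imp[OF w(1) v(1)])
      fix i
      show "set (take (m (Suc i)) (hat w)) = set (take (m (Suc i)) (hat v))"
        using full[of "m (Suc i) - 1"] m_le[of "Suc i"] by (cases "m (Suc i)") auto
    qed
    then show "S = T" using w(2) v(2) by simp
  qed
  moreover have "f ` ?dual \<subseteq> dual_schubert_varieties ?full Chat0"
  proof (rule image_subsetI)
    fix S assume S: "S \<in> ?dual"
    then obtain w where w: "minimal_rep ?d w" "S = schubert ?d w" using dual by blast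
    then show "f S \<in> dual_schubert_varieties ?full Chat0" using S f[OF w(1)] maps[OF w(1)] by simp
  qed
  ultimately show ?thesis using f by (intro exI[of _ f] conjI allI impI) blast+
qed

end

theorem theorem14:
  fixes ds :: "nat list" and e :: nat
    and D C0 :: "'n::{finite,linorder} flag set"
  assumes "ds \<noteq> []" and "\<forall>d \<in> set ds. 0 < d"
    and "sum_list (sym_dims ds e) = CARD('n)"
    and "open_orbit (sym_dims ds e) D"
    and "base_cycle (sym_dims ds e) D C0"
  shows "(\<forall>w :: 'n list. minimal_rep (sym_dims ds e) w \<longrightarrow>
           (generalized_double_box_contraction ds e w \<longleftrightarrow>
            schubert (sym_dims ds e) w \<in> dual_schubert_varieties (sym_dims ds e) C0)) \<and>
         (\<forall>Dhat Chat0 :: 'n flag set.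
           open_orbit (replicate CARD('n) 1) Dhat \<longrightarrow>
           flag_proj (sym_dims ds e) ` Dhat = D \<longrightarrow>
           base_cycle (replicate CARD('n) 1) Dhat Chat0 \<longrightarrow>
           (\<exists>f. (\<forall>w. minimal_rep (sym_dims ds e) w \<and>
                     schubert (sym_dims ds e) w \<in> dual_schubert_varieties (sym_dims ds e) C0 \<longrightarrow>
                     f (schubert (sym_dims ds e) w) =
                       schubert (replicate CARD('n) 1) (canonical_rearrangement ds e w)) \<and>
                f ` dual_schubert_varieties (sym_dims ds e) C0
                  \<subseteq> dual_schubert_varieties (replicate CARD('n) 1) Chat0 \<and>
                inj_on f (dual_schubert_varieties (sym_dims ds e) C0)))"
proof -
  interpret sym_pair ds e "TYPE('n)"
    by (rule sym_pair.intro[OF assms(1-3)])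
  show ?thesis
    using contraction_iff_dual[OF assms(4,5)] lifting_map[OF assms(4,5)] by blast
qed

end
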